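(* The class $\mathcal{C}(0)$ is empty, and the following two assertions are true: (Hypothesis I for $\gamma=0$) for every $\mu\in\mathcal{OS}\cap\mathcal{ID}$, if $\mu^{n*}\in\mathcal{L}(0)$ for some $n\in\mathbb N$, then $\mu^{(n+1)*}\in\mathcal{L}(0)$; (Hypothesis II for $\gamma=0$) for every $\mu\in\mathcal{OS}\cap\mathcal{ID}$, if $\mu^{n*}\in\mathcal{L}(0)$ for some $n\in\mathbb N$, then $\mu\in\mathcal{L}(0)$. Moreover, for $\mu\in\mathcal{OS}\cap\mathcal{ID}$ with associated $\nu_1$ and $n_0$, one has $\mu\in\mathcal{A}(0)$ if and only if $$\lim_{x\to\infty}\frac{\nu_1((x,x+1])}{\overline{\nu_1^{n_0*}}(x)}=0.$$ If $\mu\in\mathcal{A}(0)$, then $\nu_1^{n*}\notin\mathcal{L}(0)\cap\mathcal{OS}$ for $1\le n\le n_0-1$ and $\nu_1^{n*}\in\mathcal{L}(0)\cap\mathcal{OS}$ for all $n\ge n_0$.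
   Context: $\mathbb N=\{1,2,\dots\}$ and $a\mathbb N=\{a,2a,3a,\dots\}$. "Distribution" means probability distribution on $\mathbb R$; $\bar\xi(x)=\xi((x,\infty))$ is the tail of a measure $\xi$; $\rho^{n*}$ is the $n$-th convolution power. $f\sim g$ means $\lim_{x\to\infty}f(x)/g(x)=1$; $f\asymp g$ means $0<\liminf_{x\to\infty}f(x)/g(x)\le\limsup_{x\to\infty}f(x)/g(x)<\infty$. $\rho\in\mathcal{L}(0)$ if $\bar\rho(x)>0$ for all $x>0$ and $\bar\rho(x+a)\sim\bar\rho(x)$ for every $a\in\mathbb R$. $\rho\in\mathcal{OS}$ if $\bar\rho(x)>0$ for all $x>0$ and $\overline{\rho^{2*}}(x)\asymp\bar\rho(x)$. $\mathcal{ID}$ is the class of infinitely divisible distributions on $\mathbb R$. For $\mu\in\mathcal{ID}$, $\nu$ denotes its Lévy measure and $\mu^{t*}$ ($t>0$) its $t$-th convolution power (the distribution with characteristic function the $t$-th power of that of $\mu$, i.e. the law at time $t$ of the associated Lévy process). When $\bar\nu(c)>0$ for all $c>0$ (which is the case for $\mu\in\mathcal{OS}\cap\mathcal{ID}$), $\nu_1(dx):=1_{(1,\infty)}(x)\nu(dx)/\bar\nu(1)$. For $\mu\in\mathcal{OS}\cap\mathcal{ID}$ it is known that $\nu_1^{n*}\in\mathcal{OS}$ for some $n\in\mathbb N$, and $n_0:=\min\{n\in\mathbb N:\nu_1^{n*}\in\mathcal{OS}\}$. $T(\mu,0):=\{t>0:\mu^{t*}\in\mathcal{L}(0)\}$,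 $\mathcal{A}(0):=\{\mu\in\mathcal{OS}\cap\mathcal{ID}:T(\mu,0)=(0,\infty)\}$, $\mathcal{C}(0):=\{\mu\in\mathcal{OS}\cap\mathcal{ID}:T(\mu,0)=a_0\mathbb N\text{ for some }a_0>0\}$. *)

theory Defs
  imports "HOL-Probability.Probability"
begin

definition tail :: "real measure \<Rightarrow> real \<Rightarrow> real" where
  "tail \<xi> x = measure \<xi> {x<..}"

primrec conv_pow :: "real measure \<Rightarrow> nat \<Rightarrow> real measure" where
  "conv_pow \<rho> 0 = return borel 0"
| "conv_pow \<rho> (Suc n) = convolution \<rho> (conv_pow \<rho> n)"

definition tail_equiv :: "(real \<Rightarrow> real) \<Rightarrow> (real \<Rightarrow> real) \<Rightarrow> bool" where
  "tail_equiv f g \<longleftrightarrow> ((\<lambda>x. f x / g x) \<longlongrightarrow> 1) at_top"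

definition tail_comparable :: "(real \<Rightarrow> real) \<Rightarrow> (real \<Rightarrow> real) \<Rightarrow> bool" where
  "tail_comparable f g \<longleftrightarrow>
     0 < Liminf at_top (\<lambda>x. ereal (f x / g x)) \<and>
     Limsup at_top (\<lambda>x. ereal (f x / g x)) < \<infinity>"

definition class_L0 :: "real measure set" where
  "class_L0 = {\<rho>. real_distribution \<rho> \<and> (\<forall>x>0. tail \<rho> x > 0) \<and>
     (\<forall>a. tail_equiv (\<lambda>x. tail \<rho> (x + a)) (tail \<rho>))}"

definition class_OS :: "real measure set" where
  "class_OS = {\<rho>. real_distribution \<rho> \<and> (\<forall>x>0. tail \<rho> x > 0) \<and>
     tail_comparable (tail (conv_pow \<rho> 2)) (tail \<rho>)}"

definition class_ID :: "real measure set" where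
  "class_ID = {\<mu>. real_distribution \<mu> \<and>
     (\<forall>n\<ge>1. \<exists>\<rho>. real_distribution \<rho> \<and> conv_pow \<rho> n = \<mu>)}"

text \<open>The \<open>t\<close>-th power of the characteristic function is taken with its continuous
  logarithm \<open>\<psi>\<close> vanishing at 0. Such a \<open>\<psi>\<close> is unique, and for infinitely divisible \<open>\<mu>\<close>
  and \<open>t > 0\<close> exactly one distribution satisfies the description; for other arguments the
  value may be unspecified.\<close>

definition conv_rpow :: "real measure \<Rightarrow> real \<Rightarrow> real measure" where
  "conv_rpow \<mu> t = (THE \<rho>. real_distribution \<rho> \<and>
     (\<exists>\<psi> :: real \<Rightarrow> complex. continuous_on UNIV \<psi> \<and> \<psi> 0 = 0 \<and>
        (\<forall>z. char \<mu> z = exp (\<psi> z)) \<and>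
        (\<forall>z. char \<rho> z = exp (of_real t * \<psi> z))))"

text \<open>\<open>\<nu>\<close> is the Levy measure of \<open>\<mu>\<close>, in the sense of the Levy-Khintchine representation with
  Gaussian variance \<open>A\<close> and drift \<open>b\<close>. Which truncation function is used affects \<open>b\<close> only.\<close>

definition is_levy_measure :: "real measure \<Rightarrow> real measure \<Rightarrow> bool" where
  "is_levy_measure \<mu> \<nu> \<longleftrightarrow>
     sets \<nu> = sets borel \<and> emeasure \<nu> {0} = 0 \<and>
     (\<integral>\<^sup>+ x. ennreal (min 1 (x\<^sup>2)) \<partial>\<nu>) < \<infinity> \<and>
     (\<exists>A b :: real. A \<ge> 0 \<and>
        (\<forall>z. char \<mu> z = exp (- of_real (A * z\<^sup>2 / 2) + \<i> * of_real (b * z) +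
           (CLINT x|\<nu>. iexp (z * x) - 1
              - \<i> * of_real (z * x * indicator {-1..1} x)))))"

text \<open>The normalised restriction to \<open>(1, \<infinity>)\<close>.\<close>

definition levy_tail_dist :: "real measure \<Rightarrow> real measure" where
  "levy_tail_dist \<nu> = uniform_measure \<nu> {1<..}"

definition OS_index :: "real measure \<Rightarrow> nat" where
  "OS_index \<rho> = (LEAST n. n \<ge> 1 \<and> conv_pow \<rho> n \<in> class_OS)"

definition T0 :: "real measure \<Rightarrow> real set" where
  "T0 \<mu> = {t. t > 0 \<and> conv_rpow \<mu> t \<in> class_L0}"

definition class_A0 :: "real measure set" where
  "class_A0 = {\<mu> \<in> class_OS \<inter> class_ID. T0 \<mu> = {0<..}}"

definition class_C0 :: "real measure set" where
  "class_C0 = {\<mu> \<in> class_OS \<inter> class_ID.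
     \<exists>a0>0. T0 \<mu> = {a0 * real n | n. n \<ge> 1}}"

definition hypothesis_I0 :: bool where
  "hypothesis_I0 \<longleftrightarrow> (\<forall>\<mu> \<in> class_OS \<inter> class_ID. \<forall>n\<ge>1.
     conv_pow \<mu> n \<in> class_L0 \<longrightarrow> conv_pow \<mu> (n + 1) \<in> class_L0)"

definition hypothesis_II0 :: bool where
  "hypothesis_II0 \<longleftrightarrow> (\<forall>\<mu> \<in> class_OS \<inter> class_ID.
     (\<exists>n\<ge>1. conv_pow \<mu> n \<in> class_L0) \<longrightarrow> \<mu> \<in> class_L0)"

end

theory Submission
  imports Defs
begin

text \<open>Write \<open>S\<close> for the tail of \<open>\<mu> \<in> OS\<close>. Then \<open>S (x - a) \<le> C S x\<close>, so \<open>S\<close> decays at most exponentially, and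
  a distribution \<open>\<rho>\<close> whose tail is comparable to \<open>S\<close> lies in \<open>L(0)\<close> iff \<open>\<rho> (x, x + 1] = o(S x)\<close>. Among
  distributions with tail \<open>O(S)\<close> this property passes to convolutions and to convolution factors, which
  settles both hypotheses and shows that \<open>T(\<mu>, 0)\<close>
  contains \<open>[1, \<infinity>)\<close> as soon as it is unbounded, so it is never \<open>a\<^sub>0 \<nat>\<close>.

  For the remaining part, \<open>\<mu>\<^sup>t\<close> is the convolution of a compound Poisson law with rate \<open>t \<lambda>\<close> and jump law
  \<open>\<nu>\<^sub>1\<close> with a distribution all of whose positive exponential moments are finite. The latter is
  invisible at the scale of \<open>S\<close>. Comparing the Poisson mixtures at times \<open>t\<close> and \<open>2 t\<close> bounds the
  tail of the \<open>k\<close>-th power of \<open>\<nu>\<^sub>1\<close> by \<open>C k! / (2 t \<lambda>)\<^sup>k S\<close>, so the Poisson series can be truncated: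
  some power of \<open>\<nu>\<^sub>1\<close> has tail comparable to \<open>S\<close>, a power of \<open>\<nu>\<^sub>1\<close> is in \<open>OS\<close> iff its tail is, and \<open>\<mu>\<^sup>t \<in> L(0)\<close>
  iff \<open>\<nu>\<^sub>1 (x, x + 1] = o(S x)\<close>, for each \<open>t\<close>.\<close>

section \<open>Convolutions and tails\<close>

text \<open>A convolution factor inherits negligible unit masses because the other factor charges
  some unit interval; the shift bound then moves the resulting window back at the cost of a
  constant. This is why every law is tested against the one function \<open>S\<close> and not
  against its own tail. Two obstacles shape the rest. At times \<open>t < 1\<close> the law at time
  \<open>t\<close> need not contain \<mu> as a factor, so comparability with \<open>S\<close> must
  come from the jumps: one Poisson term suffices, once a power of the jump law is known to be
  comparable. And removing the light-tailed factor of \<mu> must not lose the lower bound on the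
  tail: the error is made at most \<open>S / 2\<close> and absorbed. Doubling the time produces
  summability: the Poisson weight at time \<open>t\<close> divided by the one at time
  \<open>2 t\<close> is a constant times \<open>2^(-k)\<close>. Since \<open>conv_rpow\<close> is a
  definite description, existence of real powers has to be proved: roots of \<mu> supply compound
  Poisson approximations, and Levy continuity supplies their limit. The light-tailed factor arises
  in the same way.\<close>

lemma real_distribution_of_prob_space: "prob_space M \<Longrightarrow> sets M = sets borel \<Longrightarrow> real_distribution M"
  by (simp add: real_distribution_def real_distribution_axioms_def)

lemma real_distribution_convolution:
  assumes "real_distribution M" "real_distribution N"
  shows "real_distribution (M \<star> N)"
proof -
  interpret M: real_distribution M by fact
  interpret N: real_distribution N by fact
  interpret P: pair_prob_space M N ..
  show ?thesis
    unfolding convolution_def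
    by (rule real_distribution_of_prob_space) (auto intro!: P.prob_space_distr)
qed

lemma real_distribution_return: "real_distribution (return borel a)"
  by (intro real_distribution_of_prob_space prob_space_return) auto

lemma real_distribution_conv_pow: "real_distribution M \<Longrightarrow> real_distribution (conv_pow M n)"
  by (induction n) (auto intro: real_distribution_convolution real_distribution_return)

lemma char_convolution:
  assumes "real_distribution M" "real_distribution N"
  shows "char (M \<star> N) t = char M t * char N t"
proof -
  interpret M: real_distribution M by fact
  interpret N: real_distribution N by fact
  interpret P: pair_prob_space M N ..
  have "char (M \<star> N) t = (CLINT p|M \<Otimes>\<^sub>M N. iexp (t * (fst p + snd p)))"
    unfolding convolution_def char_def by (subst integral_distr) (auto simp: split_beta')
  also have "\<dots> = (CLINT x|M. CLINT y|N. iexp (t * (x + y)))"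
    by (subst P.integral_fst'[symmetric])
       (auto intro!: P.integrable_const_bound[where B=1])
  also have "\<dots> = (CLINT x|M. iexp (t * x) * char N t)"
    unfolding char_def by (simp add: exp_add ring_distribs)
  finally show ?thesis
    by (simp add: char_def)
qed

lemma char_return: "char (return borel a) t = iexp (t * a)"
  unfolding char_def by (subst integral_return) auto

lemma char_conv_pow: "real_distribution M \<Longrightarrow> char (conv_pow M n) t = char M t ^ n"
  by (induction n) (simp_all add: char_return char_convolution real_distribution_conv_pow)

lemma convolution_return_0:
  assumes "real_distribution M" shows "(M \<star> return borel 0) = M"
  by (rule Levy_uniqueness)
     (auto simp: fun_eq_iff char_convolution char_return assms real_distribution_return
           intro!: real_distribution_convolution)

lemma conv_pow_1: "real_distribution M \<Longrightarrow> conv_pow M (Suc 0) = M"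
  by (simp add: convolution_return_0)

lemma conv_pow_mult:
  assumes "real_distribution M"
  shows "conv_pow M (m * n) = conv_pow (conv_pow M m) n"
  by (rule Levy_uniqueness)
     (auto simp: fun_eq_iff char_conv_pow power_mult assms real_distribution_conv_pow)

lemma convolution_commute:
  "real_distribution M \<Longrightarrow> real_distribution N \<Longrightarrow> (M \<star> N) = (N \<star> M)"
  by (rule Levy_uniqueness)
     (auto simp: fun_eq_iff char_convolution intro!: real_distribution_convolution)

lemma measure_convolution:
  assumes "real_distribution M" "real_distribution N" and A: "A \<in> sets borel"
  shows "measure (M \<star> N) A = (\<integral>x. measure N {a. x + a \<in> A} \<partial>M)"
    and "integrable M (\<lambda>x. measure N {a. x + a \<in> A})"
proof -
  interpret M: real_distribution M by fact
  interpret N: real_distribution N by fact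
  interpret P: pair_prob_space M N ..
  interpret C: real_distribution "M \<star> N"
    using assms by (intro real_distribution_convolution)
  have S: "(\<lambda>p. fst p + snd p) -` A \<inter> space (M \<Otimes>\<^sub>M N) \<in> sets (M \<Otimes>\<^sub>M N)"
    using A by measurable
  have *: "(\<lambda>x. measure N {a. x + a \<in> A}) \<in> borel_measurable M"
  proof -
    have "(\<lambda>x. measure N (Pair x -` ((\<lambda>p. fst p + snd p) -` A \<inter> space (M \<Otimes>\<^sub>M N)))) \<in> borel_measurable M"
      using N.measurable_emeasure_Pair[OF S] by (simp add: measure_def)
    also have "(\<lambda>x. Pair x -` ((\<lambda>p. fst p + snd p) -` A \<inter> space (M \<Otimes>\<^sub>M N))) = (\<lambda>x. {a. x + a \<in> A})"
      by (auto simp: space_pair_measure fun_eq_iff)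
    then have "(\<lambda>x. measure N (Pair x -` ((\<lambda>p. fst p + snd p) -` A \<inter> space (M \<Otimes>\<^sub>M N)))) = (\<lambda>x. measure N {a. x + a \<in> A})"
      by metis
    finally show ?thesis .
  qed
  show I: "integrable M (\<lambda>x. measure N {a. x + a \<in> A})"
    using * by (intro M.integrable_const_bound[where B=1]) auto
  have "emeasure (M \<star> N) A = (\<integral>\<^sup>+x. emeasure N {a. a + x \<in> A} \<partial>M)"
    using A by (intro convolution_emeasure) (auto intro: M.finite_measure N.finite_measure)
  also have "\<dots> = (\<integral>\<^sup>+x. ennreal (measure N {a. x + a \<in> A}) \<partial>M)"
    by (simp add: N.emeasure_eq_measure add.commute)
  also have "\<dots> = ennreal (\<integral>x. measure N {a. x + a \<in> A} \<partial>M)"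
    using I by (intro nn_integral_eq_integral) auto
  finally show "measure (M \<star> N) A = (\<integral>x. measure N {a. x + a \<in> A} \<partial>M)"
    by (simp add: C.emeasure_eq_measure integral_nonneg)
qed

lemma tail_convolution:
  assumes "real_distribution M" "real_distribution N"
  shows "tail (M \<star> N) x = (\<integral>a. tail N (x - a) \<partial>M)"
    and "integrable M (\<lambda>a. tail N (x - a))"
proof -
  have *: "{b. a + b \<in> {x<..}} = {x - a<..}" for a :: real by auto
  show "tail (M \<star> N) x = (\<integral>a. tail N (x - a) \<partial>M)" "integrable M (\<lambda>a. tail N (x - a))"
    using measure_convolution[OF assms, of "{x<..}"] by (simp_all only: tail_def *) auto
qed

lemma tail_nonneg [simp]: "0 \<le> tail M x"
  by (simp add: tail_def)

lemma tail_le_1: "real_distribution M \<Longrightarrow> tail M x \<le> 1"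
  unfolding tail_def using prob_space.prob_le_1 real_distribution_def by blast

lemma tail_mono:
  assumes "real_distribution M" "x \<le> y" shows "tail M y \<le> tail M x"
proof -
  interpret M: real_distribution M by fact
  show ?thesis
    unfolding tail_def using \<open>x \<le> y\<close> by (intro M.finite_measure_mono) auto
qed

lemma measure_Ioc_tail:
  assumes "real_distribution M" "x \<le> y" shows "measure M {x<..y} = tail M x - tail M y"
proof -
  interpret M: real_distribution M by fact
  have "{x<..y} = {x<..} - {y<..}" by auto
  moreover have "measure M ({x<..} - {y<..}) = measure M {x<..} - measure M {y<..}"
    using \<open>x \<le> y\<close> by (intro M.finite_measure_Diff) auto
  ultimately show ?thesis by (simp add: tail_def)
qed

text \<open>For independent summands, membership in \<open>A\<close> and in \<open>B\<close> forces
  the sum into \<open>C\<close>. Half-lines give tail bounds, unit intervals give local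
  ones.\<close>

lemma measure_convolution_ge:
  assumes "real_distribution M" "real_distribution N"
    and "A \<in> sets borel" "B \<in> sets borel" "C \<in> sets borel"
    and sub: "\<And>a b. a \<in> A \<Longrightarrow> b \<in> B \<Longrightarrow> a + b \<in> C"
  shows "measure M A * measure N B \<le> measure (M \<star> N) C"
proof -
  interpret M: real_distribution M by fact
  interpret N: real_distribution N by fact
  have "measure M A * measure N B = (\<integral>x. indicator A x * measure N B \<partial>M)"
    using assms by simp
  also have "\<dots> \<le> (\<integral>x. measure N {a. x + a \<in> C} \<partial>M)"
  proof (rule integral_mono)
    show "integrable M (\<lambda>x. indicator A x * measure N B)"
      using assms by (intro integrable_mult_left integrable_real_indicator) (auto simp: M.emeasure_finite less_top[symmetric])
    show "integrable M (\<lambda>x. measure N {a. x + a \<in> C})"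
      using assms by (intro measure_convolution)
    fix x
    have "{a. x + a \<in> C} \<in> sets N"
    proof -
      have "(\<lambda>a. x + a) -` C \<inter> space borel \<in> sets borel"
        using assms by (intro measurable_sets) auto
      moreover have "(\<lambda>a. x + a) -` C \<inter> space borel = {a. x + a \<in> C}" by auto
      ultimately show ?thesis by simp
    qed
    then show "indicator A x * measure N B \<le> measure N {a. x + a \<in> C}"
      using sub by (auto simp: indicator_def intro!: N.finite_measure_mono)
  qed
  also have "\<dots> = measure (M \<star> N) C"
    using assms by (simp add: measure_convolution)
  finally show ?thesis .
qed

lemma tail_convolution_ge:
  assumes "real_distribution M" "real_distribution N"
  shows "tail M x * tail N y \<le> tail (M \<star> N) (x + y)"
  unfolding tail_def using assms by (intro measure_convolution_ge) auto

text \<open>In lower tail bounds, convolving with \<open>M\<close> then costs at most a factor 2 and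
  a shift by \<open>a\<close>.\<close>

lemma tail_at_bot:
  assumes "real_distribution M" shows "\<exists>a. tail M a \<ge> 1/2"
proof -
  interpret M: real_distribution M by fact
  have "(\<lambda>n. measure M {- real n<..}) \<longlonglongrightarrow> measure M (\<Union>n. {- real n<..})"
    by (intro M.finite_Lim_measure_incseq) (auto simp: incseq_def)
  also have "(\<Union>n. {- real n<..}) = (UNIV :: real set)"
    by (auto) (metis minus_less_iff reals_Archimedean2)
  finally have "(\<lambda>n. measure M {- real n<..}) \<longlonglongrightarrow> 1"
    using M.prob_space by simp
  then have "eventually (\<lambda>n. measure M {- real n<..} > 1/2) sequentially"
    by (rule order_tendstoD) simp
  then show ?thesis
    unfolding tail_def eventually_sequentially by (metis less_imp_le order_refl)
qed

text \<open>Countably many unit intervals cover the line, so they cannot all be null. This is the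
  local counterpart of \<open>tail_at_bot\<close>.\<close>

lemma exists_unit_interval_pos:
  assumes "real_distribution M" shows "\<exists>z. measure M {z<..z+1} > 0"
proof (rule ccontr)
  interpret M: real_distribution M by fact
  assume "\<not> ?thesis"
  then have 0: "measure M {z<..z+1} = 0" for z
    by (auto simp: zero_less_measure_iff)
  have "(\<Union>i::int. {real_of_int i<..real_of_int i+1}) = UNIV"
  proof -
    have "x \<in> {real_of_int (\<lceil>x\<rceil> - 1)<..real_of_int (\<lceil>x\<rceil> - 1)+1}" for x
      by (simp; linarith)
    then show ?thesis by blast
  qed
  moreover have "(\<Union>i::int. {real_of_int i<..real_of_int i+1}) \<in> null_sets M"
    by (intro null_sets_UN') (auto simp: null_sets_def M.emeasure_eq_measure 0)
  ultimately show False
    using M.emeasure_space_1 by (simp add: null_sets_def)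
qed

text \<open>The classes ask for positivity on the right half-line only; monotonicity extends it, so
  quotients by the tail make sense everywhere.\<close>

lemma tail_pos_all:
  assumes "real_distribution M" "\<And>x. x > 0 \<Longrightarrow> tail M x > 0" shows "tail M x > 0"
  using assms(2)[of "max x 1"] tail_mono[OF assms(1), of x "max x 1"] by linarith

lemma filterlim_at_top_add_const: "LIM x at_top. x + (a::real) :> at_top"
proof -
  have "LIM x at_top. a + x :> at_top"
    by (rule filterlim_tendsto_add_at_top[OF tendsto_const filterlim_ident])
  then show ?thesis by (simp add: add.commute)
qed

section \<open>Unit-interval masses and reformulations of the two tail classes\<close>

definition unit_mass :: "real measure \<Rightarrow> real \<Rightarrow> real" where
  "unit_mass M x = measure M {x<..x + 1}"

lemma unit_mass_nonneg [simp]: "0 \<le> unit_mass M x"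
  by (simp add: unit_mass_def)

lemma unit_mass_tail: "real_distribution M \<Longrightarrow> unit_mass M x = tail M x - tail M (x + 1)"
  by (simp add: unit_mass_def measure_Ioc_tail)

lemma unit_mass_le_tail: "real_distribution M \<Longrightarrow> unit_mass M x \<le> tail M x"
  by (simp add: unit_mass_tail)

text \<open>The quotient is 1 minus the tail ratio for shift 1. Integer shifts telescope, other
  positive shifts are squeezed between 1 and the ratio at the next integer, and negative shifts are
  reciprocals read at a translated point.\<close>

lemma class_L0_iff:
  assumes R: "real_distribution M" and pos: "\<And>x. tail M x > 0"
  shows "M \<in> class_L0 \<longleftrightarrow> ((\<lambda>x. unit_mass M x / tail M x) \<longlongrightarrow> 0) at_top"
proof
  have eq: "unit_mass M x / tail M x = 1 - tail M (x + 1) / tail M x" for x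
    using pos[of x] by (simp add: unit_mass_tail[OF R] field_simps)
  {
    assume "M \<in> class_L0"
    then have "((\<lambda>x. tail M (x + 1) / tail M x) \<longlongrightarrow> 1) at_top"
      by (auto simp: class_L0_def tail_equiv_def)
    then have "((\<lambda>x. 1 - tail M (x + 1) / tail M x) \<longlongrightarrow> 1 - 1) at_top"
      by (intro tendsto_intros)
    then show "((\<lambda>x. unit_mass M x / tail M x) \<longlongrightarrow> 0) at_top"
      by (simp add: eq)
  }
  assume "((\<lambda>x. unit_mass M x / tail M x) \<longlongrightarrow> 0) at_top"
  then have "((\<lambda>x. 1 - unit_mass M x / tail M x) \<longlongrightarrow> 1 - 0) at_top"
    by (intro tendsto_intros)
  then have 1: "((\<lambda>x. tail M (x + 1) / tail M x) \<longlongrightarrow> 1) at_top"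
    by (simp add: eq)
  have N: "((\<lambda>x. tail M (x + real n) / tail M x) \<longlongrightarrow> 1) at_top" for n
  proof (induction n)
    case 0
    show ?case by (simp add: less_imp_neq[OF pos, symmetric])
  next
    case (Suc n)
    have "((\<lambda>x. tail M ((x + real n) + 1) / tail M (x + real n)) \<longlongrightarrow> 1) at_top"
      by (rule filterlim_compose[OF 1 filterlim_at_top_add_const])
    from tendsto_mult[OF this Suc]
    show ?case using pos by (simp add: less_imp_neq[OF pos, symmetric] ac_simps)
  qed
  have P: "((\<lambda>x. tail M (x + a) / tail M x) \<longlongrightarrow> 1) at_top" if "a \<ge> 0" for a
  proof (rule tendsto_sandwich[OF _ _ N tendsto_const])
    show "\<forall>\<^sub>F x in at_top. tail M (x + a) / tail M x \<le> 1"
      using pos tail_mono[OF R, of x "x + a" for x] that by (intro always_eventually allI) (simp add: divide_le_eq)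
    show "\<forall>\<^sub>F x in at_top. tail M (x + real (nat \<lceil>a\<rceil>)) / tail M x \<le> tail M (x + a) / tail M x"
      using that by (intro always_eventually allI divide_right_mono tail_mono[OF R] tail_nonneg) linarith
  qed
  have "((\<lambda>x. tail M (x + a) / tail M x) \<longlongrightarrow> 1) at_top" for a
  proof (cases "a \<ge> 0")
    case False
    from filterlim_compose[OF P[of "-a"] filterlim_at_top_add_const[of a]] False
    have "((\<lambda>x. tail M x / tail M (x + a)) \<longlongrightarrow> 1) at_top" by simp
    from tendsto_inverse[OF this] show ?thesis by simp
  qed (rule P)
  then show "M \<in> class_L0"
    using R pos by (auto simp: class_L0_def tail_equiv_def)
qed

text \<open>The lower half of comparability is automatic, because \<open>tail M 0 * tail M x\<close>
  bounds the tail of the square from below. The asymptotic upper bound becomes global by enlarging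
  the constant.\<close>

lemma class_OS_iff:
  "M \<in> class_OS \<longleftrightarrow> real_distribution M \<and> (\<forall>x. tail M x > 0) \<and>
     (\<exists>C. \<forall>x. tail (M \<star> M) x \<le> C * tail M x)"
proof (intro iffI conjI)
  assume M: "M \<in> class_OS"
  then show R: "real_distribution M" by (simp add: class_OS_def)
  have pos: "tail M x > 0" for x
    by (rule tail_pos_all[OF R]) (use M in \<open>simp add: class_OS_def\<close>)
  then show "\<forall>x. tail M x > 0" by simp
  have 2: "conv_pow M 2 = (M \<star> M)"
    using conv_pow_1[OF R] by (simp add: numeral_2_eq_2)
  from M have "Limsup at_top (\<lambda>x. ereal (tail (M \<star> M) x / tail M x)) < \<infinity>"
    by (simp add: class_OS_def tail_comparable_def 2)
  then obtain C where "Limsup at_top (\<lambda>x. ereal (tail (M \<star> M) x / tail M x)) < ereal C"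
    using ereal_dense2 by blast
  from Limsup_lessD[OF this] have "\<forall>\<^sub>F x in at_top. tail (M \<star> M) x / tail M x < C"
    by simp
  then obtain X where X: "\<And>x. x \<ge> X \<Longrightarrow> tail (M \<star> M) x / tail M x < C"
    by (auto simp: eventually_at_top_linorder)
  show "\<exists>C. \<forall>x. tail (M \<star> M) x \<le> C * tail M x"
  proof (intro exI allI)
    fix x
    \<comment> \<open>Left of \<open>X\<close> the tail is at least \<open>tail M X\<close>, so
      \<open>1 / tail M X\<close> compensates the trivial bound 1.\<close>
    show "tail (M \<star> M) x \<le> max C (1 / tail M X) * tail M x"
    proof (cases "x \<ge> X")
      case True
      then have "tail (M \<star> M) x \<le> C * tail M x"
        using X[OF True] pos[of x] by (simp add: field_simps)
      also have "\<dots> \<le> max C (1 / tail M X) * tail M x"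
        by (intro mult_right_mono) auto
      finally show ?thesis .
    next
      case False
      then have "1 \<le> 1 / tail M X * tail M x"
        using pos[of X] tail_mono[OF R, of x X] by simp
      also have "\<dots> \<le> max C (1 / tail M X) * tail M x"
        by (intro mult_right_mono) auto
      finally show ?thesis
        using tail_le_1[OF real_distribution_convolution[OF R R], of x] by linarith
    qed
  qed
next
  assume *: "real_distribution M \<and> (\<forall>x. tail M x > 0) \<and>
     (\<exists>C. \<forall>x. tail (M \<star> M) x \<le> C * tail M x)"
  then have R: "real_distribution M" and pos: "\<And>x. tail M x > 0" by auto
  from * obtain C where C: "\<And>x. tail (M \<star> M) x \<le> C * tail M x" by auto
  have 2: "conv_pow M 2 = (M \<star> M)"
    using conv_pow_1[OF R] by (simp add: numeral_2_eq_2)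
  have "ereal (tail M 0) \<le> Liminf at_top (\<lambda>x. ereal (tail (M \<star> M) x / tail M x))"
  proof (rule Liminf_bounded, rule always_eventually, rule allI)
    fix x
    show "ereal (tail M 0) \<le> ereal (tail (M \<star> M) x / tail M x)"
      using tail_convolution_ge[OF R R, of 0 x] pos[of x] by (simp add: field_simps)
  qed
  moreover have "Limsup at_top (\<lambda>x. ereal (tail (M \<star> M) x / tail M x)) \<le> ereal C"
  proof (rule Limsup_bounded, rule always_eventually, rule allI)
    fix x
    show "ereal (tail (M \<star> M) x / tail M x) \<le> ereal C"
      using C[of x] pos[of x] by (simp add: field_simps)
  qed
  ultimately show "M \<in> class_OS"
    using R pos by (auto simp: class_OS_def tail_comparable_def 2 intro: less_le_trans[of 0 "ereal (tail M 0)"])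
qed

section \<open>Comparison with an O-subexponential distribution\<close>

lemma tail_convolution_mono:
  assumes "real_distribution M" "real_distribution N" "real_distribution N'"
    and "\<And>x. tail N x \<le> D * tail N' x"
  shows "tail (M \<star> N) x \<le> D * tail (M \<star> N') x"
proof -
  have "tail (M \<star> N) x \<le> (\<integral>a. D * tail N' (x - a) \<partial>M)"
    unfolding tail_convolution[OF assms(1,2)]
    using assms by (intro integral_mono tail_convolution integrable_mult_right) auto
  also have "\<dots> = D * tail (M \<star> N') x"
    by (simp add: tail_convolution[OF assms(1,3)])
  finally show ?thesis .
qed

text \<open>Only positive exponents occur: the classes concern the right tail, and the negative
  jumps of \<mu> may be arbitrarily heavy.\<close>

definition light_tailed :: "real measure \<Rightarrow> bool" where
  "light_tailed M \<longleftrightarrow> (\<forall>\<theta>>0. integrable M (\<lambda>x. exp (\<theta> * x)))"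

text \<open>Markov's inequality for \<open>exp (\<theta> * x)\<close>, whose integral serves as
  \<open>K\<close>.\<close>

lemma light_tailed_tail_le:
  assumes "real_distribution M" "light_tailed M" "\<theta> > 0"
  shows "\<exists>K\<ge>0. \<forall>x. tail M x \<le> K * exp (- \<theta> * x)"
proof (intro exI conjI allI)
  interpret M: real_distribution M by fact
  have I: "integrable M (\<lambda>x. exp (\<theta> * x))"
    using assms by (auto simp: light_tailed_def)
  show "(\<integral>x. exp (\<theta> * x) \<partial>M) \<ge> 0" by simp
  fix x
  have "tail M x * exp (\<theta> * x) = (\<integral>y. indicator {x<..} y * exp (\<theta> * x) \<partial>M)"
    by (simp add: tail_def)
  also have "\<dots> \<le> (\<integral>x. exp (\<theta> * x) \<partial>M)"
    using \<open>\<theta> > 0\<close>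
    by (intro integral_mono I integrable_mult_left integrable_real_indicator)
       (auto simp: indicator_def M.emeasure_finite less_top[symmetric])
  finally show "tail M x \<le> (\<integral>x. exp (\<theta> * x) \<partial>M) * exp (- \<theta> * x)"
    by (simp add: exp_minus field_simps)
qed

locale OS_distribution =
  fixes \<mu> :: "real measure"
  assumes OS: "\<mu> \<in> class_OS"
begin

lemma real_dist: "real_distribution \<mu>"
  and tail_pos: "tail \<mu> x > 0"
  using OS by (simp_all add: class_OS_iff)

text \<open>\<open>X > x - a\<close> and \<open>Y > a\<close> force \<open>X + Y > x\<close>, so the
  bound for the square pays for the shift, at the price \<open>1 / tail \<mu> a\<close>. Passing to
  \<open>\<bar>K\<bar> + 1\<close> makes the constant positive.\<close>

lemma tail_shift: "\<exists>C>0. \<forall>x. tail \<mu> (x - a) \<le> C * tail \<mu> x"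
proof -
  obtain K where K: "\<And>x. tail (\<mu> \<star> \<mu>) x \<le> K * tail \<mu> x"
    using OS by (auto simp: class_OS_iff)
  have "tail \<mu> (x - a) \<le> (\<bar>K\<bar> + 1) / tail \<mu> a * tail \<mu> x" for x
  proof -
    have "tail \<mu> (x - a) * tail \<mu> a \<le> tail (\<mu> \<star> \<mu>) x"
      using tail_convolution_ge[OF real_dist real_dist, of "x - a" a] by simp
    also have "\<dots> \<le> (\<bar>K\<bar> + 1) * tail \<mu> x"
      using order_trans[OF K[of x] mult_right_mono[of K "\<bar>K\<bar> + 1" "tail \<mu> x"]] by auto
    finally show ?thesis
      using tail_pos[of a] by (simp add: field_simps)
  qed
  then show ?thesis
    using tail_pos[of a] by (intro exI[of _ "(\<bar>K\<bar> + 1) / tail \<mu> a"]) auto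
qed

text \<open>The unit shift is iterated. The factor \<open>exp \<gamma>\<close> absorbs rounding
  \<open>y\<close> up to an integer, and the summand 1 covers negative \<open>y\<close>, where
  monotonicity suffices.\<close>

lemma tail_shift_exp:
  obtains K \<gamma> where "K > 0" "\<gamma> > 0" "\<And>x y. tail \<mu> (x - y) \<le> K * (1 + exp (\<gamma> * y)) * tail \<mu> x"
proof -
  obtain C where C: "C > 0" "\<And>x. tail \<mu> (x - 1) \<le> C * tail \<mu> x"
    using tail_shift[of 1] by auto
  define \<gamma> where "\<gamma> = \<bar>ln C\<bar> + 1"
  have C': "C \<le> exp \<gamma>"
  proof -
    have "exp (ln C) \<le> exp \<gamma>" by (simp add: \<gamma>_def)
    then show ?thesis using C by simp
  qed
  have n: "tail \<mu> (x - real n) \<le> exp (\<gamma> * real n) * tail \<mu> x" for x n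
  proof (induction n)
    case (Suc n)
    have "tail \<mu> (x - real (Suc n)) \<le> C * tail \<mu> (x - real n)"
      using C(2)[of "x - real n"] by (simp add: algebra_simps)
    also have "\<dots> \<le> exp \<gamma> * (exp (\<gamma> * real n) * tail \<mu> x)"
      using Suc C' C by (intro mult_mono) auto
    finally show ?case by (simp add: algebra_simps exp_add)
  qed simp
  have "tail \<mu> (x - y) \<le> exp \<gamma> * (1 + exp (\<gamma> * y)) * tail \<mu> x" for x y
  proof (cases "y \<ge> 0")
    case True
    have "tail \<mu> (x - y) \<le> tail \<mu> (x - real (nat \<lceil>y\<rceil>))"
      using True by (intro tail_mono[OF real_dist]) linarith
    also have "\<dots> \<le> exp (\<gamma> * real (nat \<lceil>y\<rceil>)) * tail \<mu> x" by (rule n)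
    also have "\<dots> \<le> exp (\<gamma> * (1 + y)) * tail \<mu> x"
    proof (intro mult_right_mono, simp)
      have "real (nat \<lceil>y\<rceil>) \<le> 1 + y" using True by linarith
      then show "\<gamma> * real (nat \<lceil>y\<rceil>) \<le> \<gamma> * (1 + y)"
        by (intro mult_left_mono) (auto simp: \<gamma>_def)
    qed simp
    also have "\<dots> = exp \<gamma> * exp (\<gamma> * y) * tail \<mu> x"
      by (simp add: ring_distribs exp_add)
    also have "\<dots> \<le> exp \<gamma> * (1 + exp (\<gamma> * y)) * tail \<mu> x"
      by (intro mult_right_mono mult_left_mono) auto
    finally show ?thesis .
  next
    case False
    have "tail \<mu> (x - y) \<le> 1 * tail \<mu> x"
      using False tail_mono[OF real_dist, of x "x - y"] by simp
    also have "\<dots> \<le> exp \<gamma> * (1 + exp (\<gamma> * y)) * tail \<mu> x"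
    proof (intro mult_right_mono)
      have "1 * 1 \<le> exp \<gamma> * (1 + exp (\<gamma> * y))"
        by (intro mult_mono) (auto simp: \<gamma>_def)
      then show "1 \<le> exp \<gamma> * (1 + exp (\<gamma> * y))" by simp
    qed simp
    finally show ?thesis .
  qed
  then show ?thesis
    by (intro that[of "exp \<gamma>" \<gamma>]) (auto simp: \<gamma>_def)
qed

text \<open>The shift bound with \<open>y = x\<close> compares \<open>tail \<mu> x\<close> with the
  fixed value \<open>tail \<mu> 0\<close>.\<close>

lemma tail_ge_exp: "\<exists>c>0. \<exists>\<gamma>>0. \<forall>x\<ge>0. tail \<mu> x \<ge> c * exp (- \<gamma> * x)"
proof -
  obtain K \<gamma> where K: "K > 0" "\<gamma> > 0" "\<And>x y. tail \<mu> (x - y) \<le> K * (1 + exp (\<gamma> * y)) * tail \<mu> x"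
    by (rule tail_shift_exp) blast
  have "tail \<mu> 0 / (2 * K) * exp (- \<gamma> * x) \<le> tail \<mu> x" if "x \<ge> 0" for x
  proof -
    have "tail \<mu> 0 \<le> K * (1 + exp (\<gamma> * x)) * tail \<mu> x" using K(3)[of x x] by simp
    also have "\<dots> \<le> K * (exp (\<gamma> * x) + exp (\<gamma> * x)) * tail \<mu> x"
      using K that by (intro mult_right_mono mult_left_mono add_right_mono) auto
    finally show ?thesis using K by (simp add: exp_minus field_simps)
  qed
  then show ?thesis
    using K tail_pos[of 0] by (intro exI[of _ "tail \<mu> 0 / (2 * K)"] exI[of _ \<gamma>] conjI) auto
qed

section \<open>Distributions with tail dominated by that of \<mu>\<close>

definition controlled :: "real measure \<Rightarrow> bool" where
  "controlled \<rho> \<longleftrightarrow> real_distribution \<rho> \<and> (\<exists>C. \<forall>x. tail \<rho> x \<le> C * tail \<mu> x)"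

lemma controlledI: "real_distribution \<rho> \<Longrightarrow> (\<And>x. tail \<rho> x \<le> C * tail \<mu> x) \<Longrightarrow> controlled \<rho>"
  by (auto simp: controlled_def)

lemma controlledE:
  assumes "controlled \<rho>"
  obtains C where "C > 0" "\<And>x. tail \<rho> x \<le> C * tail \<mu> x"
proof -
  obtain C where C: "\<And>x. tail \<rho> x \<le> C * tail \<mu> x"
    using assms by (auto simp: controlled_def)
  have "tail \<rho> x \<le> (\<bar>C\<bar> + 1) * tail \<mu> x" for x
    using order_trans[OF C[of x] mult_right_mono[of C "\<bar>C\<bar> + 1" "tail \<mu> x"]] by auto
  then show ?thesis by (intro that[of "\<bar>C\<bar> + 1"]) auto
qed

lemma controlled_real_distribution: "controlled \<rho> \<Longrightarrow> real_distribution \<rho>"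
  by (simp add: controlled_def)

lemma controlled_self: "controlled \<mu>"
  by (rule controlledI[of _ 1]) (auto simp: real_dist)

text \<open>The factors are replaced by \<mu> one at a time, until only the tail of
  \<open>\<mu> \<star> \<mu>\<close> is left.\<close>

lemma controlled_convolution:
  assumes \<rho>: "controlled \<rho>" and \<sigma>: "controlled \<sigma>"
  shows "controlled (\<rho> \<star> \<sigma>)"
proof -
  note R = controlled_real_distribution[OF \<rho>] controlled_real_distribution[OF \<sigma>]
  obtain C where C: "C > 0" "\<And>x. tail \<rho> x \<le> C * tail \<mu> x" using controlledE[OF \<rho>] by blast
  obtain D where D: "D > 0" "\<And>x. tail \<sigma> x \<le> D * tail \<mu> x" using controlledE[OF \<sigma>] by blast
  obtain K where K: "\<And>x. tail (\<mu> \<star> \<mu>) x \<le> K * tail \<mu> x"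
    using OS by (auto simp: class_OS_iff)
  have "tail (\<rho> \<star> \<sigma>) x \<le> (D * C * K) * tail \<mu> x" for x
  proof -
    have "tail (\<rho> \<star> \<sigma>) x \<le> D * tail (\<rho> \<star> \<mu>) x"
      using R real_dist D by (intro tail_convolution_mono) auto
    also have "tail (\<rho> \<star> \<mu>) x = tail (\<mu> \<star> \<rho>) x"
      using R real_dist by (simp add: convolution_commute)
    also have "D * \<dots> \<le> D * (C * tail (\<mu> \<star> \<mu>) x)"
      using R real_dist D C by (intro mult_left_mono tail_convolution_mono) auto
    also have "\<dots> \<le> D * (C * (K * tail \<mu> x))"
      using K D C by (intro mult_left_mono) auto
    finally show ?thesis by (simp add: ac_simps)
  qed
  then show ?thesis
    using R by (intro controlledI real_distribution_convolution) auto
qed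

text \<open>An exponential moment of order \<open>\<gamma> + 1\<close> beats the lower bound
  \<open>c * exp (- \<gamma> * x)\<close> by a factor \<open>exp (- x)\<close>. On the negative
  half-line the trivial bound 1 is compared with \<open>tail \<mu> 0\<close>.\<close>

lemma light_tailed_imp_controlled:
  assumes R: "real_distribution \<rho>" and L: "light_tailed \<rho>"
  shows "controlled \<rho>" and "((\<lambda>x. tail \<rho> x / tail \<mu> x) \<longlongrightarrow> 0) at_top"
proof -
  obtain c \<gamma> where c: "c > 0" "\<gamma> > 0" "\<And>x. x \<ge> 0 \<Longrightarrow> tail \<mu> x \<ge> c * exp (- \<gamma> * x)"
    using tail_ge_exp by auto
  obtain K where K: "K \<ge> 0" "\<And>x. tail \<rho> x \<le> K * exp (- (\<gamma> + 1) * x)"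
    using light_tailed_tail_le[OF R L, of "\<gamma> + 1"] c by auto
  have bound: "tail \<rho> x / tail \<mu> x \<le> K / c * exp (- x)" if "x \<ge> 0" for x
  proof -
    have "tail \<rho> x / tail \<mu> x \<le> K * exp (- (\<gamma> + 1) * x) / (c * exp (- \<gamma> * x))"
      using K c that by (intro frac_le) auto
    also have "\<dots> = K / c * exp (- x)"
    proof -
      have "exp (- (\<gamma> + 1) * x) = exp (- \<gamma> * x) * exp (- x)"
        by (simp add: exp_add[symmetric] algebra_simps)
      then show ?thesis by simp
    qed
    finally show ?thesis .
  qed
  show "((\<lambda>x. tail \<rho> x / tail \<mu> x) \<longlongrightarrow> 0) at_top"
  proof (rule tendsto_sandwich[OF _ _ tendsto_const])
    show "((\<lambda>x. K / c * exp (- x)) \<longlongrightarrow> 0) at_top"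
      by (intro tendsto_mult_right_zero filterlim_compose[OF exp_at_bot] filterlim_uminus_at_bot_at_top)
    show "\<forall>\<^sub>F x in at_top. tail \<rho> x / tail \<mu> x \<le> K / c * exp (- x)"
      using eventually_ge_at_top[of 0] by eventually_elim (rule bound)
    show "\<forall>\<^sub>F x in at_top. 0 \<le> tail \<rho> x / tail \<mu> x"
      by (simp add: divide_nonneg_nonneg)
  qed
  have "tail \<rho> x \<le> (K / c + 1 / tail \<mu> 0) * tail \<mu> x" for x
  proof (cases "x \<ge> 0")
    case True
    have "tail \<rho> x / tail \<mu> x \<le> K / c * 1"
      using bound[OF True] mult_left_mono[of "exp (-x)" 1 "K / c"] True K c by auto
    then have "tail \<rho> x \<le> K / c * tail \<mu> x"
      using tail_pos[of x] by (simp add: divide_le_eq)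
    also have "\<dots> \<le> (K / c + 1 / tail \<mu> 0) * tail \<mu> x"
      by (intro mult_right_mono) auto
    finally show ?thesis .
  next
    case False
    have "tail \<rho> x \<le> 1 / tail \<mu> 0 * tail \<mu> x"
    proof -
      have "tail \<rho> x * tail \<mu> 0 \<le> 1 * tail \<mu> 0"
        by (intro mult_right_mono tail_le_1 R) simp
      also have "\<dots> \<le> tail \<mu> x" using tail_mono[OF real_dist, of x 0] False by simp
      finally show ?thesis using tail_pos[of 0] by (simp add: le_divide_eq)
    qed
    also have "\<dots> \<le> (K / c + 1 / tail \<mu> 0) * tail \<mu> x"
      using K c by (intro mult_right_mono) auto
    finally show ?thesis .
  qed
  then show "controlled \<rho>" by (rule controlledI[OF R])
qed

section \<open>Unit masses that are negligible against the tail of \<mu>\<close>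

definition negligible_mass :: "real measure \<Rightarrow> bool" where
  "negligible_mass \<rho> \<longleftrightarrow> ((\<lambda>x. unit_mass \<rho> x / tail \<mu> x) \<longlongrightarrow> 0) at_top"

lemma negligible_mass_iff:
  "negligible_mass \<rho> \<longleftrightarrow> (\<forall>\<epsilon>>0. \<exists>X. \<forall>x\<ge>X. unit_mass \<rho> x \<le> \<epsilon> * tail \<mu> x)"
proof
  assume "negligible_mass \<rho>"
  show "\<forall>\<epsilon>>0. \<exists>X. \<forall>x\<ge>X. unit_mass \<rho> x \<le> \<epsilon> * tail \<mu> x"
  proof safe
    fix \<epsilon> :: real assume "\<epsilon> > 0"
    with \<open>negligible_mass \<rho>\<close> have "\<forall>\<^sub>F x in at_top. unit_mass \<rho> x / tail \<mu> x < \<epsilon>"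
      unfolding negligible_mass_def by (rule order_tendstoD)
    then have "\<forall>\<^sub>F x in at_top. unit_mass \<rho> x \<le> \<epsilon> * tail \<mu> x"
      by eventually_elim (use tail_pos in \<open>auto simp: divide_less_eq intro: less_imp_le\<close>)
    then show "\<exists>X. \<forall>x\<ge>X. unit_mass \<rho> x \<le> \<epsilon> * tail \<mu> x"
      by (simp add: eventually_at_top_linorder)
  qed
next
  assume *: "\<forall>\<epsilon>>0. \<exists>X. \<forall>x\<ge>X. unit_mass \<rho> x \<le> \<epsilon> * tail \<mu> x"
  show "negligible_mass \<rho>"
    unfolding negligible_mass_def
  proof (rule order_tendstoI)
    fix \<epsilon> :: real assume "0 < \<epsilon>"
    then obtain X where X: "\<And>x. x \<ge> X \<Longrightarrow> unit_mass \<rho> x \<le> \<epsilon> / 2 * tail \<mu> x"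
      using * by (meson half_gt_zero)
    show "\<forall>\<^sub>F x in at_top. unit_mass \<rho> x / tail \<mu> x < \<epsilon>"
      using eventually_ge_at_top[of X]
    proof eventually_elim
      case (elim x)
      have "unit_mass \<rho> x / tail \<mu> x \<le> \<epsilon> / 2"
        using X[OF elim] tail_pos[of x] by (simp add: divide_le_eq)
      then show ?case using \<open>0 < \<epsilon>\<close> by linarith
    qed
  qed (simp add: less_le_trans[OF _ divide_nonneg_nonneg])
qed

lemma light_tailed_imp_negligible_mass:
  assumes R: "real_distribution \<rho>" and L: "light_tailed \<rho>"
  shows "negligible_mass \<rho>"
  unfolding negligible_mass_def
proof (rule tendsto_sandwich[OF _ _ tendsto_const])
  show "((\<lambda>x. tail \<rho> x / tail \<mu> x) \<longlongrightarrow> 0) at_top"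
    using assms by (rule light_tailed_imp_controlled)
  show "\<forall>\<^sub>F x in at_top. unit_mass \<rho> x / tail \<mu> x \<le> tail \<rho> x / tail \<mu> x"
    by (simp add: divide_right_mono unit_mass_le_tail[OF R])
qed (simp add: divide_nonneg_nonneg)

text \<open>The integral is the tail of \<open>\<rho> \<star> \<mu>\<close>. It appears when a bound
  by \<open>tail \<mu> (x - a)\<close> is integrated over the value \<open>a\<close> of one
  summand.\<close>

lemma convolution_controlled_tail_bound:
  assumes "controlled \<rho>"
  obtains C where "C > 0" "\<And>x. (\<integral>a. tail \<mu> (x - a) \<partial>\<rho>) \<le> C * tail \<mu> x"
proof -
  have R: "real_distribution \<rho>" using assms by (rule controlled_real_distribution)
  obtain C where "C > 0" "\<And>x. tail (\<rho> \<star> \<mu>) x \<le> C * tail \<mu> x"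
    using controlledE[OF controlled_convolution[OF assms controlled_self]] by blast
  then show ?thesis
    by (intro that[of C]) (auto simp: tail_convolution[OF R real_dist])
qed

text \<open>If \<open>x < X + Y \<le> x + 1\<close> with \<open>x\<close> large, then \<open>X \<le> x - L\<close> or \<open>Y \<le> x - L\<close>; conditioning on that
  variable, the other one has to hit a unit interval to the right of \<open>L\<close>.\<close>

lemma negligible_mass_convolution:
  assumes \<rho>: "controlled \<rho>" "negligible_mass \<rho>" and \<sigma>: "controlled \<sigma>" "negligible_mass \<sigma>"
  shows "negligible_mass (\<rho> \<star> \<sigma>)"
  unfolding negligible_mass_iff
proof (intro allI impI)
  fix \<epsilon> :: real assume "\<epsilon> > 0"
  note R = controlled_real_distribution[OF \<rho>(1)] controlled_real_distribution[OF \<sigma>(1)]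
  interpret \<rho>: real_distribution \<rho> by fact
  interpret \<sigma>: real_distribution \<sigma> by fact
  interpret P: pair_prob_space \<rho> \<sigma> ..
  obtain C where C: "C > 0" "\<And>x. (\<integral>a. tail \<mu> (x - a) \<partial>\<rho>) \<le> C * tail \<mu> x"
    using convolution_controlled_tail_bound[OF \<rho>(1)] by blast
  obtain D where D: "D > 0" "\<And>x. (\<integral>a. tail \<mu> (x - a) \<partial>\<sigma>) \<le> D * tail \<mu> x"
    using convolution_controlled_tail_bound[OF \<sigma>(1)] by blast
  define \<delta> where "\<delta> = \<epsilon> / (C + D)"
  have \<delta>: "\<delta> > 0" using C D \<open>\<epsilon> > 0\<close> by (simp add: \<delta>_def)
  obtain L1 where L1: "\<And>x. x \<ge> L1 \<Longrightarrow> unit_mass \<rho> x \<le> \<delta> * tail \<mu> x"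
    using \<rho>(2) \<delta> by (auto simp: negligible_mass_iff)
  obtain L2 where L2: "\<And>x. x \<ge> L2 \<Longrightarrow> unit_mass \<sigma> x \<le> \<delta> * tail \<mu> x"
    using \<sigma>(2) \<delta> by (auto simp: negligible_mass_iff)
  define L where "L = max L1 L2"
  \<comment> \<open>If both summands exceeded \<open>x - L\<close>, the sum would exceed
    \<open>2 * x - 2 * L\<close>, which is at least \<open>x + 1\<close> from this threshold
    on.\<close>
  have "unit_mass (\<rho> \<star> \<sigma>) x \<le> \<epsilon> * tail \<mu> x" if x: "x \<ge> 2 * L + 1" for x
  proof -
    define E1 where "E1 = {p :: real \<times> real. x < fst p + snd p \<and> fst p + snd p \<le> x + 1 \<and> fst p \<le> x - L}"
    define E2 where "E2 = {p :: real \<times> real. x < fst p + snd p \<and> fst p + snd p \<le> x + 1 \<and> snd p \<le> x - L}"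
    have sp: "space (\<rho> \<Otimes>\<^sub>M \<sigma>) = UNIV" by (simp add: space_pair_measure)
    have "{p \<in> space (\<rho> \<Otimes>\<^sub>M \<sigma>). x < fst p + snd p \<and> fst p + snd p \<le> x + 1 \<and> fst p \<le> x - L} \<in> sets (\<rho> \<Otimes>\<^sub>M \<sigma>)"
      by measurable
    then have E1[measurable]: "E1 \<in> sets (\<rho> \<Otimes>\<^sub>M \<sigma>)" by (simp add: E1_def sp)
    have "{p \<in> space (\<rho> \<Otimes>\<^sub>M \<sigma>). x < fst p + snd p \<and> fst p + snd p \<le> x + 1 \<and> snd p \<le> x - L} \<in> sets (\<rho> \<Otimes>\<^sub>M \<sigma>)"
      by measurable
    then have E2[measurable]: "E2 \<in> sets (\<rho> \<Otimes>\<^sub>M \<sigma>)" by (simp add: E2_def sp)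
    have m1: "(\<lambda>a. measure \<sigma> (Pair a -` E1)) \<in> borel_measurable \<rho>"
      unfolding measure_def using \<sigma>.measurable_emeasure_Pair[OF E1] by measurable
    have m2: "(\<lambda>b. measure \<rho> ((\<lambda>a. (a, b)) -` E2)) \<in> borel_measurable \<sigma>"
      unfolding measure_def using P.measurable_emeasure_Pair2[OF E2] by measurable
    have I1: "integrable \<rho> (\<lambda>a. measure \<sigma> (Pair a -` E1))"
      using m1 by (intro \<rho>.integrable_const_bound[where B=1]) auto
    have I2: "integrable \<sigma> (\<lambda>b. measure \<rho> ((\<lambda>a. (a, b)) -` E2))"
      using m2 by (intro \<sigma>.integrable_const_bound[where B=1]) auto
    have "unit_mass (\<rho> \<star> \<sigma>) x = P.prob {p. x < fst p + snd p \<and> fst p + snd p \<le> x + 1}"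
      unfolding unit_mass_def convolution_def
      by (subst measure_distr) (auto intro!: arg_cong[where f="P.prob"] simp: sp)
    also have "\<dots> \<le> P.prob (E1 \<union> E2)"
    proof (rule P.finite_measure_mono)
      show "{p. x < fst p + snd p \<and> fst p + snd p \<le> x + 1} \<subseteq> E1 \<union> E2"
        using x by (auto simp: E1_def E2_def)
    qed (intro sets.Un E1 E2)
    also have "\<dots> \<le> P.prob E1 + P.prob E2"
      by (intro measure_Un_le E1 E2)
    also have "P.prob E1 = (\<integral>a. measure \<sigma> (Pair a -` E1) \<partial>\<rho>)"
    proof -
      have "emeasure (\<rho> \<Otimes>\<^sub>M \<sigma>) E1 = (\<integral>\<^sup>+a. ennreal (measure \<sigma> (Pair a -` E1)) \<partial>\<rho>)"
        by (simp add: \<sigma>.emeasure_pair_measure_alt[OF E1] \<sigma>.emeasure_eq_measure)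
      also have "\<dots> = ennreal (\<integral>a. measure \<sigma> (Pair a -` E1) \<partial>\<rho>)"
        by (intro nn_integral_eq_integral I1) auto
      finally show ?thesis
        by (simp add: P.emeasure_eq_measure integral_nonneg)
    qed
    also have "\<dots> \<le> (\<integral>a. \<delta> * tail \<mu> (x - a) \<partial>\<rho>)"
    proof (rule integral_mono)
      show "integrable \<rho> (\<lambda>a. measure \<sigma> (Pair a -` E1))" by (rule I1)
      show "integrable \<rho> (\<lambda>a. \<delta> * tail \<mu> (x - a))"
        by (intro integrable_mult_right tail_convolution R real_dist)
      fix a
      have eq: "Pair a -` E1 = (if a \<le> x - L then {x - a<..x - a + 1} else {})"
        by (auto simp: E1_def)
      show "measure \<sigma> (Pair a -` E1) \<le> \<delta> * tail \<mu> (x - a)"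
        using L2[of "x - a"] \<delta> by (auto simp: eq unit_mass_def L_def)
    qed
    also have "\<dots> \<le> \<delta> * (C * tail \<mu> x)"
      using C \<delta> by simp
    also have "P.prob E2 = (\<integral>b. measure \<rho> ((\<lambda>a. (a, b)) -` E2) \<partial>\<sigma>)"
    proof -
      have "emeasure (\<rho> \<Otimes>\<^sub>M \<sigma>) E2 = (\<integral>\<^sup>+b. ennreal (measure \<rho> ((\<lambda>a. (a, b)) -` E2)) \<partial>\<sigma>)"
        by (simp add: P.emeasure_pair_measure_alt2[OF E2] \<rho>.emeasure_eq_measure)
      also have "\<dots> = ennreal (\<integral>b. measure \<rho> ((\<lambda>a. (a, b)) -` E2) \<partial>\<sigma>)"
        by (intro nn_integral_eq_integral I2) auto
      finally show ?thesis
        by (simp add: P.emeasure_eq_measure integral_nonneg)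
    qed
    also have "\<dots> \<le> (\<integral>a. \<delta> * tail \<mu> (x - a) \<partial>\<sigma>)"
    proof (rule integral_mono)
      show "integrable \<sigma> (\<lambda>b. measure \<rho> ((\<lambda>a. (a, b)) -` E2))" by (rule I2)
      show "integrable \<sigma> (\<lambda>a. \<delta> * tail \<mu> (x - a))"
        by (intro integrable_mult_right tail_convolution R real_dist)
      fix a
      have eq: "(\<lambda>b. (b, a)) -` E2 = (if a \<le> x - L then {x - a<..x - a + 1} else {})"
        by (auto simp: E2_def)
      show "measure \<rho> ((\<lambda>b. (b, a)) -` E2) \<le> \<delta> * tail \<mu> (x - a)"
        using L1[of "x - a"] \<delta> by (auto simp: eq unit_mass_def L_def)
    qed
    also have "\<dots> \<le> \<delta> * (D * tail \<mu> x)"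
      using D \<delta> by simp
    finally have "unit_mass (\<rho> \<star> \<sigma>) x \<le> \<delta> * (C + D) * tail \<mu> x"
      by (simp add: algebra_simps)
    also have "\<delta> * (C + D) = \<epsilon>"
      using C D by (simp add: \<delta>_def)
    finally show ?thesis .
  qed
  then show "\<exists>X. \<forall>x\<ge>X. unit_mass (\<rho> \<star> \<sigma>) x \<le> \<epsilon> * tail \<mu> x" by blast
qed

text \<open>If one summand lies in the unit interval after \<open>x\<close> and the other in a
  charged unit interval after \<open>z\<close>, the sum lies in an interval of length 2 after
  \<open>x + z\<close>. The mass of the charged interval is a constant, so it can be divided
  out.\<close>

lemma negligible_mass_factor:
  assumes \<rho>: "real_distribution \<rho>" and \<sigma>: "real_distribution \<sigma>"
    and N: "negligible_mass (\<rho> \<star> \<sigma>)"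
  shows "negligible_mass \<rho>"
  unfolding negligible_mass_iff
proof (intro allI impI)
  fix \<epsilon> :: real assume "\<epsilon> > 0"
  note R = real_distribution_convolution[OF \<rho> \<sigma>]
  obtain z where z: "measure \<sigma> {z<..z+1} > 0"
    using exists_unit_interval_pos[OF \<sigma>] by blast
  obtain C where C: "C > 0" "\<And>x. tail \<mu> (x - (-z)) \<le> C * tail \<mu> x"
    using tail_shift[of "-z"] by blast
  \<comment> \<open>The 2 counts the unit intervals covering the window, and \<open>C\<close> pays
    for the shift by \<open>z\<close>.\<close>
  define \<delta> where "\<delta> = \<epsilon> * measure \<sigma> {z<..z+1} / (2 * C)"
  have \<delta>: "\<delta> > 0" using C \<open>\<epsilon> > 0\<close> z by (simp add: \<delta>_def)
  obtain X where X: "\<And>x. x \<ge> X \<Longrightarrow> unit_mass (\<rho> \<star> \<sigma>) x \<le> \<delta> * tail \<mu> x"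
    using N \<delta> by (auto simp: negligible_mass_iff)
  have "unit_mass \<rho> x \<le> \<epsilon> * tail \<mu> x" if x: "x \<ge> X - z" for x
  proof -
    have "unit_mass \<rho> x * measure \<sigma> {z<..z+1} \<le> measure (\<rho> \<star> \<sigma>) {x + z<..x + z + 2}"
      unfolding unit_mass_def by (intro measure_convolution_ge \<rho> \<sigma>) auto
    also have "\<dots> = unit_mass (\<rho> \<star> \<sigma>) (x + z) + unit_mass (\<rho> \<star> \<sigma>) (x + z + 1)"
      by (simp add: unit_mass_tail[OF R] measure_Ioc_tail[OF R] add.assoc)
    also have "\<dots> \<le> \<delta> * tail \<mu> (x + z) + \<delta> * tail \<mu> (x + z + 1)"
      using x by (intro add_mono X) auto
    also have "\<dots> \<le> \<delta> * tail \<mu> (x + z) + \<delta> * tail \<mu> (x + z)"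
      using \<delta> tail_mono[OF real_dist, of "x + z" "x + z + 1"] by simp
    also have "\<dots> = 2 * \<delta> * tail \<mu> (x + z)" by simp
    also have "\<dots> \<le> 2 * \<delta> * (C * tail \<mu> x)"
      using C(2)[of x] \<delta> by (intro mult_left_mono) auto
    also have "\<dots> = \<epsilon> * tail \<mu> x * measure \<sigma> {z<..z+1}"
      using C by (simp add: \<delta>_def)
    finally show ?thesis using z by simp
  qed
  then show "\<exists>X. \<forall>x\<ge>X. unit_mass \<rho> x \<le> \<epsilon> * tail \<mu> x" by blast
qed

text \<open>As in \<open>negligible_mass_factor\<close>, with a half-line of mass at least 1/2 in
  place of the charged interval.\<close>

lemma controlled_factor:
  assumes \<rho>: "real_distribution \<rho>" and \<sigma>: "real_distribution \<sigma>"
    and N: "controlled (\<rho> \<star> \<sigma>)"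
  shows "controlled \<rho>"
proof -
  obtain a where a: "tail \<sigma> a \<ge> 1/2" using tail_at_bot[OF \<sigma>] by blast
  obtain C where C: "C > 0" "\<And>x. tail \<mu> (x - (-a)) \<le> C * tail \<mu> x"
    using tail_shift[of "-a"] by blast
  obtain D where D: "D > 0" "\<And>x. tail (\<rho> \<star> \<sigma>) x \<le> D * tail \<mu> x" using controlledE[OF N] by blast
  show ?thesis
  proof (rule controlledI[OF \<rho>])
    fix x
    have "tail \<rho> x * (1/2) \<le> tail \<rho> x * tail \<sigma> a"
      using a by (intro mult_left_mono) auto
    also have "\<dots> \<le> tail (\<rho> \<star> \<sigma>) (x + a)" by (rule tail_convolution_ge[OF \<rho> \<sigma>])
    also have "\<dots> \<le> D * tail \<mu> (x + a)" by (rule D)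
    also have "\<dots> \<le> D * (C * tail \<mu> x)" using C(2)[of x] D by (intro mult_left_mono) auto
    finally show "tail \<rho> x \<le> (2 * D * C) * tail \<mu> x" by simp
  qed
qed

section \<open>Distributions with tail of the same order as that of \<mu>\<close>

definition comparable :: "real measure \<Rightarrow> bool" where
  "comparable \<rho> \<longleftrightarrow> controlled \<rho> \<and> (\<exists>c>0. \<forall>x. c * tail \<mu> x \<le> tail \<rho> x)"

lemma comparable_self: "comparable \<mu>"
  unfolding comparable_def by (intro conjI controlled_self exI[of _ 1]) auto

text \<open>The lower bound survives because \<open>\<sigma>\<close> has mass at least 1/2 above
  some \<open>a\<close>, and the shift by \<open>a\<close> costs a constant.\<close>

lemma comparable_convolution:
  assumes \<rho>: "comparable \<rho>" and \<sigma>: "controlled \<sigma>"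
  shows "comparable (\<rho> \<star> \<sigma>)"
proof -
  have R: "real_distribution \<rho>" "real_distribution \<sigma>"
    using assms by (auto simp: comparable_def controlled_real_distribution)
  obtain c where c: "c > 0" "\<And>x. c * tail \<mu> x \<le> tail \<rho> x"
    using \<rho> by (auto simp: comparable_def)
  obtain a where a: "tail \<sigma> a \<ge> 1/2" using tail_at_bot[OF R(2)] by blast
  obtain C where C: "C > 0" "\<And>x. tail \<mu> (x - (- a)) \<le> C * tail \<mu> x"
    using tail_shift[of "-a"] by blast
  have "c / (2 * C) * tail \<mu> x \<le> tail (\<rho> \<star> \<sigma>) x" for x
  proof -
    have "c / (2 * C) * tail \<mu> x \<le> c / (2 * C) * (C * tail \<mu> (x - a))"
      using C(2)[of "x - a"] C(1) c(1) by (intro mult_left_mono) auto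
    also have "\<dots> = (c * tail \<mu> (x - a)) * (1/2)"
      using C(1) by simp
    also have "\<dots> \<le> tail \<rho> (x - a) * tail \<sigma> a"
      using c a by (intro mult_mono) auto
    also have "\<dots> \<le> tail (\<rho> \<star> \<sigma>) x"
      using tail_convolution_ge[OF R, of "x - a" a] by simp
    finally show ?thesis .
  qed
  moreover have "controlled (\<rho> \<star> \<sigma>)"
    using assms by (intro controlled_convolution) (auto simp: comparable_def)
  ultimately show ?thesis
    using c C unfolding comparable_def by (intro conjI exI[of _ "c / (2 * C)"]) auto
qed

lemma comparable_tail_pos: "comparable \<rho> \<Longrightarrow> tail \<rho> x > 0"
  unfolding comparable_def using tail_pos by (meson less_le_trans mult_pos_pos)

lemma comparable_imp_OS:
  assumes "comparable \<rho>" shows "\<rho> \<in> class_OS"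
proof -
  obtain c where c: "c > 0" "\<And>x. c * tail \<mu> x \<le> tail \<rho> x"
    using assms by (auto simp: comparable_def)
  have \<rho>: "controlled \<rho>" using assms by (simp add: comparable_def)
  obtain C where C: "C > 0" "\<And>x. tail (\<rho> \<star> \<rho>) x \<le> C * tail \<mu> x"
    using controlledE[OF controlled_convolution[OF \<rho> \<rho>]] by blast
  have "tail (\<rho> \<star> \<rho>) x \<le> C / c * tail \<rho> x" for x
  proof -
    have "tail (\<rho> \<star> \<rho>) x \<le> C / c * (c * tail \<mu> x)" using C(2)[of x] c(1) by simp
    also have "\<dots> \<le> C / c * tail \<rho> x" using c C by (intro mult_left_mono) auto
    finally show ?thesis .
  qed
  then have "\<exists>C. \<forall>x. tail (\<rho> \<star> \<rho>) x \<le> C * tail \<rho> x" by blast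
  then show ?thesis
    using comparable_tail_pos[OF assms] controlled_real_distribution[OF \<rho>] by (simp add: class_OS_iff)
qed

text \<open>Exchanges the denominator, so that L(0) and the limit criterion for the jump law can
  both be tested against \<mu>.\<close>

lemma comparable_ratio_tendsto_0_iff:
  assumes "comparable \<rho>" and f: "\<And>x. f x \<ge> 0"
  shows "((\<lambda>x. f x / tail \<rho> x) \<longlongrightarrow> 0) at_top \<longleftrightarrow> ((\<lambda>x. f x / tail \<mu> x) \<longlongrightarrow> 0) at_top"
proof -
  obtain c where c: "c > 0" "\<And>x. c * tail \<mu> x \<le> tail \<rho> x"
    using assms(1) by (auto simp: comparable_def)
  have \<rho>: "controlled \<rho>" using assms(1) by (simp add: comparable_def)
  obtain C where C: "C > 0" "\<And>x. tail \<rho> x \<le> C * tail \<mu> x"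
    using controlledE[OF \<rho>] by blast
  have pos: "tail \<rho> x > 0" for x by (rule comparable_tail_pos[OF assms(1)])
  show ?thesis
  proof
    assume *: "((\<lambda>x. f x / tail \<rho> x) \<longlongrightarrow> 0) at_top"
    show "((\<lambda>x. f x / tail \<mu> x) \<longlongrightarrow> 0) at_top"
    proof (rule tendsto_sandwich[OF _ _ tendsto_const])
      show "((\<lambda>x. C * (f x / tail \<rho> x)) \<longlongrightarrow> 0) at_top"
        using * by (intro tendsto_mult_right_zero)
      show "\<forall>\<^sub>F x in at_top. f x / tail \<mu> x \<le> C * (f x / tail \<rho> x)"
      proof (intro always_eventually allI)
        fix x
        have "f x * tail \<rho> x \<le> f x * (C * tail \<mu> x)"
          by (intro mult_left_mono C f)
        then show "f x / tail \<mu> x \<le> C * (f x / tail \<rho> x)"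
          using pos[of x] tail_pos[of x] by (simp add: field_simps)
      qed
    qed (simp add: divide_nonneg_nonneg f)
  next
    assume *: "((\<lambda>x. f x / tail \<mu> x) \<longlongrightarrow> 0) at_top"
    show "((\<lambda>x. f x / tail \<rho> x) \<longlongrightarrow> 0) at_top"
    proof (rule tendsto_sandwich[OF _ _ tendsto_const])
      show "((\<lambda>x. 1 / c * (f x / tail \<mu> x)) \<longlongrightarrow> 0) at_top"
        using * by (intro tendsto_mult_right_zero)
      show "\<forall>\<^sub>F x in at_top. f x / tail \<rho> x \<le> 1 / c * (f x / tail \<mu> x)"
      proof (intro always_eventually allI)
        fix x
        have "f x * (c * tail \<mu> x) \<le> f x * tail \<rho> x"
          by (intro mult_left_mono c f)
        then show "f x / tail \<rho> x \<le> 1 / c * (f x / tail \<mu> x)"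
          using pos[of x] tail_pos[of x] c(1) by (simp add: field_simps)
      qed
    qed (simp add: divide_nonneg_nonneg f)
  qed
qed

text \<open>With the denominator fixed, L(0) becomes a condition that is stable under convolution
  and under passing to factors.\<close>

lemma comparable_L0_iff:
  assumes "comparable \<rho>"
  shows "\<rho> \<in> class_L0 \<longleftrightarrow> negligible_mass \<rho>"
  using assms class_L0_iff[of \<rho>] comparable_tail_pos[OF assms]
    comparable_ratio_tendsto_0_iff[OF assms, of "unit_mass \<rho>"]
  by (simp add: comparable_def controlled_real_distribution negligible_mass_def)

lemma comparable_conv_pow:
  assumes "comparable \<rho>" "n \<ge> 1" shows "comparable (conv_pow \<rho> n)"
  using assms(2)
proof (induction n rule: dec_induct)
  case base
  show ?case
    using assms conv_pow_1 by (simp add: comparable_def controlled_real_distribution)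
next
  case (step n)
  then show ?case
    using assms comparable_convolution[of \<rho> "conv_pow \<rho> n"] by (simp add: comparable_def)
qed

lemma controlled_conv_pow:
  assumes "controlled \<rho>" "n \<ge> 1" shows "controlled (conv_pow \<rho> n)"
  using assms(2)
proof (induction n rule: dec_induct)
  case base
  show ?case
    using assms conv_pow_1 by (simp add: controlled_real_distribution)
qed (use assms in \<open>auto intro: controlled_convolution\<close>)

lemma negligible_mass_conv_pow:
  assumes "controlled \<rho>" "negligible_mass \<rho>" "n \<ge> 1" shows "negligible_mass (conv_pow \<rho> n)"
  using assms(3)
proof (induction n rule: dec_induct)
  case base
  show ?case
    using assms conv_pow_1 by (simp add: controlled_real_distribution)
next
  case (step n)
  then show ?case
    using assms by (auto intro!: negligible_mass_convolution controlled_conv_pow)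
qed

text \<open>Negligible unit masses pass up from \<mu> to its powers by convolution and down again
  because \<mu> is a factor; writing \<open>n\<close> as \<open>Suc m\<close> exhibits it. Both
  hypotheses are instances.\<close>

lemma L0_iff_conv_pow:
  assumes "n \<ge> 1"
  shows "conv_pow \<mu> n \<in> class_L0 \<longleftrightarrow> \<mu> \<in> class_L0"
proof -
  obtain m where n: "n = Suc m" using assms by (cases n) auto
  have "negligible_mass (conv_pow \<mu> n) \<longleftrightarrow> negligible_mass \<mu>"
    using negligible_mass_conv_pow[OF controlled_self _ assms]
      negligible_mass_factor[OF real_dist real_distribution_conv_pow[OF real_dist, of m]]
    by (auto simp: n)
  then show ?thesis
    using comparable_L0_iff[OF comparable_self]
      comparable_L0_iff[OF comparable_conv_pow[OF comparable_self assms]] by simp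
qed

text \<open>Values \<open>y \<le> a\<close> of the light summand cost at most a shift by
  \<open>a\<close>. Values beyond \<open>a\<close> are weighted by
  \<open>1 + exp (\<gamma> * y)\<close>, which is integrable, so their share is below \<epsilon> for
  large \<open>a\<close>, uniformly in \<open>x\<close>.\<close>

lemma light_convolution_tail_le:
  assumes \<rho>: "controlled \<rho>" and \<zeta>: "real_distribution \<zeta>" "light_tailed \<zeta>" and "\<epsilon> > 0"
  shows "\<exists>a. \<forall>x. tail (\<zeta> \<star> \<rho>) x \<le> tail \<rho> (x - a) + \<epsilon> * tail \<mu> x"
proof -
  interpret \<zeta>: real_distribution \<zeta> by fact
  have R: "real_distribution \<rho>" by (rule controlled_real_distribution[OF \<rho>])
  obtain C where C: "C > 0" "\<And>x. tail \<rho> x \<le> C * tail \<mu> x"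
    using controlledE[OF \<rho>] by blast
  obtain K \<gamma> where K: "K > 0" "\<gamma> > 0" "\<And>x y. tail \<mu> (x - y) \<le> K * (1 + exp (\<gamma> * y)) * tail \<mu> x"
    by (rule tail_shift_exp) blast
  define g where "g a y = indicator {a<..} y * (1 + exp (\<gamma> * y))" for a y :: real
  have I: "integrable \<zeta> (\<lambda>y. 1 + exp (\<gamma> * y))"
    using \<zeta>(2) K(2) by (auto simp: light_tailed_def)
  have gm[measurable]: "g a \<in> borel_measurable borel" for a unfolding g_def by measurable
  have Ig: "integrable \<zeta> (g a)" for a
    by (rule Bochner_Integration.integrable_bound[OF I]) (auto simp: g_def indicator_def)
  have "((\<lambda>a. \<integral>y. g a y \<partial>\<zeta>) \<longlongrightarrow> (\<integral>y. 0 \<partial>\<zeta>)) at_top"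
  proof (rule integral_dominated_convergence_at_top[OF _ _ I])
    show "AE y in \<zeta>. ((\<lambda>a. g a y) \<longlongrightarrow> 0) at_top"
    proof (rule AE_I2)
      fix y
      have "\<forall>\<^sub>F a in at_top. g a y = 0"
        using eventually_ge_at_top[of y] by eventually_elim (auto simp: g_def)
      then show "((\<lambda>a. g a y) \<longlongrightarrow> 0) at_top" by (rule tendsto_eventually)
    qed
    show "\<forall>\<^sub>F i in at_top. AE x in \<zeta>. norm (g i x) \<le> 1 + exp (\<gamma> * x)"
      by (auto simp: g_def indicator_def)
  qed auto
  then have "((\<lambda>a. \<integral>y. g a y \<partial>\<zeta>) \<longlongrightarrow> 0) at_top" by simp
  moreover have "0 < \<epsilon> / (C * K)" using C K \<open>\<epsilon> > 0\<close> by simp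
  ultimately have "\<forall>\<^sub>F a in at_top. (\<integral>y. g a y \<partial>\<zeta>) < \<epsilon> / (C * K)"
    by (rule order_tendstoD)
  then obtain a where a: "(\<integral>y. g a y \<partial>\<zeta>) < \<epsilon> / (C * K)"
    by (auto simp: eventually_at_top_linorder)
  have "tail (\<zeta> \<star> \<rho>) x \<le> tail \<rho> (x - a) + \<epsilon> * tail \<mu> x" for x
  proof -
    have "tail (\<zeta> \<star> \<rho>) x \<le> (\<integral>y. tail \<rho> (x - a) + (C * K * tail \<mu> x) * g a y \<partial>\<zeta>)"
      unfolding tail_convolution[OF \<zeta>(1) R]
    proof (rule integral_mono)
      fix y
      show "tail \<rho> (x - y) \<le> tail \<rho> (x - a) + (C * K * tail \<mu> x) * g a y"
      proof (cases "y \<le> a")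
        case True
        then show ?thesis
          using tail_mono[OF R, of "x - a" "x - y"] by (simp add: g_def)
      next
        case False
        have "tail \<rho> (x - y) \<le> C * (K * (1 + exp (\<gamma> * y)) * tail \<mu> x)"
          using C(2)[of "x - y"] mult_left_mono[OF K(3)[of x y], of C] C(1) by linarith
        also have "\<dots> = (C * K * tail \<mu> x) * g a y"
          using False by (simp add: g_def)
        finally show ?thesis using tail_nonneg[of \<rho> "x - a"] by linarith
      qed
    qed (auto intro!: tail_convolution \<zeta>(1) R Ig)
    also have "\<dots> = tail \<rho> (x - a) + (C * K * tail \<mu> x) * (\<integral>y. g a y \<partial>\<zeta>)"
      using Ig \<zeta>.prob_space by simp
    also have "\<dots> \<le> tail \<rho> (x - a) + (C * K * tail \<mu> x) * (\<epsilon> / (C * K))"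
      using a C K by (intro add_left_mono mult_left_mono) auto
    also have "\<dots> = tail \<rho> (x - a) + \<epsilon> * tail \<mu> x"
      using C K by simp
    finally show ?thesis .
  qed
  then show ?thesis by blast
qed

end

theorem hypothesis_I0_holds: "hypothesis_I0"
  unfolding hypothesis_I0_def
proof (intro ballI allI impI)
  fix \<mu> n assume "\<mu> \<in> class_OS \<inter> class_ID" "1 \<le> n" "conv_pow \<mu> n \<in> class_L0"
  then interpret OS_distribution \<mu> by unfold_locales auto
  show "conv_pow \<mu> (n + 1) \<in> class_L0"
    using L0_iff_conv_pow[of n] \<open>1 \<le> n\<close> \<open>conv_pow \<mu> n \<in> class_L0\<close> L0_iff_conv_pow[of "n + 1"] by auto
qed

theorem hypothesis_II0_holds: "hypothesis_II0"
  unfolding hypothesis_II0_def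
proof (intro ballI impI)
  fix \<mu> assume "\<mu> \<in> class_OS \<inter> class_ID" "\<exists>n\<ge>1. conv_pow \<mu> n \<in> class_L0"
  then interpret OS_distribution \<mu> by unfold_locales auto
  show "\<mu> \<in> class_L0"
    using L0_iff_conv_pow \<open>\<exists>n\<ge>1. conv_pow \<mu> n \<in> class_L0\<close> by auto
qed

section \<open>Levy continuity and compound Poisson distributions\<close>

text \<open>Averaging a characteristic function over a Gaussian gives, by Fubini, the Gaussian integral
  \<open>\<integral> exp (- (u x)\<^sup>2 / 2) dM\<close>, which controls the mass of \<open>M\<close> far from the origin.\<close>

lemma char_gaussian_average:
  assumes "real_distribution M"
  shows "(CLINT y|std_normal_distribution. 1 - char M (u * y)) =
           of_real (\<integral>x. 1 - exp (- (u * x)\<^sup>2 / 2) \<partial>M)"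
proof -
  interpret M: real_distribution M by fact
  interpret G: real_distribution std_normal_distribution by (rule real_dist_normal_dist)
  interpret P: pair_prob_space std_normal_distribution M ..
  have [measurable]: "char M \<in> borel_measurable borel" by (rule M.char_measurable)
  have iM: "integrable M (\<lambda>x. exp (- (u * x)\<^sup>2 / 2))"
    by (rule M.integrable_const_bound[where B=1]) auto
  have iG: "complex_integrable std_normal_distribution (\<lambda>y. char M (u * y))"
    by (rule G.integrable_const_bound[where B=1]) (auto simp: M.cmod_char_le_1)
  have "(CLINT y|std_normal_distribution. char M (u * y)) =
        (CLINT y|std_normal_distribution. CLINT x|M. iexp (u * y * x))"
    by (simp add: char_def)
  also have "\<dots> = (CLINT x|M. CLINT y|std_normal_distribution. iexp (u * y * x))"
    by (rule P.Fubini_integral[symmetric])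
       (auto intro!: P.integrable_const_bound[where B=1] simp: split_beta')
  also have "\<dots> = (CLINT x|M. char std_normal_distribution (u * x))"
    by (simp add: char_def ac_simps)
  also have "\<dots> = of_real (\<integral>x. exp (- (u * x)\<^sup>2 / 2) \<partial>M)"
    unfolding char_std_normal_distribution by (rule integral_complex_of_real)
  finally have "(CLINT y|std_normal_distribution. char M (u * y)) = of_real (\<integral>x. exp (- (u * x)\<^sup>2 / 2) \<partial>M)" .
  then show ?thesis
    using iM iG M.prob_space G.prob_space by simp
qed

text \<open>Markov's inequality: on the set, \<open>(u * x)\<^sup>2 / 2\<close> is at least
  2.\<close>

lemma measure_abs_ge_le:
  assumes "real_distribution M" "u > 0"
  shows "(1 - exp (- 2)) * measure M {x. \<bar>x\<bar> \<ge> 2 / u} \<le> (\<integral>x. 1 - exp (- (u * x)\<^sup>2 / 2) \<partial>M)"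
proof -
  interpret M: real_distribution M by fact
  have [measurable]: "{x. \<bar>x\<bar> \<ge> 2 / u} \<in> sets borel" by simp
  have "(1 - exp (- 2)) * measure M {x. \<bar>x\<bar> \<ge> 2 / u} =
      (\<integral>x. (1 - exp (- 2)) * indicator {x. \<bar>x\<bar> \<ge> 2 / u} x \<partial>M)"
    by simp
  also have "\<dots> \<le> (\<integral>x. 1 - exp (- (u * x)\<^sup>2 / 2) \<partial>M)"
  proof (rule integral_mono)
    show "integrable M (\<lambda>x. (1 - exp (- 2)) * indicat_real {x. \<bar>x\<bar> \<ge> 2 / u} x)"
      by (rule M.integrable_const_bound[where B=1]) (auto simp: indicator_def)
    show "integrable M (\<lambda>x. 1 - exp (- (u * x)\<^sup>2 / 2))"
      by (rule M.integrable_const_bound[where B=1]) auto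
    fix x
    show "(1 - exp (- 2)) * indicat_real {x. \<bar>x\<bar> \<ge> 2 / u} x \<le> 1 - exp (- (u * x)\<^sup>2 / 2)"
    proof (cases "\<bar>x\<bar> \<ge> 2 / u")
      case True
      then have "2 \<le> \<bar>u * x\<bar>" using \<open>u > 0\<close> by (simp add: field_simps abs_mult)
      then have "2\<^sup>2 \<le> \<bar>u * x\<bar>\<^sup>2" by (intro power_mono) auto
      then show ?thesis using True by simp
    qed auto
  qed
  finally show ?thesis .
qed

text \<open>Here the limit is not known to be a characteristic function. Continuity at 0 makes the
  Gaussian average of \<open>1 - f (u * y)\<close> small for small \<open>u\<close>; this carries
  over to all large \<open>n\<close> and gives tightness. A weak subsequential limit then has
  characteristic function \<open>f\<close>.\<close>

theorem levy_continuity_existence: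
  assumes R: "\<And>n. real_distribution (M n)"
    and conv: "\<And>z. (\<lambda>n. char (M n) z) \<longlonglongrightarrow> f z"
    and cont: "isCont f 0"
  obtains N where "real_distribution N" "char N = f" "weak_conv_m M N"
proof -
  interpret Mn: real_distribution "M n" for n by (rule R)
  interpret G: real_distribution std_normal_distribution by (rule real_dist_normal_dist)
  define c :: real where "c = 1 - exp (- 2)"
  have c: "c > 0" by (simp add: c_def)
  have [measurable]: "char (M n) \<in> borel_measurable borel" for n by (rule Mn.char_measurable)
  have [measurable]: "f \<in> borel_measurable borel"
    by (rule borel_measurable_LIMSEQ_metric[where f="\<lambda>n. char (M n)"]) (auto intro: conv)
  have f_le: "cmod (f z) \<le> 1" for z
    by (rule LIMSEQ_le_const2[OF tendsto_norm[OF conv]]) (auto simp: Mn.cmod_char_le_1)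
  have f0: "f 0 = 1"
    using conv[of 0] by (simp add: Mn.char_zero LIMSEQ_const_iff)
  have bd: "cmod (1 - f z) \<le> 2" "cmod (1 - char (M n) z) \<le> 2" for n z
    using norm_triangle_ineq4[of 1 "f z"] norm_triangle_ineq4[of 1 "char (M n) z"]
      f_le[of z] Mn.cmod_char_le_1[of n z] by auto
  have tight_aux: "\<exists>K. \<forall>n. measure (M n) {x. \<bar>x\<bar> \<ge> K} < \<epsilon>" if "\<epsilon> > 0" for \<epsilon> :: real
  proof -
    have "(\<lambda>k. CLINT y|std_normal_distribution. 1 - f (inverse (real (Suc k)) * y)) \<longlonglongrightarrow>
          (CLINT y|std_normal_distribution. 0)"
    proof (rule integral_dominated_convergence[where w="\<lambda>_. 2"])
      show "AE y in std_normal_distribution. (\<lambda>k. 1 - f (inverse (real (Suc k)) * y)) \<longlonglongrightarrow> 0"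
      proof (rule AE_I2)
        fix y
        have "(\<lambda>k. inverse (real (Suc k)) * y) \<longlonglongrightarrow> 0 * y"
          by (intro tendsto_intros LIMSEQ_inverse_real_of_nat)
        then have "(\<lambda>k. f (inverse (real (Suc k)) * y)) \<longlonglongrightarrow> f 0"
          by (intro isCont_tendsto_compose[OF cont]) simp
        from tendsto_diff[OF tendsto_const[of 1] this]
        show "(\<lambda>k. 1 - f (inverse (real (Suc k)) * y)) \<longlonglongrightarrow> 0" by (simp add: f0)
      qed
    qed (auto simp: bd)
    then have "(\<lambda>k. CLINT y|std_normal_distribution. 1 - f (inverse (real (Suc k)) * y)) \<longlonglongrightarrow> 0"
      by simp
    \<comment> \<open>One half of \<open>c * \<epsilon>\<close> is for the limit \<open>f\<close>,
      the other for the distance of \<open>M n\<close> from it.\<close>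
    from LIMSEQ_D[OF this, of "c * \<epsilon> / 2"] obtain k
      where k: "cmod (CLINT y|std_normal_distribution. 1 - f (inverse (real (Suc k)) * y)) < c * \<epsilon> / 2"
      using c \<open>\<epsilon> > 0\<close> by auto
    define u where "u = inverse (real (Suc k))"
    have u: "u > 0" by (simp add: u_def)
    have "(\<lambda>n. CLINT y|std_normal_distribution. 1 - char (M n) (u * y)) \<longlonglongrightarrow>
          (CLINT y|std_normal_distribution. 1 - f (u * y))"
      by (rule integral_dominated_convergence[where w="\<lambda>_. 2"])
         (auto simp: bd intro!: tendsto_intros conv)
    from LIMSEQ_D[OF this, of "c * \<epsilon> / 2"] obtain N where N: "\<And>n. n \<ge> N \<Longrightarrow>
        cmod ((CLINT y|std_normal_distribution. 1 - char (M n) (u * y)) -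
              (CLINT y|std_normal_distribution. 1 - f (u * y))) < c * \<epsilon> / 2"
      using c \<open>\<epsilon> > 0\<close> by auto
    have big: "measure (M n) {x. \<bar>x\<bar> \<ge> 2 / u} < \<epsilon>" if "n \<ge> N" for n
    proof -
      have "c * measure (M n) {x. \<bar>x\<bar> \<ge> 2 / u} \<le> (\<integral>x. 1 - exp (- (u * x)\<^sup>2 / 2) \<partial>M n)"
        unfolding c_def by (rule measure_abs_ge_le[OF R u])
      also have "\<dots> \<le> cmod (of_real (\<integral>x. 1 - exp (- (u * x)\<^sup>2 / 2) \<partial>M n))"
        by simp
      also have "\<dots> = cmod (CLINT y|std_normal_distribution. 1 - char (M n) (u * y))"
        by (simp only: char_gaussian_average[OF R])
      also have "\<dots> < c * \<epsilon>"
        using N[OF that] k norm_triangle_sub[of "CLINT y|std_normal_distribution. 1 - char (M n) (u * y)"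
          "CLINT y|std_normal_distribution. 1 - f (u * y)"]
        unfolding u_def by linarith
      finally show ?thesis using c by simp
    qed
    have "\<exists>K. measure (M n) {x. \<bar>x\<bar> \<ge> K} < \<epsilon>" for n
    proof -
      have "(\<lambda>k. measure (M n) {x. \<bar>x\<bar> \<ge> real k}) \<longlonglongrightarrow> measure (M n) (\<Inter>k. {x. \<bar>x\<bar> \<ge> real k})"
        by (intro Mn.finite_Lim_measure_decseq) (auto simp: decseq_def)
      also have "(\<Inter>k. {x :: real. \<bar>x\<bar> \<ge> real k}) = {}"
        by (auto) (metis linorder_not_le reals_Archimedean2)
      finally have "(\<lambda>k. measure (M n) {x. \<bar>x\<bar> \<ge> real k}) \<longlonglongrightarrow> 0" by simp
      from order_tendstoD(2)[OF this \<open>\<epsilon> > 0\<close>] show ?thesis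
        by (auto simp: eventually_sequentially)
    qed
    then obtain K where K: "\<And>n. measure (M n) {x. \<bar>x\<bar> \<ge> K n} < \<epsilon>" by metis
    define L where "L = Max (insert (2 / u) (K ` {..<N}))"
    have "measure (M n) {x. \<bar>x\<bar> \<ge> L} < \<epsilon>" for n
    proof (cases "n < N")
      case True
      then have "K n \<le> L" by (auto simp: L_def)
      then have "measure (M n) {x. \<bar>x\<bar> \<ge> L} \<le> measure (M n) {x. \<bar>x\<bar> \<ge> K n}"
        by (intro Mn.finite_measure_mono) auto
      then show ?thesis using K[of n] by simp
    next
      case False
      have "2 / u \<le> L" by (auto simp: L_def)
      then have "measure (M n) {x. \<bar>x\<bar> \<ge> L} \<le> measure (M n) {x. \<bar>x\<bar> \<ge> 2 / u}"
        by (intro Mn.finite_measure_mono) auto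
      then show ?thesis using big[of n] False by simp
    qed
    then show ?thesis by blast
  qed
  have tight: "tight M"
    unfolding tight_def
  proof (intro conjI allI impI R)
    fix \<epsilon> :: real assume "\<epsilon> > 0"
    then obtain K where K: "\<And>n. measure (M n) {x. \<bar>x\<bar> \<ge> K} < \<epsilon>" using tight_aux by blast
    \<comment> \<open>The extra 1 keeps the interval nondegenerate when \<open>K\<close> is 0 and
      includes the left endpoint of the closed range.\<close>
    have "1 - \<epsilon> < measure (M n) {- \<bar>K\<bar> - 1<..\<bar>K\<bar>}" for n
    proof -
      have "1 - measure (M n) {x. \<bar>x\<bar> \<ge> K} = measure (M n) (space (M n) - {x. \<bar>x\<bar> \<ge> K})"
        by (rule Mn.prob_compl[symmetric]) auto
      also have "\<dots> \<le> measure (M n) {- \<bar>K\<bar> - 1<..\<bar>K\<bar>}"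
        by (intro Mn.finite_measure_mono) auto
      finally show ?thesis using K[of n] by linarith
    qed
    then show "\<exists>a b. a < b \<and> (\<forall>n. 1 - \<epsilon> < measure (M n) {a<..b})"
      by (intro exI[of _ "- \<bar>K\<bar> - 1"] exI[of _ "\<bar>K\<bar>"]) auto
  qed
  from tight_imp_convergent_subsubsequence[OF this strict_mono_id]
  obtain r N where r: "strict_mono r" and N: "real_distribution N" "weak_conv_m (M \<circ> id \<circ> r) N" by blast
  have "char N = f"
  proof
    fix z
    have "(\<lambda>n. char ((M \<circ> id \<circ> r) n) z) \<longlonglongrightarrow> char N z"
      by (rule levy_continuity1[OF _ N]) (auto simp: R)
    moreover have "(\<lambda>n. char ((M \<circ> id \<circ> r) n) z) \<longlonglongrightarrow> f z"
      using LIMSEQ_subseq_LIMSEQ[OF conv[of z] r] by (simp add: o_def)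
    ultimately show "char N z = f z" by (rule LIMSEQ_unique)
  qed
  moreover from this have "weak_conv_m M N"
    using conv by (intro levy_continuity R N) simp
  ultimately show ?thesis using N that by blast
qed

text \<open>The law of a sum of a Poisson number, of mean \<open>l\<close>, of independent
  \<open>M\<close>-distributed jumps. In bind form, probabilities become Poisson averages over the
  convolution powers.\<close>

definition compound_poisson :: "real \<Rightarrow> real measure \<Rightarrow> real measure" where
  "compound_poisson l M = measure_pmf (poisson_pmf l) \<bind> conv_pow M"

context
  fixes l :: real and M :: "real measure"
  assumes l: "l > 0" and M: "real_distribution M"
begin

lemma conv_pow_measurable_prob: "conv_pow M \<in> measure_pmf p \<rightarrow>\<^sub>M prob_algebra borel"
proof -
  have "conv_pow M k \<in> space (prob_algebra borel)" for k
    using real_distribution_conv_pow[OF M, of k]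
    by (auto simp: space_prob_algebra real_distribution_def real_distribution_axioms_def)
  then show ?thesis by (simp add: measurable_def)
qed

lemma conv_pow_measurable: "conv_pow M \<in> measure_pmf p \<rightarrow>\<^sub>M subprob_algebra borel"
  using conv_pow_measurable_prob by (rule measurable_prob_algebraD)

lemma real_distribution_compound_poisson: "real_distribution (compound_poisson l M)"
proof (rule real_distribution_of_prob_space)
  show "prob_space (compound_poisson l M)"
    unfolding compound_poisson_def
  proof (rule prob_space_bind'[OF _ conv_pow_measurable_prob])
    show "measure_pmf (poisson_pmf l) \<in> space (prob_algebra (measure_pmf (poisson_pmf l)))"
      by (simp add: space_prob_algebra measure_pmf.prob_space_axioms)
  qed
  show "sets (compound_poisson l M) = sets borel"
    unfolding compound_poisson_def
    using sets_bind[of "measure_pmf (poisson_pmf l)" "conv_pow M" borel] real_distribution_conv_pow[OF M]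
    by (simp add: real_distribution_def real_distribution_axioms_def)
qed

lemma measure_compound_poisson:
  assumes "A \<in> sets borel"
  shows "measure (compound_poisson l M) A = (\<integral>k. measure (conv_pow M k) A \<partial>poisson_pmf l)"
  unfolding compound_poisson_def
  by (rule measure_pmf.measure_bind[OF conv_pow_measurable assms])

lemma nn_integral_compound_poisson:
  "f \<in> borel_measurable borel \<Longrightarrow>
    (\<integral>\<^sup>+x. f x \<partial>compound_poisson l M) = (\<integral>\<^sup>+k. \<integral>\<^sup>+x. f x \<partial>conv_pow M k \<partial>poisson_pmf l)"
  unfolding compound_poisson_def by (rule nn_integral_bind[OF _ conv_pow_measurable])

lemma integral_compound_poisson:
  fixes f :: "real \<Rightarrow> real"
  assumes "f \<in> borel_measurable borel" "\<And>x. \<bar>f x\<bar> \<le> B"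
  shows "(\<integral>x. f x \<partial>compound_poisson l M) = (\<integral>k. \<integral>x. f x \<partial>conv_pow M k \<partial>poisson_pmf l)"
  unfolding compound_poisson_def
proof (rule integral_bind[OF assms(1) _ conv_pow_measurable])
  have "prob_space (conv_pow M k)" for k
    using real_distribution_conv_pow[OF M] by (simp add: real_distribution_def)
  then show "AE x in measure_pmf (poisson_pmf l). emeasure (conv_pow M x) (space (conv_pow M x)) \<le> ennreal 1"
    by (simp add: prob_space.emeasure_space_1)
qed (use assms in \<open>auto intro: measure_pmf.finite_measure\<close>)

text \<open>The generating function of the Poisson law. The field is left general because complex
  \<open>w\<close> yields characteristic functions and real \<open>w\<close> exponential
  moments.\<close>

lemma integrable_poisson_power:
  fixes w :: "'a :: {real_normed_field, banach, second_countable_topology}"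
  shows "integrable (measure_pmf (poisson_pmf l)) (\<lambda>k. w ^ k)"
    and "(\<integral>k. w ^ k \<partial>poisson_pmf l) = of_real (exp (- l)) * exp (of_real l * w)"
proof -
  have eq: "pmf (poisson_pmf l) k *\<^sub>R w ^ k = of_real (exp (- l)) * ((of_real l * w) ^ k /\<^sub>R fact k)" for k
    using l by (simp add: scaleR_conv_of_real power_mult_distrib field_simps)
  have "summable (\<lambda>k. norm (of_real (exp (- l)) * ((of_real l * w) ^ k /\<^sub>R fact k)))"
    unfolding norm_mult by (intro summable_mult summable_norm_exp)
  then have I: "integrable (count_space UNIV) (\<lambda>k. pmf (poisson_pmf l) k *\<^sub>R w ^ k)"
    by (simp only: eq integrable_count_space_nat_iff)
  then show "integrable (measure_pmf (poisson_pmf l)) (\<lambda>k. w ^ k)"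
    unfolding measure_pmf_eq_density by (subst integrable_density) auto
  have "(\<integral>k. w ^ k \<partial>poisson_pmf l) = (\<integral>k. pmf (poisson_pmf l) k *\<^sub>R w ^ k \<partial>count_space UNIV)"
    unfolding measure_pmf_eq_density by (subst integral_density) auto
  also have "\<dots> = (\<Sum>k. pmf (poisson_pmf l) k *\<^sub>R w ^ k)"
    by (rule integral_count_space_nat[OF I])
  also have "\<dots> = of_real (exp (- l)) * (\<Sum>k. (of_real l * w) ^ k /\<^sub>R fact k)"
    unfolding eq by (rule suminf_mult[OF summable_exp_generic])
  also have "(\<Sum>k. (of_real l * w) ^ k /\<^sub>R fact k) = exp (of_real l * w)"
    by (simp add: exp_def)
  finally show "(\<integral>k. w ^ k \<partial>poisson_pmf l) = of_real (exp (- l)) * exp (of_real l * w)" .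
qed

text \<open>Cosine and sine are averaged separately, since \<open>integral_compound_poisson\<close>
  concerns real functions. Recombined, they give the Poisson generating function at
  \<open>char M z\<close>.\<close>

lemma char_compound_poisson: "char (compound_poisson l M) z = exp (of_real l * (char M z - 1))"
proof -
  interpret M: real_distribution M by (rule M)
  interpret C: real_distribution "compound_poisson l M" by (rule real_distribution_compound_poisson)
  interpret P: real_distribution "conv_pow M k" for k by (intro real_distribution_conv_pow M)
  have iexp_eq: "iexp x = of_real (cos x) + \<i> * of_real (sin x)" for x :: real
    by (simp add: exp_Euler cos_of_real sin_of_real)
  have *: "char N z = of_real (\<integral>x. cos (z * x) \<partial>N) + \<i> * of_real (\<integral>x. sin (z * x) \<partial>N)"
    if "real_distribution N" for N
  proof -
    interpret N: real_distribution N by fact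
    have "integrable N (\<lambda>x. cos (z * x))" "integrable N (\<lambda>x. sin (z * x))"
      by (auto intro!: N.integrable_const_bound[where B=1])
    then show ?thesis
      unfolding char_def iexp_eq by simp
  qed
  have "char (compound_poisson l M) z =
      of_real (\<integral>k. \<integral>x. cos (z * x) \<partial>conv_pow M k \<partial>poisson_pmf l) +
      \<i> * of_real (\<integral>k. \<integral>x. sin (z * x) \<partial>conv_pow M k \<partial>poisson_pmf l)"
    unfolding *[OF real_distribution_compound_poisson]
    by (simp add: integral_compound_poisson[where B=1])
  also have "\<dots> = (\<integral>k. of_real (\<integral>x. cos (z * x) \<partial>conv_pow M k) +
      \<i> * of_real (\<integral>x. sin (z * x) \<partial>conv_pow M k) \<partial>poisson_pmf l)"
  proof -
    have "\<bar>\<integral>x. cos (z * x) \<partial>conv_pow M k\<bar> \<le> 1" "\<bar>\<integral>x. sin (z * x) \<partial>conv_pow M k\<bar> \<le> 1" for k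
    proof -
      have "\<bar>\<integral>x. f x \<partial>conv_pow M k\<bar> \<le> 1" if "\<And>x. \<bar>f x\<bar> \<le> 1" "f \<in> borel_measurable borel" for f :: "real \<Rightarrow> real"
      proof -
        have "\<bar>\<integral>x. f x \<partial>conv_pow M k\<bar> \<le> (\<integral>x. \<bar>f x\<bar> \<partial>conv_pow M k)" by (rule integral_abs_bound)
        also have "\<dots> \<le> (\<integral>x. 1 \<partial>conv_pow M k)"
          using that by (intro integral_mono P.integrable_const_bound[where B=1]) auto
        finally show ?thesis using P.prob_space by simp
      qed
      then show "\<bar>\<integral>x. cos (z * x) \<partial>conv_pow M k\<bar> \<le> 1" "\<bar>\<integral>x. sin (z * x) \<partial>conv_pow M k\<bar> \<le> 1"
        by auto
    qed
    then have "integrable (poisson_pmf l) (\<lambda>k. \<integral>x. cos (z * x) \<partial>conv_pow M k)"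
      "integrable (poisson_pmf l) (\<lambda>k. \<integral>x. sin (z * x) \<partial>conv_pow M k)"
      by (auto intro!: measure_pmf.integrable_const_bound[where B=1])
    then show ?thesis by simp
  qed
  also have "\<dots> = (\<integral>k. char M z ^ k \<partial>poisson_pmf l)"
    by (simp add: *[OF real_distribution_conv_pow[OF M], symmetric] char_conv_pow[OF M])
  also have "\<dots> = exp (of_real l * (char M z - 1))"
    by (simp add: integrable_poisson_power exp_of_real[symmetric] exp_add[symmetric] algebra_simps)
  finally show ?thesis .
qed

lemma nn_integral_exp_conv_pow:
  assumes "integrable M (\<lambda>x. exp (\<theta> * x))"
  shows "(\<integral>\<^sup>+x. exp (\<theta> * x) \<partial>conv_pow M k) = ennreal ((\<integral>x. exp (\<theta> * x) \<partial>M) ^ k)"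
proof (induction k)
  case 0
  show ?case by (simp add: nn_integral_return)
next
  case (Suc n)
  interpret M: real_distribution M by (rule M)
  interpret P: real_distribution "conv_pow M k" for k by (intro real_distribution_conv_pow M)
  have "(\<integral>\<^sup>+x. exp (\<theta> * x) \<partial>conv_pow M (Suc n)) =
      (\<integral>\<^sup>+x. \<integral>\<^sup>+y. ennreal (exp (\<theta> * x)) * ennreal (exp (\<theta> * y)) \<partial>conv_pow M n \<partial>M)"
    by (simp add: nn_integral_convolution M.finite_measure_axioms P.finite_measure_axioms
        ring_distribs exp_add ennreal_mult)
  also have "\<dots> = (\<integral>\<^sup>+x. exp (\<theta> * x) \<partial>M) * (\<integral>\<^sup>+x. exp (\<theta> * x) \<partial>conv_pow M n)"
    by (simp add: nn_integral_cmult nn_integral_multc)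
  also note Suc.IH
  also have "(\<integral>\<^sup>+x. exp (\<theta> * x) \<partial>M) = ennreal (\<integral>x. exp (\<theta> * x) \<partial>M)"
    using assms by (intro nn_integral_eq_integral) auto
  finally show ?case by (simp add: ennreal_mult)
qed

lemma nn_integral_exp_compound_poisson:
  assumes "integrable M (\<lambda>x. exp (\<theta> * x))"
  shows "(\<integral>\<^sup>+x. exp (\<theta> * x) \<partial>compound_poisson l M) = ennreal (exp (l * ((\<integral>x. exp (\<theta> * x) \<partial>M) - 1)))"
proof -
  have "(\<integral>\<^sup>+x. exp (\<theta> * x) \<partial>compound_poisson l M) =
      (\<integral>\<^sup>+k. ennreal ((\<integral>x. exp (\<theta> * x) \<partial>M) ^ k) \<partial>poisson_pmf l)"
    by (simp add: nn_integral_compound_poisson nn_integral_exp_conv_pow[OF assms])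
  also have "\<dots> = ennreal (\<integral>k. (\<integral>x. exp (\<theta> * x) \<partial>M) ^ k \<partial>poisson_pmf l)"
    by (intro nn_integral_eq_integral integrable_poisson_power) auto
  also have "\<dots> = ennreal (exp (l * ((\<integral>x. exp (\<theta> * x) \<partial>M) - 1)))"
    by (simp add: integrable_poisson_power(2) exp_add[symmetric] algebra_simps)
  finally show ?thesis .
qed

end

section \<open>Convolution powers with real exponent\<close>

text \<open>The difference is continuous with values in the integer multiples of
  \<open>2 * pi * \<i>\<close>. Distinct values are at least \<open>2 * pi\<close> apart, so it is
  constant.\<close>

lemma continuous_log_unique:
  fixes f g :: "real \<Rightarrow> complex"
  assumes "continuous_on UNIV f" "continuous_on UNIV g" "f 0 = g 0"
    and eq: "\<And>z. exp (f z) = exp (g z)"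
  shows "f = g"
proof -
  have "(\<lambda>z. f z - g z) constant_on UNIV"
  proof (rule continuous_discrete_range_constant)
    show "continuous_on UNIV (\<lambda>z. f z - g z)" using assms by (intro continuous_intros)
    fix x :: real
    have *: "\<exists>n::int. f y - g y = of_real (2 * pi * of_int n) * \<i>" for y
    proof -
      obtain n :: int where "f y = g y + of_int (2 * n) * of_real pi * \<i>"
        using eq[of y] by (auto simp: exp_eq)
      then show ?thesis by (intro exI[of _ n]) (simp add: algebra_simps)
    qed
    show "\<exists>e>0. \<forall>y. y \<in> UNIV \<and> f y - g y \<noteq> f x - g x \<longrightarrow> e \<le> norm ((f y - g y) - (f x - g x))"
    proof (intro exI[of _ "2 * pi"] conjI allI impI)
      fix y assume ne: "y \<in> UNIV \<and> f y - g y \<noteq> f x - g x"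
      obtain m n :: int where mn: "f y - g y = of_real (2 * pi * of_int m) * \<i>"
        "f x - g x = of_real (2 * pi * of_int n) * \<i>"
        using *[of x] *[of y] by auto
      have "(f y - g y) - (f x - g x) = of_real (2 * pi * of_int (m - n)) * \<i>"
        unfolding mn by (simp add: algebra_simps)
      then have "norm ((f y - g y) - (f x - g x)) = 2 * pi * \<bar>of_int (m - n)\<bar>"
        by (simp only: norm_mult norm_of_real norm_ii mult_1_right abs_mult) simp
      moreover have "m \<noteq> n" using ne mn by auto
      then have "1 \<le> \<bar>of_int (m - n) :: real\<bar>" by linarith
      then have "2 * pi * 1 \<le> 2 * pi * \<bar>of_int (m - n)\<bar>"
        by (intro mult_left_mono) auto
      ultimately show "2 * pi \<le> norm ((f y - g y) - (f x - g x))" by simp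
    qed simp
  qed simp
  then obtain c where c: "\<And>z. f z - g z = c" by (auto simp: constant_on_def)
  from c[of 0] assms have "c = 0" by simp
  with c show ?thesis by (simp add: fun_eq_iff)
qed

text \<open>Discharges the definite description: the logarithm is forced by
  \<open>continuous_log_unique\<close>, and the distribution then by its characteristic
  function.\<close>

lemma conv_rpow_eqI:
  assumes "real_distribution \<rho>" "continuous_on UNIV \<psi>" "\<psi> 0 = 0"
    and "\<And>z. char \<mu> z = exp (\<psi> z)" "\<And>z. char \<rho> z = exp (of_real t * \<psi> z)"
  shows "conv_rpow \<mu> t = \<rho>"
  unfolding conv_rpow_def
proof (rule the_equality)
  show "real_distribution \<rho> \<and> (\<exists>\<psi>. continuous_on UNIV \<psi> \<and> \<psi> 0 = 0 \<and>
      (\<forall>z. char \<mu> z = exp (\<psi> z)) \<and> (\<forall>z. char \<rho> z = exp (complex_of_real t * \<psi> z)))"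
    using assms by blast
  fix \<sigma>
  assume "real_distribution \<sigma> \<and> (\<exists>\<psi>. continuous_on UNIV \<psi> \<and> \<psi> 0 = 0 \<and>
      (\<forall>z. char \<mu> z = exp (\<psi> z)) \<and> (\<forall>z. char \<sigma> z = exp (complex_of_real t * \<psi> z)))"
  then obtain \<phi> where \<sigma>: "real_distribution \<sigma>" and \<phi>: "continuous_on UNIV \<phi>" "\<phi> 0 = 0"
    "\<And>z. char \<mu> z = exp (\<phi> z)" "\<And>z. char \<sigma> z = exp (complex_of_real t * \<phi> z)" by blast
  have "\<phi> = \<psi>"
    by (rule continuous_log_unique[OF \<phi>(1) assms(2)]) (simp_all only: \<phi>(2) assms(3) \<phi>(3)[symmetric] assms(4))
  then show "\<sigma> = \<rho>"
    using assms \<sigma> \<phi> by (intro Levy_uniqueness) auto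
qed

text \<open>Convolving with the reflected law turns the squared modulus into an average of
  \<open>cos (z * x)\<close>. Then \<open>1 - cos (2 * v) = 2 * (1 - cos v) * (1 + cos v)\<close> is
  at most \<open>4 * (1 - cos v)\<close>.\<close>

lemma char_double_bound:
  assumes "real_distribution M"
  shows "1 - (cmod (char M (2 * z)))\<^sup>2 \<le> 4 * (1 - (cmod (char M z))\<^sup>2)"
proof -
  interpret M: real_distribution M by fact
  define N where "N = distr M borel uminus"
  have N: "real_distribution N"
    unfolding N_def by (intro real_distribution_of_prob_space M.prob_space_distr) auto
  interpret S: real_distribution "M \<star> N"
    using assms N by (rule real_distribution_convolution)
  have charN: "char N z = cnj (char M z)" for z
  proof -
    have "char N z = (CLINT x|M. iexp (z * - x))"
      unfolding char_def N_def by (subst integral_distr) auto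
    also have "\<dots> = (CLINT x|M. cnj (iexp (z * x)))"
      by (simp add: exp_cnj)
    finally show ?thesis by (simp add: char_def)
  qed
  have sq: "(cmod (char M z))\<^sup>2 = (\<integral>x. cos (z * x) \<partial>(M \<star> N))" for z
  proof -
    have "complex_of_real ((cmod (char M z))\<^sup>2) = char (M \<star> N) z"
      unfolding char_convolution[OF assms N] charN by (rule complex_norm_square)
    then have "(cmod (char M z))\<^sup>2 = Re (char (M \<star> N) z)"
      by (metis Re_complex_of_real)
    also have "\<dots> = (\<integral>x. Re (iexp (z * x)) \<partial>(M \<star> N))"
      unfolding char_def
      by (intro integral_Re[symmetric] S.integrable_const_bound[where B=1]) auto
    finally show ?thesis by (simp add: Re_exp)
  qed
  have I: "integrable (M \<star> N) (\<lambda>x. cos (z * x))" for z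
    by (rule S.integrable_const_bound[where B=1]) auto
  have "(\<integral>x. 1 - cos (2 * z * x) \<partial>(M \<star> N)) \<le> (\<integral>x. 4 * (1 - cos (z * x)) \<partial>(M \<star> N))"
  proof (rule integral_mono)
    fix x
    have "1 - cos (2 * z * x) = 2 * ((1 - cos (z * x)) * (1 + cos (z * x)))"
      using cos_double_cos[of "z * x"] by (simp add: algebra_simps power2_eq_square)
    also have "\<dots> \<le> 2 * ((1 - cos (z * x)) * 2)"
    proof -
      have "1 + cos (z * x) \<le> 2" using cos_le_one[of "z * x"] by linarith
      then show ?thesis by (intro mult_left_mono) auto
    qed
    finally show "1 - cos (2 * z * x) \<le> 4 * (1 - cos (z * x))" by simp
  qed (auto intro!: I integrable_diff integrable_mult_right)
  then show ?thesis
    using I S.prob_space by (simp add: sq)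
qed

text \<open>A zero at \<open>2 * z\<close> is shared by every root, so each root has squared modulus
  at most 3/4 at \<open>z\<close>. The \<open>n\<close>-th power then bounds that of \<mu> by
  \<open>(3/4) ^ n\<close> for all \<open>n\<close>. Hence nonvanishing spreads from
  \<open>z\<close> to \<open>2 * z\<close>, starting near 0.\<close>

lemma class_ID_char_nonzero:
  assumes "\<mu> \<in> class_ID"
  shows "char \<mu> z \<noteq> 0"
proof -
  have R: "real_distribution \<mu>" using assms by (simp add: class_ID_def)
  interpret M: real_distribution \<mu> by (rule R)
  have double: "char \<mu> (2 * z) \<noteq> 0" if "char \<mu> z \<noteq> 0" for z
  proof
    assume 0: "char \<mu> (2 * z) = 0"
    have "(cmod (char \<mu> z))\<^sup>2 \<le> (3/4) ^ n" if "n \<ge> 1" for n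
    proof -
      obtain \<rho> where \<rho>: "real_distribution \<rho>" "conv_pow \<rho> n = \<mu>"
        using assms \<open>n \<ge> 1\<close> by (auto simp: class_ID_def)
      have pow: "char \<mu> y = char \<rho> y ^ n" for y
        using char_conv_pow[OF \<rho>(1), of n y] \<rho>(2) by simp
      have "char \<rho> (2 * z) = 0" using 0 pow[of "2 * z"] by simp
      then have "(cmod (char \<rho> z))\<^sup>2 \<le> 3/4"
        using char_double_bound[OF \<rho>(1), of z] by simp
      then have "((cmod (char \<rho> z))\<^sup>2) ^ n \<le> (3/4) ^ n"
        by (intro power_mono) auto
      then show ?thesis
        by (simp add: pow norm_power power_mult[symmetric] mult.commute)
    qed
    then have "(cmod (char \<mu> z))\<^sup>2 \<le> 0"
      by (intro LIMSEQ_le_const[OF LIMSEQ_power_zero[of "3/4 :: real"]]) (auto intro!: exI[of _ 1])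
    then show False using that by simp
  qed
  have "isCont (char \<mu>) 0" by (rule M.isCont_char)
  then obtain d where d: "d > 0" "\<And>y. \<bar>y\<bar> < d \<Longrightarrow> cmod (char \<mu> y - 1) < 1"
    unfolding continuous_at_eps_delta using M.char_zero
    by (auto simp: dist_norm) (metis zero_less_one)
  have near: "char \<mu> y \<noteq> 0" if "\<bar>y\<bar> < d" for y
    using d(2)[OF that] by auto
  obtain k :: nat where k: "\<bar>z\<bar> / d < 2 ^ k" using real_arch_pow[of 2 "\<bar>z\<bar> / d"] by auto
  have "char \<mu> (2 ^ j * (z / 2 ^ k)) \<noteq> 0" for j
  proof (induction j)
    case 0
    show ?case using k d(1) by (intro near) (simp add: field_simps abs_mult)
  next
    case (Suc j)
    then show ?case using double[OF Suc] by (simp add: mult.assoc)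
  qed
  from this[of k] show ?thesis by simp
qed

lemma char_continuous_log:
  assumes "real_distribution M" "\<And>z. char M z \<noteq> 0"
  obtains \<psi> where "continuous_on UNIV \<psi>" "\<psi> 0 = 0" "\<And>z. char M z = exp (\<psi> z)"
proof -
  interpret M: real_distribution M by fact
  have "continuous_on UNIV (char M)"
    by (simp add: continuous_on_eq_continuous_within M.isCont_char)
  then obtain g where g: "continuous_on UNIV g" "\<And>z. char M z = exp (g z)"
    using continuous_logarithm_on_contractible[OF _ contractible_UNIV, of "char M"] assms(2) by auto
  have "exp (g 0) = 1" using g(2)[of 0] by (simp add: M.char_zero)
  then show ?thesis
    using g by (intro that[of "\<lambda>z. g z - g 0"]) (auto intro!: continuous_intros simp: exp_diff)
qed

text \<open>The derivative of \<open>exp (w * h)\<close> at 0 along \<open>h = 1 / (n + 1)\<close>;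
  it gives the limit of the compound Poisson exponents below.\<close>

lemma tendsto_exp_increment:
  fixes w :: complex
  shows "(\<lambda>n. of_nat (Suc n) * (exp (w / of_nat (Suc n)) - 1)) \<longlonglongrightarrow> w"
proof -
  have "((\<lambda>h. exp (w * h)) has_field_derivative w) (at 0)"
    by (auto intro!: derivative_eq_intros)
  then have lim: "((\<lambda>h. (exp (w * h) - 1) / h) \<longlongrightarrow> w) (at 0)"
    by (simp add: DERIV_def)
  have "filterlim (\<lambda>n. inverse (of_nat (Suc n) :: complex)) (at 0) sequentially"
    unfolding filterlim_at using LIMSEQ_inverse_real_of_nat
    by (auto simp: tendsto_of_real_iff[symmetric, where 'a=complex] simp del: of_nat_Suc)
  from filterlim_compose[OF lim this] show ?thesis
    by (simp add: field_simps del: of_nat_Suc)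
qed

text \<open>The root of order \<open>n + 1\<close>, taken as jump law with rate
  \<open>t * (n + 1)\<close>, gives a compound Poisson law whose exponent tends to
  \<open>t * \<psi>\<close>. Levy continuity provides the limit law, also for irrational
  \<open>t\<close>.\<close>

theorem class_ID_conv_rpow:
  assumes "\<mu> \<in> class_ID"
  obtains \<psi> where "continuous_on UNIV \<psi>" "\<psi> 0 = 0" "\<And>z. char \<mu> z = exp (\<psi> z)"
    "\<And>t. t > 0 \<Longrightarrow> real_distribution (conv_rpow \<mu> t)"
    "\<And>t z. t > 0 \<Longrightarrow> char (conv_rpow \<mu> t) z = exp (of_real t * \<psi> z)"
proof -
  have R: "real_distribution \<mu>" using assms by (simp add: class_ID_def)
  obtain \<psi> where \<psi>: "continuous_on UNIV \<psi>" "\<psi> 0 = 0" "\<And>z. char \<mu> z = exp (\<psi> z)"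
    using char_continuous_log[OF R class_ID_char_nonzero[OF assms]] by metis
  have "\<exists>\<rho>. real_distribution \<rho> \<and> (\<forall>z. char \<rho> z = exp (\<psi> z / of_nat (Suc n)))" for n
  proof -
    have "\<exists>\<rho>. real_distribution \<rho> \<and> conv_pow \<rho> (Suc n) = \<mu>"
      using assms[unfolded class_ID_def mem_Collect_eq, THEN conjunct2, rule_format, of "Suc n"] by simp
    then obtain \<rho> where \<rho>: "real_distribution \<rho>" "conv_pow \<rho> (Suc n) = \<mu>" by blast
    have pow: "char \<mu> y = char \<rho> y ^ Suc n" for y
      using char_conv_pow[OF \<rho>(1), of "Suc n" y] \<rho>(2) by simp
    have "char \<rho> z \<noteq> 0" for z using pow[of z] class_ID_char_nonzero[OF assms, of z] by auto
    from char_continuous_log[OF \<rho>(1) this] obtain \<phi> where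
      \<phi>: "continuous_on UNIV \<phi>" "\<phi> 0 = 0" "\<And>z. char \<rho> z = exp (\<phi> z)" by metis
    \<comment> \<open>Uniqueness of the normalised logarithm excludes a wrong branch for the
      root.\<close>
    have "(\<lambda>z. of_nat (Suc n) * \<phi> z) = \<psi>"
    proof (rule continuous_log_unique)
      fix z
      show "exp (of_nat (Suc n) * \<phi> z) = exp (\<psi> z)"
        unfolding \<psi>(3)[symmetric] pow \<phi>(3) by (rule exp_of_nat_mult)
    qed (use \<psi> \<phi> in \<open>auto intro!: continuous_intros\<close>)
    then have "\<phi> z = \<psi> z / of_nat (Suc n)" for z
      by (auto simp: fun_eq_iff field_simps simp del: of_nat_Suc)
    then show ?thesis using \<rho> \<phi> by metis
  qed
  then obtain \<rho> where \<rho>: "\<And>n. real_distribution (\<rho> n)"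
    "\<And>n z. char (\<rho> n) z = exp (\<psi> z / of_nat (Suc n))" by metis
  have main: "real_distribution (conv_rpow \<mu> t) \<and> (\<forall>z. char (conv_rpow \<mu> t) z = exp (of_real t * \<psi> z))"
    if t: "t > 0" for t
  proof -
    have tn: "t * real (Suc n) > 0" for n using t by simp
    have "(\<lambda>n. char (compound_poisson (t * real (Suc n)) (\<rho> n)) z) \<longlonglongrightarrow> exp (of_real t * \<psi> z)" for z
    proof -
      have "char (compound_poisson (t * real (Suc n)) (\<rho> n)) z =
          exp (of_real t * (of_nat (Suc n) * (exp (\<psi> z / of_nat (Suc n)) - 1)))" for n
        unfolding char_compound_poisson[OF tn \<rho>(1)] \<rho>(2)
        by (simp only: of_real_mult of_real_of_nat_eq mult.assoc)
      moreover have "(\<lambda>n. exp (of_real t * (of_nat (Suc n) * (exp (\<psi> z / of_nat (Suc n)) - 1))))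
          \<longlonglongrightarrow> exp (of_real t * \<psi> z)"
        by (rule tendsto_exp[OF tendsto_mult[OF tendsto_const tendsto_exp_increment]])
      ultimately show ?thesis by (simp only:)
    qed
    moreover have "isCont (\<lambda>z. exp (of_real t * \<psi> z)) 0"
      using \<psi>(1) by (intro continuous_intros) (auto simp: continuous_on_eq_continuous_within)
    ultimately obtain N where N: "real_distribution N" "char N = (\<lambda>z. exp (of_real t * \<psi> z))"
      by (rule levy_continuity_existence[OF real_distribution_compound_poisson[OF tn \<rho>(1)]])
    have "conv_rpow \<mu> t = N"
      using N \<psi> by (intro conv_rpow_eqI) auto
    with N show ?thesis by simp
  qed
  show ?thesis
    using main by (intro that[OF \<psi>]) auto
qed

text \<open>\<open>P\<close> abstracts the powers \<open>conv_rpow \<mu>\<close>. Times are strictly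
  positive throughout, so there is no unit \<open>P 0\<close>.\<close>

locale OS_semigroup = OS_distribution +
  fixes P :: "real \<Rightarrow> real measure"
  assumes P_real_distribution: "t > 0 \<Longrightarrow> real_distribution (P t)"
    and P_add: "s > 0 \<Longrightarrow> t > 0 \<Longrightarrow> P (s + t) = (P s \<star> P t)"
    and P_1: "P 1 = \<mu>"
begin

text \<open>\<open>P t\<close> is a factor of \<open>P n\<close> for an integer \<open>n\<close>
  beyond \<open>t\<close>, and \<open>P n\<close> is a power of \<mu>.\<close>

lemma controlled_P:
  assumes "t > 0" shows "controlled (P t)"
proof -
  \<comment> \<open>The successor makes \<open>n - t\<close> strictly positive even when
    \<open>t\<close> is an integer.\<close>
  define n where "n = Suc (nat \<lceil>t\<rceil>)"
  have n: "n \<ge> 1" "real n - t > 0" by (auto simp: n_def; linarith)+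
  have "controlled (P (real n))"
    using n(1)
  proof (induction n rule: dec_induct)
    case base
    show ?case by (simp add: P_1 controlled_self)
  next
    case (step k)
    have "P (real (Suc k)) = (P 1 \<star> P (real k))" using step P_add[of 1 "real k"] by simp
    with step show ?case by (simp only: P_1 controlled_convolution controlled_self)
  qed
  moreover have "P (real n) = (P t \<star> P (real n - t))"
    using P_add[OF assms n(2)] by simp
  ultimately show ?thesis
    using controlled_factor[OF P_real_distribution[OF assms] P_real_distribution[OF n(2)]] by simp
qed

text \<open>From time 1 on, \<mu> is a factor of \<open>P t\<close>. Time 1 itself is separate
  because the complementary time would be 0.\<close>

lemma comparable_P:
  assumes "t \<ge> 1" shows "comparable (P t)"
proof (cases "t = 1")
  case True then show ?thesis by (simp add: P_1 comparable_self)
next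
  case False
  then have "P t = (\<mu> \<star> P (t - 1))" "t - 1 > 0"
    using P_add[of 1 "t - 1"] assms P_1 by auto
  then show ?thesis by (simp add: comparable_convolution comparable_self controlled_P)
qed

end

text \<open>Far enough out, the half-step before a multiple of \<open>a0\<close> is still at least
  1, and its law is a factor of the one at that multiple. It therefore belongs to
  \<open>T0 \<mu>\<close>, although it is no multiple of \<open>a0\<close>.\<close>

theorem class_C0_empty: "class_C0 = {}"
proof (rule ccontr)
  assume "class_C0 \<noteq> {}"
  then obtain \<mu> a0 where \<mu>: "\<mu> \<in> class_OS" "\<mu> \<in> class_ID" and a0: "a0 > 0"
    and T: "T0 \<mu> = {a0 * real n | n. n \<ge> 1}" by (auto simp: class_C0_def)
  interpret OS_distribution \<mu> by unfold_locales (rule \<mu>)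
  obtain \<psi> where \<psi>: "continuous_on UNIV \<psi>" "\<psi> 0 = 0" "\<And>z. char \<mu> z = exp (\<psi> z)"
    and R: "\<And>t. t > 0 \<Longrightarrow> real_distribution (conv_rpow \<mu> t)"
    and char_P: "\<And>t z. t > 0 \<Longrightarrow> char (conv_rpow \<mu> t) z = exp (of_real t * \<psi> z)"
    using class_ID_conv_rpow[OF \<mu>(2)] by metis
  have add: "conv_rpow \<mu> (s + t) = (conv_rpow \<mu> s \<star> conv_rpow \<mu> t)" if "s > 0" "t > 0" for s t
    using that by (intro Levy_uniqueness real_distribution_convolution R)
      (auto simp: fun_eq_iff char_convolution R char_P exp_add[symmetric] algebra_simps)
  have one: "conv_rpow \<mu> 1 = \<mu>"
    using \<psi> by (intro Levy_uniqueness R real_dist) (auto simp: char_P)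
  interpret OS_semigroup \<mu> "conv_rpow \<mu>"
    by (intro OS_semigroup.intro OS_semigroup_axioms.intro OS_distribution_axioms R add one)
  define n where "n = Suc (nat \<lceil>1 / a0\<rceil>)"
  have "1 / a0 \<le> real n - 1" by (simp add: n_def) linarith
  then have n: "1 + a0 \<le> a0 * real n" using a0 by (simp add: field_simps)
  define s where "s = a0 * real n - a0 / 2"
  have s: "s \<ge> 1" using n a0 by (simp add: s_def)
  have "a0 * real n \<in> T0 \<mu>" unfolding T by (rule CollectI, rule exI[of _ n]) (simp add: n_def)
  then have "negligible_mass (conv_rpow \<mu> (a0 * real n))"
    using comparable_L0_iff[OF comparable_P, of "a0 * real n"] n a0 by (auto simp: T0_def)
  moreover have "conv_rpow \<mu> (a0 * real n) = (conv_rpow \<mu> s \<star> conv_rpow \<mu> (a0 / 2))"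
  proof -
    have "s + a0 / 2 = a0 * real n" by (simp add: s_def)
    then show ?thesis using add[of s "a0 / 2"] s a0 by simp
  qed
  ultimately have "negligible_mass (conv_rpow \<mu> s)"
    using negligible_mass_factor[OF R[of s] R[of "a0 / 2"]] s a0 by simp
  then have "s \<in> T0 \<mu>"
    using comparable_L0_iff[OF comparable_P[OF s]] s by (auto simp: T0_def)
  then obtain m :: nat where "s = a0 * real m" by (auto simp: T)
  then have "a0 * (real n - 1 / 2) = a0 * real m" by (simp add: s_def algebra_simps)
  then have "real n - 1 / 2 = real m" using a0 by simp
  then have "real (2 * n) = real (2 * m + 1)" by simp
  then have "2 * n = 2 * m + 1" by (simp only: of_nat_eq_iff)
  then show False by presburger
qed

section \<open>Splitting off the large positive jumps\<close>

lemma real_distribution_uniform_measure: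
  assumes "sets M = sets borel" "A \<in> sets borel" "emeasure M A \<noteq> 0" "emeasure M A \<noteq> \<infinity>"
  shows "real_distribution (uniform_measure M A)"
  using assms by (intro real_distribution_of_prob_space prob_space_uniform_measure) auto

lemma uniform_measure_integral:
  fixes f :: "real \<Rightarrow> 'b :: {banach, second_countable_topology}"
  assumes M: "sets M = sets borel" and A: "A \<in> sets borel" "emeasure M A \<noteq> 0" "emeasure M A \<noteq> \<infinity>"
    and f: "f \<in> borel_measurable borel"
  shows "(\<integral>x. f x \<partial>uniform_measure M A) = (\<integral>x. indicator A x *\<^sub>R f x \<partial>M) /\<^sub>R measure M A"
    and "integrable (uniform_measure M A) f \<longleftrightarrow> integrable M (\<lambda>x. indicator A x *\<^sub>R f x)"
proof -
  note [measurable_cong] = M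
  note [measurable] = A(1) f
  have pos: "measure M A > 0"
    using A by (simp add: measure_def enn2real_positive_iff less_top zero_less_iff_neq_zero)
  have eq: "uniform_measure M A = density M (\<lambda>x. ennreal (indicator A x / measure M A))"
    unfolding uniform_measure_def using A pos
    by (intro density_cong AE_I2)
       (auto simp: emeasure_eq_ennreal_measure divide_ennreal[symmetric] split: split_indicator)
  have *: "(indicat_real A x / measure M A) *\<^sub>R f x = inverse (measure M A) *\<^sub>R (indicator A x *\<^sub>R f x)" for x
    by (simp add: field_simps)
  show "(\<integral>x. f x \<partial>uniform_measure M A) = (\<integral>x. indicator A x *\<^sub>R f x \<partial>M) /\<^sub>R measure M A"
  proof -
    have "(\<integral>x. f x \<partial>density M (\<lambda>x. ennreal (indicator A x / measure M A))) =
        (\<integral>x. (indicat_real A x / measure M A) *\<^sub>R f x \<partial>M)"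
      by (rule integral_density) auto
    also have "\<dots> = (\<integral>x. inverse (measure M A) *\<^sub>R (indicator A x *\<^sub>R f x) \<partial>M)"
      by (simp only: *)
    finally show ?thesis unfolding eq by (simp only: integral_scaleR_right)
  qed
  show "integrable (uniform_measure M A) f \<longleftrightarrow> integrable M (\<lambda>x. indicator A x *\<^sub>R f x)"
  proof -
    have "integrable (density M (\<lambda>x. ennreal (indicator A x / measure M A))) f \<longleftrightarrow>
        integrable M (\<lambda>x. (indicat_real A x / measure M A) *\<^sub>R f x)"
      by (rule integrable_density) auto
    also have "\<dots> \<longleftrightarrow> integrable M (\<lambda>x. inverse (measure M A) *\<^sub>R (indicator A x *\<^sub>R f x))"
      by (simp only: *)
    also have "\<dots> \<longleftrightarrow> integrable M (\<lambda>x. indicator A x *\<^sub>R f x)" (is "?L \<longleftrightarrow> ?R")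
    proof
      assume ?L
      then have "integrable M (\<lambda>x. measure M A *\<^sub>R (inverse (measure M A) *\<^sub>R (indicator A x *\<^sub>R f x)))"
        by (rule integrable_scaleR_right)
      moreover have "measure M A *\<^sub>R (inverse (measure M A) *\<^sub>R y) = y" for y :: 'b
        using pos by simp
      ultimately show ?R by (simp only:)
    next
      assume ?R
      then show ?L by (rule integrable_scaleR_right)
    qed
    finally show ?thesis unfolding eq .
  qed
qed

definition jump_part :: "real measure \<Rightarrow> real set \<Rightarrow> real \<Rightarrow> real measure" where
  "jump_part \<nu> B t = (if measure \<nu> B = 0 then return borel 0
     else compound_poisson (t * measure \<nu> B) (uniform_measure \<nu> B))"

context
  fixes \<nu> :: "real measure" and B :: "real set" and t :: real
  assumes \<nu>: "sets \<nu> = sets borel" and B: "B \<in> sets borel" "emeasure \<nu> B \<noteq> \<infinity>" and t: "t > 0"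
begin

lemma jump_part_aux:
  assumes "measure \<nu> B \<noteq> 0"
  shows "emeasure \<nu> B \<noteq> 0" "real_distribution (uniform_measure \<nu> B)" "t * measure \<nu> B > 0"
proof -
  show 1: "emeasure \<nu> B \<noteq> 0" using assms by (auto simp: measure_def)
  show "real_distribution (uniform_measure \<nu> B)"
    using \<nu> B 1 by (intro real_distribution_uniform_measure)
  show "t * measure \<nu> B > 0"
    using t assms by (simp add: zero_less_measure_iff)
qed

lemma jump_part_null:
  assumes "measure \<nu> B = 0"
  shows "AE x in \<nu>. x \<notin> B"
proof -
  have "emeasure \<nu> B = 0"
    using assms B by (simp add: measure_def enn2real_eq_0_iff)
  then show ?thesis
    using \<nu> B by (intro AE_not_in) (simp add: null_sets_def)
qed

lemma real_distribution_jump_part: "real_distribution (jump_part \<nu> B t)"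
  unfolding jump_part_def using jump_part_aux
  by (auto intro: real_distribution_return real_distribution_compound_poisson)

lemma integrable_indicator_iexp:
  "complex_integrable \<nu> (\<lambda>x. indicator B x *\<^sub>R iexp (z * x))"
  using \<nu> B by (intro integrableI_bounded_set_indicator[where B=1]) (auto simp: less_top cong: measurable_cong_sets)

lemma char_jump_part:
  "char (jump_part \<nu> B t) z = exp (of_real t * (CLINT x|\<nu>. indicator B x *\<^sub>R (iexp (z * x) - 1)))"
proof (cases "measure \<nu> B = 0")
  case True
  have "(CLINT x|\<nu>. indicator B x *\<^sub>R (iexp (z * x) - 1)) = 0"
    using jump_part_null[OF True]
    by (intro integral_eq_zero_AE) (auto simp: indicator_def)
  then show ?thesis using True by (simp add: jump_part_def char_return)
next
  case False
  note * = jump_part_aux[OF False]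
  have int1: "integrable \<nu> (indicat_real B)"
    using \<nu> B by (intro integrable_real_indicator) (auto simp: less_top)
  have int1': "complex_integrable \<nu> (\<lambda>x. of_real (indicat_real B x))"
    using int1 by (simp add: complex_of_real_integrable_eq)
  have "(CLINT x|\<nu>. indicator B x *\<^sub>R (iexp (z * x) - 1)) =
      (CLINT x|\<nu>. indicator B x *\<^sub>R iexp (z * x)) - (CLINT x|\<nu>. of_real (indicat_real B x))"
    using integrable_indicator_iexp int1'
    by (subst Bochner_Integration.integral_diff[symmetric])
       (simp_all only: scaleR_diff_right, simp add: scaleR_conv_of_real)
  also have "(CLINT x|\<nu>. of_real (indicat_real B x)) = complex_of_real (measure \<nu> B)"
    using \<nu> B by (simp add: sets_eq_imp_space_eq[OF \<nu>])
  finally have eq: "(CLINT x|\<nu>. indicator B x *\<^sub>R (iexp (z * x) - 1)) =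
      (CLINT x|\<nu>. indicator B x *\<^sub>R iexp (z * x)) - of_real (measure \<nu> B)" .
  have "char (uniform_measure \<nu> B) z = (CLINT x|\<nu>. indicator B x *\<^sub>R iexp (z * x)) /\<^sub>R measure \<nu> B"
    unfolding char_def using \<nu> B * by (intro uniform_measure_integral) auto
  then have "of_real (t * measure \<nu> B) * (char (uniform_measure \<nu> B) z - 1) =
      of_real t * (CLINT x|\<nu>. indicator B x *\<^sub>R (iexp (z * x) - 1))"
    unfolding eq using False by (simp add: scaleR_conv_of_real field_simps)
  moreover have "char (jump_part \<nu> B t) z =
      exp (of_real (t * measure \<nu> B) * (char (uniform_measure \<nu> B) z - 1))"
    unfolding jump_part_def using False by (simp only: if_False char_compound_poisson[OF *(3,2)])
  ultimately show ?thesis by (simp only:)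
qed

lemma nn_integral_exp_jump_part:
  assumes int: "integrable \<nu> (\<lambda>x. indicator B x * exp (\<theta> * x))"
  shows "(\<integral>\<^sup>+x. exp (\<theta> * x) \<partial>jump_part \<nu> B t) =
    ennreal (exp (t * (\<integral>x. indicator B x * (exp (\<theta> * x) - 1) \<partial>\<nu>)))"
proof (cases "measure \<nu> B = 0")
  case True
  have "(\<integral>x. indicator B x * (exp (\<theta> * x) - 1) \<partial>\<nu>) = 0"
    using jump_part_null[OF True]
    by (intro integral_eq_zero_AE) (auto simp: indicator_def)
  then show ?thesis using True by (simp add: jump_part_def nn_integral_return)
next
  case False
  note * = jump_part_aux[OF False]
  have int1: "integrable \<nu> (indicat_real B)"
    using \<nu> B by (intro integrable_real_indicator) (auto simp: less_top)
  have eq: "(\<integral>x. indicator B x * (exp (\<theta> * x) - 1) \<partial>\<nu>) =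
      (\<integral>x. indicator B x * exp (\<theta> * x) \<partial>\<nu>) - measure \<nu> B"
    using int int1 \<nu> B
    by (simp add: right_diff_distrib sets_eq_imp_space_eq[OF \<nu>])
  have I: "integrable (uniform_measure \<nu> B) (\<lambda>x. exp (\<theta> * x))"
    using \<nu> B * int by (subst uniform_measure_integral) auto
  have "(\<integral>x. exp (\<theta> * x) \<partial>uniform_measure \<nu> B) = (\<integral>x. indicator B x *\<^sub>R exp (\<theta> * x) \<partial>\<nu>) /\<^sub>R measure \<nu> B"
    using \<nu> B * by (intro uniform_measure_integral) auto
  then have "(t * measure \<nu> B) * ((\<integral>x. exp (\<theta> * x) \<partial>uniform_measure \<nu> B) - 1) =
      t * (\<integral>x. indicator B x * (exp (\<theta> * x) - 1) \<partial>\<nu>)"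
    unfolding eq using False by (simp add: field_simps)
  then show ?thesis
    using False * nn_integral_exp_compound_poisson[OF *(3,2) I] by (simp add: jump_part_def)
qed

end

lemma nn_integral_exp_convolution:
  assumes "real_distribution M" "real_distribution N"
  shows "(\<integral>\<^sup>+x. exp (\<theta> * x) \<partial>(M \<star> N)) = (\<integral>\<^sup>+x. exp (\<theta> * x) \<partial>M) * (\<integral>\<^sup>+x. exp (\<theta> * x) \<partial>N)"
proof -
  interpret M: real_distribution M by fact
  interpret N: real_distribution N by fact
  have "(\<integral>\<^sup>+x. exp (\<theta> * x) \<partial>(M \<star> N)) =
      (\<integral>\<^sup>+x. \<integral>\<^sup>+y. ennreal (exp (\<theta> * x)) * ennreal (exp (\<theta> * y)) \<partial>N \<partial>M)"
    by (simp add: nn_integral_convolution M.finite_measure_axioms N.finite_measure_axioms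
        ring_distribs exp_add ennreal_mult)
  then show ?thesis
    by (simp add: nn_integral_cmult nn_integral_multc)
qed

lemma light_tailed_iff_nn_integral:
  assumes "real_distribution M"
  shows "light_tailed M \<longleftrightarrow> (\<forall>\<theta>>0. (\<integral>\<^sup>+x. exp (\<theta> * x) \<partial>M) < \<infinity>)"
proof -
  interpret M: real_distribution M by fact
  have "integrable M (\<lambda>x. exp (\<theta> * x)) \<longleftrightarrow> (\<integral>\<^sup>+x. exp (\<theta> * x) \<partial>M) < \<infinity>" for \<theta>
    by (simp add: integrable_iff_bounded)
  then show ?thesis by (simp add: light_tailed_def)
qed

lemma light_tailed_convolution:
  assumes "real_distribution M" "real_distribution N" "light_tailed M" "light_tailed N"
  shows "light_tailed (M \<star> N)"
  using assms
  by (simp add: light_tailed_iff_nn_integral real_distribution_convolution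
      nn_integral_exp_convolution ennreal_mult_less_top)

lemma nn_integral_exp_std_normal:
  "(\<integral>\<^sup>+x. exp (\<theta> * x) \<partial>std_normal_distribution) = ennreal (exp (\<theta>\<^sup>2 / 2))"
proof -
  have eq: "std_normal_density x * exp (\<theta> * x) = exp (\<theta>\<^sup>2 / 2) * normal_density \<theta> 1 x" for x
  proof -
    have "- x\<^sup>2 / 2 + \<theta> * x = \<theta>\<^sup>2 / 2 + - (x - \<theta>)\<^sup>2 / 2"
      by (simp add: power2_eq_square field_simps)
    then have "exp (- x\<^sup>2 / 2) * exp (\<theta> * x) = exp (\<theta>\<^sup>2 / 2) * exp (- (x - \<theta>)\<^sup>2 / 2)"
      by (simp only: exp_add[symmetric])
    then show ?thesis by (simp add: normal_density_def)
  qed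
  have "(\<integral>\<^sup>+x. exp (\<theta> * x) \<partial>std_normal_distribution) =
      (\<integral>\<^sup>+x. ennreal (std_normal_density x * exp (\<theta> * x)) \<partial>lborel)"
    by (subst nn_integral_density) (auto simp: ennreal_mult)
  also have "\<dots> = (\<integral>\<^sup>+x. ennreal (exp (\<theta>\<^sup>2 / 2)) * ennreal (normal_density \<theta> 1 x) \<partial>lborel)"
    by (simp only: eq) (simp add: ennreal_mult)
  also have "\<dots> = ennreal (exp (\<theta>\<^sup>2 / 2)) * (\<integral>\<^sup>+x. ennreal (normal_density \<theta> 1 x) \<partial>lborel)"
    by (rule nn_integral_cmult) simp
  also have "(\<integral>\<^sup>+x. ennreal (normal_density \<theta> 1 x) \<partial>lborel) = 1"
    by (subst nn_integral_eq_integral) (auto simp: integral_normal_density)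
  finally show ?thesis by simp
qed

text \<open>Variance \<open>v\<close> and mean \<open>d\<close>. As an image measure it also covers
  \<open>v = 0\<close>, the point mass at \<open>d\<close>, since the Gaussian part of \<mu> may be
  absent.\<close>

definition gauss :: "real \<Rightarrow> real \<Rightarrow> real measure" where
  "gauss v d = distr std_normal_distribution borel (\<lambda>x. sqrt v * x + d)"

lemma real_distribution_gauss: "real_distribution (gauss v d)"
proof -
  interpret G: real_distribution std_normal_distribution by (rule real_dist_normal_dist)
  show ?thesis unfolding gauss_def by (intro real_distribution_of_prob_space G.prob_space_distr) auto
qed

lemma char_gauss:
  assumes "v \<ge> 0" shows "char (gauss v d) z = exp (\<i> * of_real (d * z) - of_real (v * z\<^sup>2 / 2))"
proof -
  interpret G: real_distribution std_normal_distribution by (rule real_dist_normal_dist)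
  have "char (gauss v d) z = (CLINT x|std_normal_distribution. iexp (z * (sqrt v * x + d)))"
    unfolding char_def gauss_def by (subst integral_distr) auto
  also have "\<dots> = (CLINT x|std_normal_distribution. iexp (z * d) * iexp (z * sqrt v * x))"
    by (simp add: exp_add[symmetric] algebra_simps)
  also have "\<dots> = iexp (z * d) * char std_normal_distribution (z * sqrt v)"
    unfolding char_def by (rule integral_mult_right_zero)
  also have "\<dots> = iexp (z * d) * exp (of_real (- (v * z\<^sup>2) / 2))"
  proof -
    have "(z * sqrt v)\<^sup>2 = v * z\<^sup>2" using assms by (simp add: power_mult_distrib)
    then show ?thesis by (simp only: char_std_normal_distribution exp_of_real)
  qed
  also have "\<dots> = exp (\<i> * of_real (d * z) - of_real (v * z\<^sup>2 / 2))"
    by (simp add: exp_add[symmetric] algebra_simps)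
  finally show ?thesis .
qed

lemma nn_integral_exp_gauss:
  assumes "v \<ge> 0" shows "(\<integral>\<^sup>+x. exp (\<theta> * x) \<partial>gauss v d) = ennreal (exp (\<theta> * d + v * \<theta>\<^sup>2 / 2))"
proof -
  have "(\<integral>\<^sup>+x. exp (\<theta> * x) \<partial>gauss v d) = (\<integral>\<^sup>+x. ennreal (exp (\<theta> * (sqrt v * x + d))) \<partial>std_normal_distribution)"
    unfolding gauss_def by (subst nn_integral_distr) auto
  also have "\<dots> = (\<integral>\<^sup>+x. ennreal (exp (\<theta> * d)) * ennreal (exp ((\<theta> * sqrt v) * x)) \<partial>std_normal_distribution)"
    by (simp add: ennreal_mult[symmetric] exp_add[symmetric] algebra_simps)
  also have "\<dots> = ennreal (exp (\<theta> * d)) * ennreal (exp ((\<theta> * sqrt v)\<^sup>2 / 2))"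
    by (simp add: nn_integral_cmult nn_integral_exp_std_normal)
  also have "\<dots> = ennreal (exp (\<theta> * d + v * \<theta>\<^sup>2 / 2))"
    using assms by (simp add: ennreal_mult[symmetric] exp_add power_mult_distrib mult.commute)
  finally show ?thesis .
qed

text \<open>A Fatou argument: the exponential cut off at \<open>R\<close> is bounded and continuous,
  so weak convergence applies to it, and monotone convergence removes the cut.\<close>

lemma weak_conv_nn_integral_exp_le:
  assumes M: "\<And>n. real_distribution (M n)" and N: "real_distribution N" "weak_conv_m M N"
    and le: "\<And>n. (\<integral>\<^sup>+x. exp (\<theta> * x) \<partial>M n) \<le> ennreal Q" and Q: "Q \<ge> 0"
  shows "(\<integral>\<^sup>+x. exp (\<theta> * x) \<partial>N) \<le> ennreal Q"
proof -
  interpret M: real_distribution "M n" for n by (rule M)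
  interpret N: real_distribution N by (rule N)
  define g where "g R x = min (exp (\<theta> * x)) (real R)" for R :: nat and x :: real
  have [measurable]: "g R \<in> borel_measurable borel" for R unfolding g_def by measurable
  have bd: "norm (g R x) \<le> real R" "g R x \<ge> 0" for R x by (auto simp: g_def)
  have R: "(\<integral>\<^sup>+x. g R x \<partial>N) \<le> ennreal Q" for R
  proof -
    have "(\<integral>x. g R x \<partial>M n) \<le> Q" for n
    proof -
      have "ennreal (\<integral>x. g R x \<partial>M n) = (\<integral>\<^sup>+x. g R x \<partial>M n)"
        by (intro nn_integral_eq_integral[symmetric] M.integrable_const_bound[where B="real R"])
           (use bd in auto)
      also have "\<dots> \<le> (\<integral>\<^sup>+x. exp (\<theta> * x) \<partial>M n)"
        by (intro nn_integral_mono) (auto simp: g_def)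
      also note le[of n]
      finally show ?thesis using Q by simp
    qed
    moreover have "(\<lambda>n. \<integral>x. g R x \<partial>M n) \<longlonglongrightarrow> (\<integral>x. g R x \<partial>N)"
      by (rule weak_conv_imp_integral_bdd_continuous_conv[OF M N _ bd(1)])
         (auto simp: g_def[abs_def] intro!: continuous_intros)
    ultimately have "(\<integral>x. g R x \<partial>N) \<le> Q"
      by (intro LIMSEQ_le_const2) auto
    moreover have "(\<integral>\<^sup>+x. g R x \<partial>N) = ennreal (\<integral>x. g R x \<partial>N)"
      by (intro nn_integral_eq_integral N.integrable_const_bound[where B="real R"])
         (use bd in auto)
    ultimately show ?thesis by (simp add: ennreal_leI)
  qed
  have "(SUP R. ennreal (g R x)) = ennreal (exp (\<theta> * x))" for x
  proof (rule antisym)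
    show "(SUP R. ennreal (g R x)) \<le> ennreal (exp (\<theta> * x))"
      by (intro SUP_least ennreal_leI) (simp add: g_def)
    obtain R where "exp (\<theta> * x) \<le> real R" using real_arch_simple by blast
    then have "ennreal (exp (\<theta> * x)) = ennreal (g R x)" by (simp add: g_def)
    also have "\<dots> \<le> (SUP R. ennreal (g R x))" by (intro SUP_upper) simp
    finally show "ennreal (exp (\<theta> * x)) \<le> (SUP R. ennreal (g R x))" .
  qed
  then have "(\<integral>\<^sup>+x. exp (\<theta> * x) \<partial>N) = (\<integral>\<^sup>+x. (SUP R. ennreal (g R x)) \<partial>N)" by simp
  also have "\<dots> = (SUP R. \<integral>\<^sup>+x. ennreal (g R x) \<partial>N)"
    by (intro nn_integral_monotone_convergence_SUP)
       (auto simp: incseq_def le_fun_def g_def intro!: ennreal_leI)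
  also have "\<dots> \<le> ennreal Q" by (intro SUP_least R)
  finally show ?thesis .
qed

text \<open>Second-order Taylor expansion, with \<open>exp \<theta>\<close> bounding the exponential
  in the remainder. It makes compensated small jumps integrable against the Levy measure.\<close>

lemma exp_quadratic_bound:
  fixes x :: real assumes "\<bar>x\<bar> \<le> 1" "\<theta> > 0"
  shows "exp (\<theta> * x) - 1 - \<theta> * x \<le> (\<theta>\<^sup>2 * exp \<theta>) * x\<^sup>2"
proof -
  obtain s where s: "\<bar>s\<bar> \<le> \<bar>\<theta> * x\<bar>" "exp (\<theta> * x) = (\<Sum>m<2. ((\<theta> * x) ^ m) / fact m) + (exp s / fact 2) * (\<theta> * x)\<^sup>2"
    using Maclaurin_exp_le[of "\<theta> * x" 2] by blast
  have "\<bar>\<theta> * x\<bar> \<le> \<theta> * 1" unfolding abs_mult using assms by (intro mult_mono) auto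
  then have "exp s \<le> exp \<theta>" using s(1) by simp
  have "exp s / 2 * (\<theta> * x)\<^sup>2 \<le> exp \<theta> * (\<theta> * x)\<^sup>2"
  proof (rule mult_right_mono)
    show "exp s / 2 \<le> exp \<theta>" using \<open>exp s \<le> exp \<theta>\<close> exp_ge_zero[of s] by linarith
  qed simp
  then show ?thesis
    using s(2) by (simp add: numeral_2_eq_2 power_mult_distrib ac_simps)
qed

text \<open>Taylor expansion handles the compensated range and the trivial bound 2 the rest. One
  integrable majorant then serves all \<open>z\<close> in a bounded set.\<close>

lemma levy_integrand_bound:
  "cmod (iexp (z * x) - 1 - \<i> * of_real (z * x * indicator {-1..1} x)) \<le> (2 + z\<^sup>2) * min 1 (x\<^sup>2)"
proof (cases "\<bar>x\<bar> \<le> 1")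
  case True
  have "cmod (iexp (z * x) - 1 - \<i> * of_real (z * x)) \<le> \<bar>z * x\<bar>\<^sup>2 / 2"
    using iexp_approx1[of "z * x" 1] by (simp add: numeral_2_eq_2 algebra_simps)
  also have "\<dots> \<le> (2 + z\<^sup>2) * x\<^sup>2"
    by (simp add: power_mult_distrib algebra_simps)
  also have "x\<^sup>2 = min 1 (x\<^sup>2)" using True by (simp add: abs_square_le_1 min_absorb2)
  finally show ?thesis using True by (simp add: indicator_def abs_le_iff)
next
  case False
  then have "1 \<le> x\<^sup>2" using abs_square_le_1[of x] by linarith
  moreover have "cmod (iexp (z * x) - 1) \<le> 1 + 1"
    using norm_triangle_ineq4[of "iexp (z * x)" 1] by simp
  moreover have "(2 + z\<^sup>2) * 1 \<ge> 2" by simp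
  moreover have "indicat_real {-1..1} x = 0" using False by (auto simp: indicator_def)
  ultimately show ?thesis by (simp only: mult_zero_right of_real_0 diff_zero min_absorb1)
qed

text \<open>\<open>\<zeta> t\<close> collects the Gaussian part, the drift and all jumps up to 1. It
  is a weak limit of Gaussian laws convolved with compound Poisson laws that omit ever smaller
  jumps; a bound on the exponential moments uniform in the cut-off makes the limit
  light-tailed.\<close>

theorem levy_decomposition:
  assumes "is_levy_measure \<mu> \<nu>"
  obtains \<Psi> \<zeta> where "continuous_on UNIV \<Psi>" "\<Psi> 0 = 0" "\<And>z. char \<mu> z = exp (\<Psi> z)"
    "\<And>t. t > 0 \<Longrightarrow> real_distribution (\<zeta> t)" "\<And>t. t > 0 \<Longrightarrow> light_tailed (\<zeta> t)"
    "\<And>t z. t > 0 \<Longrightarrow> exp (of_real t * \<Psi> z) = char (jump_part \<nu> {1<..} t) z * char (\<zeta> t) z"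
    "emeasure \<nu> {1<..} \<noteq> \<infinity>"
proof -
  have \<nu>: "sets \<nu> = sets borel" and fin: "(\<integral>\<^sup>+ x. ennreal (min 1 (x\<^sup>2)) \<partial>\<nu>) < \<infinity>"
    using assms by (auto simp: is_levy_measure_def)
  note [measurable_cong] = \<nu>
  define h where "h z x = iexp (z * x) - 1 - \<i> * of_real (z * x * indicator {-1..1} x)" for z x :: real
  obtain A b :: real where A: "A \<ge> 0" and char\<mu>: "\<And>z. char \<mu> z =
      exp (- of_real (A * z\<^sup>2 / 2) + \<i> * of_real (b * z) + (CLINT x|\<nu>. h z x))"
    using assms unfolding is_levy_measure_def h_def by blast
  have I0: "integrable \<nu> (\<lambda>x. min 1 (x\<^sup>2))"
    using fin by (simp add: integrable_iff_bounded)
  have [measurable]: "h z \<in> borel_measurable borel" for z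
    unfolding h_def by measurable
  have hb: "cmod (h z x) \<le> (2 + z\<^sup>2) * min 1 (x\<^sup>2)" for z x
    unfolding h_def by (rule levy_integrand_bound)
  have hbC: "cmod (indicat_real C x *\<^sub>R h z x) \<le> (2 + z\<^sup>2) * min 1 (x\<^sup>2)" for z x C
    using hb[of z x] by (auto simp: indicator_def)
  have Ih: "complex_integrable \<nu> (\<lambda>x. indicat_real C x *\<^sub>R h z x)" if "C \<in> sets borel" for z C
  proof (rule Bochner_Integration.integrable_bound[OF integrable_mult_right[OF I0, of "2 + z\<^sup>2"]])
    show "(\<lambda>x. indicat_real C x *\<^sub>R h z x) \<in> borel_measurable \<nu>" using that by measurable
    show "AE x in \<nu>. cmod (indicat_real C x *\<^sub>R h z x) \<le> norm ((2 + z\<^sup>2) * min 1 (x\<^sup>2))"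
      using hbC by (auto intro!: AE_I2 intro: order_trans[OF _ abs_ge_self])
  qed
  define J where "J C z = (CLINT x|\<nu>. indicat_real C x *\<^sub>R h z x)" for C z
  have J_cont: "isCont (J C) z" if C: "C \<in> sets borel" for C z
    unfolding continuous_at_sequentially
  proof (intro allI impI)
    fix X :: "nat \<Rightarrow> real" assume X: "X \<longlonglongrightarrow> z"
    then obtain K where K: "\<And>n. \<bar>X n\<bar> \<le> K"
      using convergent_imp_Bseq[of X] by (auto simp: Bseq_def convergent_def)
    show "(J C \<circ> X) \<longlonglongrightarrow> J C z"
      unfolding J_def o_def
    proof (rule integral_dominated_convergence[where w="\<lambda>x. (2 + K\<^sup>2) * min 1 (x\<^sup>2)"])
      show "AE x in \<nu>. (\<lambda>n. indicat_real C x *\<^sub>R h (X n) x) \<longlonglongrightarrow> indicat_real C x *\<^sub>R h z x"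
        unfolding h_def by (intro AE_I2 tendsto_intros X)
      fix n
      show "AE x in \<nu>. cmod (indicat_real C x *\<^sub>R h (X n) x) \<le> (2 + K\<^sup>2) * min 1 (x\<^sup>2)"
      proof (rule AE_I2)
        fix x
        have "(X n)\<^sup>2 \<le> K\<^sup>2" using power_mono[OF K[of n], of 2] by simp
        then have "(2 + (X n)\<^sup>2) * min 1 (x\<^sup>2) \<le> (2 + K\<^sup>2) * min 1 (x\<^sup>2)"
          by (intro mult_right_mono) auto
        then show "cmod (indicat_real C x *\<^sub>R h (X n) x) \<le> (2 + K\<^sup>2) * min 1 (x\<^sup>2)"
          using hbC[of C x "X n"] by linarith
      qed
    qed (use C I0 in auto)
  qed
  have J_0: "J C 0 = 0" for C by (simp add: J_def h_def)
  \<comment> \<open>Markov's inequality for \<open>min 1 (x\<^sup>2)\<close>, which is at least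
    \<open>\<delta>\<^sup>2\<close> on \<open>B\<close>.\<close>
  have fin_away: "emeasure \<nu> B \<noteq> \<infinity>" if B: "B \<in> sets borel" "\<And>x. x \<in> B \<Longrightarrow> \<delta> \<le> \<bar>x\<bar>" and \<delta>: "0 < \<delta>" "\<delta> \<le> 1" for B \<delta>
  proof -
    have "emeasure \<nu> B = (\<integral>\<^sup>+x. indicator B x \<partial>\<nu>)" using B \<nu> by simp
    also have "\<dots> \<le> (\<integral>\<^sup>+x. ennreal (1 / \<delta>\<^sup>2) * ennreal (min 1 (x\<^sup>2)) \<partial>\<nu>)"
    proof (rule nn_integral_mono)
      fix x
      show "indicator B x \<le> ennreal (1 / \<delta>\<^sup>2) * ennreal (min 1 (x\<^sup>2))"
      proof (cases "x \<in> B")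
        case True
        have "\<delta>\<^sup>2 \<le> \<bar>x\<bar>\<^sup>2" using B(2)[OF True] \<delta> by (intro power_mono) auto
        moreover have "\<delta>\<^sup>2 \<le> 1" using \<delta> by (simp add: power_le_one)
        ultimately have "1 \<le> 1 / \<delta>\<^sup>2 * min 1 (x\<^sup>2)"
          using \<delta> by (simp add: field_simps min_def)
        then have "ennreal 1 \<le> ennreal (1 / \<delta>\<^sup>2 * min 1 (x\<^sup>2))" by (rule ennreal_leI)
        also have "\<dots> = ennreal (1 / \<delta>\<^sup>2) * ennreal (min 1 (x\<^sup>2))"
          by (rule ennreal_mult) auto
        finally show ?thesis using True by simp
      qed simp
    qed
    also have "\<dots> = ennreal (1 / \<delta>\<^sup>2) * (\<integral>\<^sup>+ x. ennreal (min 1 (x\<^sup>2)) \<partial>\<nu>)"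
      by (rule nn_integral_cmult) measurable
    also have "\<dots> < \<infinity>" using fin by (simp add: ennreal_mult_less_top)
    finally show ?thesis by simp
  qed
  have fin1: "emeasure \<nu> {1<..} \<noteq> \<infinity>" by (rule fin_away[of _ 1]) auto
  define \<Psi> where "\<Psi> z = - of_real (A * z\<^sup>2 / 2) + \<i> * of_real (b * z) + J UNIV z" for z
  \<comment> \<open>The exponent without the jumps above 1. Those lie outside the truncation
    interval, so they split off as an uncompensated compound Poisson exponent.\<close>
  define \<Phi> where "\<Phi> z = - of_real (A * z\<^sup>2 / 2) + \<i> * of_real (b * z) + J {..1} z" for z
  have \<Psi>_cont: "continuous_on UNIV \<Psi>"
    unfolding \<Psi>_def[abs_def] using J_cont[of UNIV]
    by (intro continuous_intros) (auto simp: continuous_on_eq_continuous_within)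
  have \<Psi>\<Phi>: "\<Psi> z = \<Phi> z + (CLINT x|\<nu>. indicator {1<..} x *\<^sub>R (iexp (z * x) - 1))" for z
  proof -
    have "J UNIV z = (CLINT x|\<nu>. indicat_real {..1} x *\<^sub>R h z x + indicat_real {1<..} x *\<^sub>R h z x)"
      unfolding J_def by (rule Bochner_Integration.integral_cong) (auto simp: indicator_def)
    also have "\<dots> = J {..1} z + (CLINT x|\<nu>. indicat_real {1<..} x *\<^sub>R h z x)"
      unfolding J_def by (intro Bochner_Integration.integral_add Ih) auto
    also have "(CLINT x|\<nu>. indicat_real {1<..} x *\<^sub>R h z x) =
        (CLINT x|\<nu>. indicator {1<..} x *\<^sub>R (iexp (z * x) - 1))"
      by (rule Bochner_Integration.integral_cong) (auto simp: indicator_def h_def)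
    finally show ?thesis by (simp add: \<Psi>_def \<Phi>_def)
  qed
  \<comment> \<open>Removing a neighbourhood of 0 makes the measure finite; large negative jumps
    stay in. The point 0 is never reached, but the integrand vanishes there.\<close>
  define B where "B m = {x::real. x \<le> 1 \<and> 1 / real (Suc m) < \<bar>x\<bar>}" for m
  have B[measurable]: "B m \<in> sets borel" for m unfolding B_def by measurable
  have finB: "emeasure \<nu> (B m) \<noteq> \<infinity>" for m
    by (rule fin_away[of _ "1 / real (Suc m)"]) (auto simp: B_def B[unfolded B_def])
  have main: "\<exists>N. real_distribution N \<and> light_tailed N \<and> (\<forall>z. char N z = exp (of_real t * \<Phi> z))"
    if t: "t > 0" for t
  proof -
    \<comment> \<open>The compensator of the jumps in \<open>B m\<close>; subtracting it from the
      drift turns the plain jump law into the compensated one.\<close>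
    define c where "c m = (\<integral>x. indicator (B m) x * (x * indicator {-1..1} x) \<partial>\<nu>)" for m
    have Ic: "integrable \<nu> (\<lambda>x. indicator (B m) x * (x * indicat_real {-1..1} x))" for m
    proof -
      have "integrable \<nu> (\<lambda>x. indicator (B m) x *\<^sub>R (x * indicat_real {-1..1} x))"
        using \<nu> finB[of m]
        by (intro integrableI_bounded_set_indicator[where B=1]) (auto simp: less_top indicator_def)
      then show ?thesis by simp
    qed
    define M where "M m = (gauss (t * A) (t * (b - c m)) \<star> jump_part \<nu> (B m) t)" for m
    have RM: "real_distribution (M m)" for m
      unfolding M_def
      by (intro real_distribution_convolution real_distribution_gauss real_distribution_jump_part \<nu> B finB t)
    have JB: "J (B m) z = (CLINT x|\<nu>. indicat_real (B m) x *\<^sub>R (iexp (z * x) - 1)) - \<i> * of_real (z * c m)" for m z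
    proof -
      have "(CLINT x|\<nu>. \<i> * of_real z * complex_of_real (indicator (B m) x * (x * indicator {-1..1} x))) =
          \<i> * of_real z * (CLINT x|\<nu>. complex_of_real (indicator (B m) x * (x * indicator {-1..1} x)))"
        by (rule integral_mult_right_zero)
      also have "(CLINT x|\<nu>. complex_of_real (indicator (B m) x * (x * indicator {-1..1} x))) = of_real (c m)"
        unfolding c_def by (rule integral_complex_of_real)
      finally have 1: "(CLINT x|\<nu>. \<i> * of_real z * complex_of_real (indicator (B m) x * (x * indicator {-1..1} x))) = \<i> * of_real (z * c m)"
        by simp
      have 2: "complex_integrable \<nu> (\<lambda>x. \<i> * of_real z * complex_of_real (indicator (B m) x * (x * indicator {-1..1} x)))"
        using Ic[of m] by (intro integrable_mult_right) (simp only: complex_of_real_integrable_eq)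
      have 3: "complex_integrable \<nu> (\<lambda>x. indicat_real (B m) x *\<^sub>R (iexp (z * x) - 1))"
        using \<nu> finB[of m]
        by (intro integrableI_bounded_set_indicator[where B=2])
           (auto simp: less_top intro!: AE_I2 order_trans[OF norm_triangle_ineq4])
      have "J (B m) z = (CLINT x|\<nu>. indicat_real (B m) x *\<^sub>R (iexp (z * x) - 1) -
          \<i> * of_real z * complex_of_real (indicator (B m) x * (x * indicator {-1..1} x)))"
        unfolding J_def by (rule Bochner_Integration.integral_cong) (auto simp: indicator_def h_def)
      also have "\<dots> = (CLINT x|\<nu>. indicat_real (B m) x *\<^sub>R (iexp (z * x) - 1)) - \<i> * of_real (z * c m)"
        unfolding 1[symmetric] by (rule Bochner_Integration.integral_diff[OF 3 2])
      finally show ?thesis .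
    qed
    have char_M: "char (M m) z = exp (of_real t * (- of_real (A * z\<^sup>2 / 2) + \<i> * of_real (b * z) + J (B m) z))" for m z
    proof -
      have "char (M m) z = exp (\<i> * of_real (t * (b - c m) * z) - of_real (t * A * z\<^sup>2 / 2)) *
          exp (of_real t * (CLINT x|\<nu>. indicat_real (B m) x *\<^sub>R (iexp (z * x) - 1)))"
        unfolding M_def
        using A t by (subst char_convolution)
          (simp_all only: real_distribution_gauss real_distribution_jump_part \<nu> B finB t
             char_jump_part char_gauss mult_nonneg_nonneg less_imp_le not_False_eq_True simp_thms)
      also have "\<dots> = exp (of_real t * (- of_real (A * z\<^sup>2 / 2) + \<i> * of_real (b * z) + J (B m) z))"
        unfolding exp_add[symmetric] JB by (rule arg_cong[where f=exp]) (simp add: algebra_simps)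
      finally show ?thesis .
    qed
    have lim: "(\<lambda>m. J (B m) z) \<longlonglongrightarrow> J {..1} z" for z
      unfolding J_def
    proof (rule integral_dominated_convergence[where w="\<lambda>x. (2 + z\<^sup>2) * min 1 (x\<^sup>2)"])
      show "AE x in \<nu>. (\<lambda>m. indicat_real (B m) x *\<^sub>R h z x) \<longlonglongrightarrow> indicat_real {..1} x *\<^sub>R h z x"
      proof (rule AE_I2)
        fix x :: real
        show "(\<lambda>m. indicat_real (B m) x *\<^sub>R h z x) \<longlonglongrightarrow> indicat_real {..1} x *\<^sub>R h z x"
        proof (cases "x = 0")
          case True
          then show ?thesis by (simp add: h_def)
        next
          case False
          then have "\<forall>\<^sub>F m in sequentially. inverse (real (Suc m)) < \<bar>x\<bar>"
            by (intro order_tendstoD(2)[OF LIMSEQ_inverse_real_of_nat]) simp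
          then have "\<forall>\<^sub>F m in sequentially. indicat_real (B m) x *\<^sub>R h z x = indicat_real {..1} x *\<^sub>R h z x"
            by eventually_elim (auto simp: B_def indicator_def inverse_eq_divide)
          then show ?thesis by (rule tendsto_eventually)
        qed
      qed
      show "AE x in \<nu>. cmod (indicat_real (B m) x *\<^sub>R h z x) \<le> (2 + z\<^sup>2) * min 1 (x\<^sup>2)" for m
        by (rule AE_I2) (rule hbC)
    qed (use I0 in auto)
    have conv: "(\<lambda>m. char (M m) z) \<longlonglongrightarrow> exp (of_real t * \<Phi> z)" for z
      unfolding char_M \<Phi>_def by (intro tendsto_intros lim)
    have cont: "isCont (\<lambda>z. exp (of_real t * \<Phi> z)) 0"
      unfolding \<Phi>_def using J_cont[of "{..1}"] by (intro continuous_intros) auto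
    obtain N where N: "real_distribution N" "char N = (\<lambda>z. exp (of_real t * \<Phi> z))" "weak_conv_m M N"
      by (rule levy_continuity_existence[OF RM conv cont])
    have "light_tailed N"
      unfolding light_tailed_iff_nn_integral[OF N(1)]
    proof (intro allI impI)
      fix \<theta> :: real assume \<theta>: "\<theta> > 0"
      \<comment> \<open>Independent of \<open>m\<close>, as the weak limit requires: the possibly
        diverging \<open>c m\<close> cancels against the linear part of the jump exponent.\<close>
      define Q where "Q = t * (\<theta> * b + A * \<theta>\<^sup>2 / 2 + (\<theta>\<^sup>2 * exp \<theta>) * (\<integral>x. min 1 (x\<^sup>2) \<partial>\<nu>))"
      have "(\<integral>\<^sup>+x. exp (\<theta> * x) \<partial>M m) \<le> ennreal (exp Q)" for m
      proof -
        have ind: "indicat_real (B m) x * y = indicator (B m) x *\<^sub>R y" for x y by simp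
        have i1: "integrable \<nu> (\<lambda>x. indicator (B m) x * exp (\<theta> * x))"
          unfolding ind using \<nu> finB[of m] \<theta>
          by (intro integrableI_bounded_set_indicator[where B="exp \<theta>"]) (auto simp: less_top B_def)
        have i2: "integrable \<nu> (\<lambda>x. indicator (B m) x * (exp (\<theta> * x) - 1))"
          unfolding ind using \<nu> finB[of m] \<theta>
          by (intro integrableI_bounded_set_indicator[where B="exp \<theta> + 1"])
             (auto simp: less_top B_def intro!: AE_I2 order_trans[OF abs_triangle_ineq4])
        have "(\<integral>x. indicator (B m) x * (exp (\<theta> * x) - 1) \<partial>\<nu>) - \<theta> * c m =
            (\<integral>x. indicator (B m) x * (exp (\<theta> * x) - 1) - \<theta> * (indicator (B m) x * (x * indicator {-1..1} x)) \<partial>\<nu>)"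
          unfolding c_def using i2 Ic[of m] by simp
        also have "\<dots> \<le> (\<integral>x. (\<theta>\<^sup>2 * exp \<theta>) * min 1 (x\<^sup>2) \<partial>\<nu>)"
        proof (rule integral_mono)
          fix x
          show "indicator (B m) x * (exp (\<theta> * x) - 1) - \<theta> * (indicator (B m) x * (x * indicator {-1..1} x))
              \<le> (\<theta>\<^sup>2 * exp \<theta>) * min 1 (x\<^sup>2)"
          proof (cases "x \<in> B m")
            case True
            show ?thesis
            proof (cases "\<bar>x\<bar> \<le> 1")
              case x: True
              then have "min 1 (x\<^sup>2) = x\<^sup>2" by (simp add: abs_square_le_1 min_absorb2)
              moreover have "x \<in> {-1..1}" using x by auto
              ultimately show ?thesis
                using exp_quadratic_bound[OF x \<theta>] True by simp
            next
              case x: False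
              \<comment> \<open>Jumps below -1 carry no compensator and only lower the exponential
                moment.\<close>
              with True have "x < -1" by (auto simp: B_def)
              then have "exp (\<theta> * x) \<le> 1" using \<theta> by (simp add: mult_le_0_iff)
              moreover have "0 \<le> (\<theta>\<^sup>2 * exp \<theta>) * min 1 (x\<^sup>2)" by simp
              moreover have "indicator (B m) x * (exp (\<theta> * x) - 1) -
                  \<theta> * (indicator (B m) x * (x * indicator {-1..1} x)) = exp (\<theta> * x) - 1"
                using x True by (auto simp: indicator_def)
              ultimately show ?thesis by linarith
            qed
          qed simp
        qed (use i2 Ic[of m] I0 in auto)
        also have "\<dots> = (\<theta>\<^sup>2 * exp \<theta>) * (\<integral>x. min 1 (x\<^sup>2) \<partial>\<nu>)" by simp
        finally have le: "(\<integral>x. indicator (B m) x * (exp (\<theta> * x) - 1) \<partial>\<nu>) - \<theta> * c m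
            \<le> (\<theta>\<^sup>2 * exp \<theta>) * (\<integral>x. min 1 (x\<^sup>2) \<partial>\<nu>)" .
        have tA: "t * A \<ge> 0" using t A by simp
        have "(\<integral>\<^sup>+x. exp (\<theta> * x) \<partial>M m) = ennreal (exp (\<theta> * (t * (b - c m)) + t * A * \<theta>\<^sup>2 / 2)) *
            ennreal (exp (t * (\<integral>x. indicator (B m) x * (exp (\<theta> * x) - 1) \<partial>\<nu>)))"
          unfolding M_def nn_integral_exp_convolution[OF real_distribution_gauss real_distribution_jump_part[OF \<nu> B finB t]]
            nn_integral_exp_gauss[OF tA] nn_integral_exp_jump_part[OF \<nu> B finB t i1] by (rule refl)
        also have "\<dots> = ennreal (exp (t * (\<theta> * b + A * \<theta>\<^sup>2 / 2 +
            ((\<integral>x. indicator (B m) x * (exp (\<theta> * x) - 1) \<partial>\<nu>) - \<theta> * c m))))"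
          unfolding ennreal_mult[OF exp_ge_zero exp_ge_zero, symmetric] exp_add[symmetric]
          by (rule arg_cong[where f="\<lambda>x. ennreal (exp x)"]) (simp add: algebra_simps)
        also have "\<dots> \<le> ennreal (exp Q)"
          unfolding Q_def using t le by (intro ennreal_leI) (simp add: mult_left_mono)
        finally show ?thesis .
      qed
      then have "(\<integral>\<^sup>+x. exp (\<theta> * x) \<partial>N) \<le> ennreal (exp Q)"
        by (intro weak_conv_nn_integral_exp_le[OF RM N(1,3)]) auto
      then show "(\<integral>\<^sup>+x. exp (\<theta> * x) \<partial>N) < \<infinity>"
        by (rule le_less_trans) simp
    qed
    with N show ?thesis by auto
  qed
  then obtain \<zeta> where \<zeta>: "\<And>t. t > 0 \<Longrightarrow> real_distribution (\<zeta> t) \<and> light_tailed (\<zeta> t) \<and>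
      (\<forall>z. char (\<zeta> t) z = exp (of_real t * \<Phi> z))" by metis
  show ?thesis
  proof (rule that[of \<Psi> \<zeta>])
    show "char \<mu> z = exp (\<Psi> z)" for z
      unfolding char\<mu> \<Psi>_def J_def by simp
    show "exp (of_real t * \<Psi> z) = char (jump_part \<nu> {1<..} t) z * char (\<zeta> t) z" if "t > 0" for t z
    proof -
      have "char (jump_part \<nu> {1<..} t) z = exp (of_real t * (CLINT x|\<nu>. indicator {1<..} x *\<^sub>R (iexp (z * x) - 1)))"
        by (rule char_jump_part[OF \<nu> _ fin1 that]) simp
      then show ?thesis
        using \<zeta>[OF that] by (simp only: \<Psi>\<Phi> distrib_left exp_add mult.commute)
    qed
  qed (use \<Psi>_cont \<zeta> fin1 in \<open>auto simp: \<Psi>_def J_0\<close>)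
qed

section \<open>O-subexponential compound Poisson semigroups\<close>

lemma pmf_mult_le_integral:
  fixes f :: "'a \<Rightarrow> real"
  assumes "\<And>k. 0 \<le> f k" "\<And>k. f k \<le> 1"
  shows "pmf p k * f k \<le> (\<integral>j. f j \<partial>measure_pmf p)"
proof -
  have "pmf p k * f k = (\<integral>j. indicator {k} j * f k \<partial>measure_pmf p)"
    by (simp add: measure_pmf_single)
  also have "\<dots> \<le> (\<integral>j. f j \<partial>measure_pmf p)"
    using assms
    by (intro integral_mono measure_pmf.integrable_const_bound[where B=1])
       (auto simp: indicator_def)
  finally show ?thesis .
qed

text \<open>Multiplied by the Poisson weights the terms become a geometric series of ratio
  1/2.\<close>

lemma integrable_poisson_fact_power:
  assumes "l > 0"
  shows "integrable (measure_pmf (poisson_pmf l)) (\<lambda>k. C * (fact k / (2 * l) ^ k) :: real)"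
proof -
  have "pmf (poisson_pmf l) k *\<^sub>R (C * (fact k / (2 * l) ^ k)) = C * exp (- l) * (1 / 2) ^ k" for k
    using assms by (simp add: power_mult_distrib power_divide field_simps)
  moreover have "summable (\<lambda>k. norm (C * exp (- l) * (1 / 2) ^ k))"
    unfolding norm_mult norm_power by (intro summable_mult summable_geometric) simp
  ultimately have "integrable (count_space UNIV) (\<lambda>k. pmf (poisson_pmf l) k *\<^sub>R (C * (fact k / (2 * l) ^ k)))"
    by (simp only: integrable_count_space_nat_iff)
  then show ?thesis
    unfolding measure_pmf_eq_density by (subst integrable_density) auto
qed

text \<open>\<open>N\<close> is the normalised law of the jumps above 1, \<open>l\<close> their
  rate, and \<open>\<zeta> t\<close> the remainder at time \<open>t\<close>.
  \<open>tail N 0 = 1\<close> says that jumps are almost surely positive.\<close>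

locale OS_compound_semigroup = OS_semigroup +
  fixes l :: real and N :: "real measure" and \<zeta> :: "real \<Rightarrow> real measure"
  assumes l: "l > 0" and N: "real_distribution N" and N_pos: "tail N 0 = 1"
    and \<zeta>: "t > 0 \<Longrightarrow> real_distribution (\<zeta> t)" "t > 0 \<Longrightarrow> light_tailed (\<zeta> t)"
    and P_eq: "t > 0 \<Longrightarrow> P t = (compound_poisson (t * l) N \<star> \<zeta> t)"
begin

abbreviation "CP t \<equiv> compound_poisson (t * l) N"

lemma rate_pos: "t > 0 \<Longrightarrow> t * l > 0" using l by simp

lemma real_distribution_CP: "t > 0 \<Longrightarrow> real_distribution (CP t)"
  using rate_pos N by (intro real_distribution_compound_poisson)

lemma real_distribution_pow: "real_distribution (conv_pow N k)"
  using N by (rule real_distribution_conv_pow)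

lemma pow_measure_le_1: "measure (conv_pow N k) A \<le> 1"
  using real_distribution_pow[of k] unfolding real_distribution_def by (blast intro: prob_space.prob_le_1)

lemma controlled_CP: "t > 0 \<Longrightarrow> controlled (CP t)"
  using controlled_factor[OF real_distribution_CP \<zeta>(1)] controlled_P P_eq by metis

lemma tail_CP: "t > 0 \<Longrightarrow> tail (CP t) x = (\<integral>k. tail (conv_pow N k) x \<partial>poisson_pmf (t * l))"
  unfolding tail_def using rate_pos N by (intro measure_compound_poisson) auto

lemma unit_mass_CP: "t > 0 \<Longrightarrow> unit_mass (CP t) x = (\<integral>k. unit_mass (conv_pow N k) x \<partial>poisson_pmf (t * l))"
  unfolding unit_mass_def using rate_pos N by (intro measure_compound_poisson) auto

lemma tail_CP_ge: "t > 0 \<Longrightarrow> pmf (poisson_pmf (t * l)) k * tail (conv_pow N k) x \<le> tail (CP t) x"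
  unfolding tail_CP by (intro pmf_mult_le_integral) (auto simp: tail_def pow_measure_le_1)

lemma unit_mass_CP_ge:
  "t > 0 \<Longrightarrow> pmf (poisson_pmf (t * l)) k * unit_mass (conv_pow N k) x \<le> unit_mass (CP t) x"
  unfolding unit_mass_CP by (intro pmf_mult_le_integral) (auto simp: unit_mass_def pow_measure_le_1)

text \<open>Comparing with the law at time \<open>2 t\<close> bounds the jump powers well enough for them to be summed
  against the Poisson weights of time \<open>t\<close>.\<close>

lemma tail_pow_bound:
  assumes t: "t > 0"
  obtains C where "C > 0" "\<And>k x. tail (conv_pow N k) x \<le> C * (fact k / (2 * (t * l)) ^ k) * tail \<mu> x"
proof -
  have t2: "2 * t > 0" using t by simp
  obtain C where C: "C > 0" "\<And>x. tail (CP (2 * t)) x \<le> C * tail \<mu> x"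
    using controlledE[OF controlled_CP[OF t2]] by blast
  have "tail (conv_pow N k) x \<le> (C * exp (2 * t * l)) * (fact k / (2 * (t * l)) ^ k) * tail \<mu> x" for k x
  proof -
    have "(2 * (t * l)) ^ k / fact k * exp (- (2 * t * l)) * tail (conv_pow N k) x \<le> C * tail \<mu> x"
      using tail_CP_ge[OF t2, of k x] C(2)[of x] rate_pos[OF t2] by (simp add: mult.assoc)
    moreover have "(2 * (t * l)) ^ k > 0" using rate_pos[OF t] by simp
    ultimately show ?thesis by (simp add: exp_minus field_simps)
  qed
  then show ?thesis using C by (intro that[of "C * exp (2 * t * l)"]) auto
qed

lemma controlled_pow: "controlled (conv_pow N k)"
  using tail_pow_bound[of 1] controlledI[OF real_distribution_pow] by (metis zero_less_one)

text \<open>A further positive jump can only increase the sum.\<close>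

lemma tail_pow_mono: "k \<le> m \<Longrightarrow> tail (conv_pow N k) x \<le> tail (conv_pow N m) x"
proof (induction m rule: dec_induct)
  case (step m)
  have "tail (conv_pow N m) x \<le> tail (conv_pow N (Suc m)) x"
    using tail_convolution_ge[OF N real_distribution_pow[of m], of 0 x] N_pos by simp
  with step show ?case by linarith
qed simp

text \<open>With error \<open>1/2 * tail \<mu> x\<close> in
  \<open>light_convolution_tail_le\<close>, half of the left-hand side absorbs it; a shift by
  \<open>a\<close> gives the lower bound.\<close>

lemma comparable_CP_1: "comparable (CP 1)"
proof -
  have one: "(0::real) < 1" by simp
  have \<mu>: "\<mu> = (\<zeta> 1 \<star> CP 1)"
    using P_eq[OF one] P_1 convolution_commute[OF real_distribution_CP[OF one] \<zeta>(1)[OF one]] by simp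
  obtain a where a: "\<And>x. tail (\<zeta> 1 \<star> CP 1) x \<le> tail (CP 1) (x - a) + 1 / 2 * tail \<mu> x"
    using light_convolution_tail_le[OF controlled_CP[OF one] \<zeta>(1)[OF one] \<zeta>(2)[OF one], of "1/2"] by auto
  obtain C where C: "C > 0" "\<And>x. tail \<mu> (x - a) \<le> C * tail \<mu> x" using tail_shift[of a] by blast
  have "1 / (2 * C) * tail \<mu> x \<le> tail (CP 1) x" for x
  proof -
    have "tail \<mu> (x + a) \<le> tail (CP 1) (x + a - a) + 1 / 2 * tail \<mu> (x + a)"
      using a[of "x + a"] by (simp only: \<mu>[symmetric])
    then have a': "tail \<mu> (x + a) \<le> 2 * tail (CP 1) x" by simp
    have "tail \<mu> x \<le> C * tail \<mu> (x + a)" using C(2)[of "x + a"] by simp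
    also have "\<dots> \<le> C * (2 * tail (CP 1) x)"
      using a' C(1) by (intro mult_left_mono) auto
    finally show ?thesis using C(1) by (simp add: field_simps)
  qed
  then show ?thesis
    unfolding comparable_def using C controlled_CP[OF one]
    by (intro conjI exI[of _ "1 / (2 * C)"]) auto
qed

text \<open>The Poisson terms beyond \<open>m\<close> contribute less than
  \<open>c / 2 * tail \<mu> x\<close>, and by monotonicity all earlier ones are bounded by the tail
  of power \<open>m\<close>. That tail must carry the other half of the lower bound. This also shows
  that \<open>OS_index N\<close> is attained.\<close>

lemma exists_comparable_pow: "\<exists>m\<ge>1. comparable (conv_pow N m)"
proof -
  have one: "(0::real) < 1" by simp
  obtain c where c: "c > 0" "\<And>x. c * tail \<mu> x \<le> tail (CP 1) x"
    using comparable_CP_1 by (auto simp: comparable_def)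
  obtain C where C: "C > 0" "\<And>k x. tail (conv_pow N k) x \<le> C * (fact k / (2 * (1 * l)) ^ k) * tail \<mu> x"
    using tail_pow_bound[OF one] by blast
  define w where "w k = C * (fact k / (2 * l) ^ k)" for k
  have w: "w k \<ge> 0" "tail (conv_pow N k) x \<le> w k * tail \<mu> x" for k x
    using C l by (auto simp: w_def)
  let ?p = "measure_pmf (poisson_pmf l)"
  have Iw: "integrable ?p w"
    unfolding w_def by (rule integrable_poisson_fact_power[OF l])
  have Iwm: "integrable ?p (\<lambda>k. indicator {m<..} k * w k)" for m
    by (rule Bochner_Integration.integrable_bound[OF Iw]) (auto simp: indicator_def)
  have "(\<lambda>m. \<integral>k. indicator {m<..} k * w k \<partial>?p) \<longlonglongrightarrow> (\<integral>k. 0 \<partial>?p)"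
  proof (rule integral_dominated_convergence[OF _ _ Iw])
    show "AE k in ?p. (\<lambda>m. indicator {m<..} k * w k) \<longlonglongrightarrow> 0"
    proof (rule AE_I2)
      fix k
      have "\<forall>\<^sub>F m in sequentially. indicator {m<..} k * w k = 0"
        using eventually_ge_at_top[of k] by eventually_elim auto
      then show "(\<lambda>m. indicator {m<..} k * w k) \<longlonglongrightarrow> 0" by (rule tendsto_eventually)
    qed
  qed (use w in \<open>auto simp: indicator_def\<close>)
  then have "(\<lambda>m. \<integral>k. indicator {m<..} k * w k \<partial>?p) \<longlonglongrightarrow> 0" by simp
  then have "\<forall>\<^sub>F m in sequentially. (\<integral>k. indicator {m<..} k * w k \<partial>?p) < c / 2"
    using c by (intro order_tendstoD) auto
  then have "\<forall>\<^sub>F m in sequentially. 1 \<le> m \<and> (\<integral>k. indicator {m<..} k * w k \<partial>?p) < c / 2"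
    using eventually_ge_at_top[of 1] by eventually_elim auto
  from eventually_happens'[OF sequentially_bot this]
  obtain m where m: "1 \<le> m" "(\<integral>k. indicator {m<..} k * w k \<partial>?p) < c / 2"
    by blast
  have "c / 2 * tail \<mu> x \<le> tail (conv_pow N m) x" for x
  proof -
    have "c * tail \<mu> x \<le> (\<integral>k. tail (conv_pow N k) x \<partial>?p)"
      using c(2)[of x] tail_CP[OF one, of x] by simp
    also have "\<dots> \<le> (\<integral>k. tail (conv_pow N m) x + (indicator {m<..} k * w k) * tail \<mu> x \<partial>?p)"
    proof (rule integral_mono)
      show "integrable ?p (\<lambda>k. tail (conv_pow N k) x)"
        by (intro measure_pmf.integrable_const_bound[where B=1]) (auto simp: tail_le_1[OF real_distribution_pow])
      show "integrable ?p (\<lambda>k. tail (conv_pow N m) x + (indicator {m<..} k * w k) * tail \<mu> x)"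
        using Iwm[of m] by (intro Bochner_Integration.integrable_add integrable_mult_left) auto
      fix k
      show "tail (conv_pow N k) x \<le> tail (conv_pow N m) x + (indicator {m<..} k * w k) * tail \<mu> x"
      proof (cases "k \<le> m")
        case True
        then show ?thesis using tail_pow_mono[OF True, of x] by simp
      next
        case False
        then show ?thesis using w(2)[of k x] by (simp add: add_increasing)
      qed
    qed
    also have "\<dots> = tail (conv_pow N m) x + (\<integral>k. indicator {m<..} k * w k \<partial>?p) * tail \<mu> x"
    proof -
      have "integrable ?p (\<lambda>k. (indicator {m<..} k * w k) * tail \<mu> x)"
        using Iwm[of m] by (intro integrable_mult_left) auto
      then show ?thesis by (subst Bochner_Integration.integral_add) auto
    qed
    also have "\<dots> \<le> tail (conv_pow N m) x + c / 2 * tail \<mu> x"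
      using m(2) by (intro add_left_mono mult_right_mono) auto
    finally show ?thesis by simp
  qed
  then show ?thesis
    using m(1) c(1) controlled_pow unfolding comparable_def by (metis half_gt_zero)
qed

lemma comparable_pow_mono:
  assumes "comparable (conv_pow N k)" "k \<le> m" shows "comparable (conv_pow N m)"
  using assms controlled_pow[of m] tail_pow_mono[OF assms(2)]
  unfolding comparable_def by (meson order_trans)

text \<open>If power \<open>n\<close> is in OS, it dominates its own \<open>m\<close>-th power, that
  is, power \<open>n * m\<close>. For \<open>m\<close> with a comparable power, the latter is at
  least of order \<open>tail \<mu>\<close> because \<open>n * m \<ge> m\<close>.\<close>

lemma pow_OS_iff:
  assumes "n \<ge> 1"
  shows "conv_pow N n \<in> class_OS \<longleftrightarrow> comparable (conv_pow N n)"
proof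
  assume OS_n: "conv_pow N n \<in> class_OS"
  interpret Q: OS_distribution "conv_pow N n" by unfold_locales (rule OS_n)
  obtain m where m: "m \<ge> 1" "comparable (conv_pow N m)" using exists_comparable_pow by blast
  obtain c where c: "c > 0" "\<And>x. c * tail \<mu> x \<le> tail (conv_pow N m) x"
    using m(2) by (auto simp: comparable_def)
  obtain C where C: "C > 0" "\<And>x. tail (conv_pow (conv_pow N n) m) x \<le> C * tail (conv_pow N n) x"
    using Q.controlledE[OF Q.controlled_conv_pow[OF Q.controlled_self m(1)]] by blast
  have "c / C * tail \<mu> x \<le> tail (conv_pow N n) x" for x
  proof -
    have "m \<le> n * m" using assms by simp
    then have "c * tail \<mu> x \<le> tail (conv_pow N (n * m)) x"
      using c(2)[of x] tail_pow_mono[of m "n * m" x] by linarith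
    also have "\<dots> \<le> C * tail (conv_pow N n) x"
      using C(2) by (simp add: conv_pow_mult[OF N])
    finally show ?thesis using C(1) by (simp add: field_simps)
  qed
  then show "comparable (conv_pow N n)"
    using c C controlled_pow unfolding comparable_def by (meson divide_pos_pos)
qed (rule comparable_imp_OS)

text \<open>Reaches times below 1: the term with exactly \<open>m\<close> jumps has positive Poisson
  weight at every time.\<close>

lemma comparable_P_all:
  assumes t: "t > 0" shows "comparable (P t)"
proof -
  obtain m where m: "m \<ge> 1" "comparable (conv_pow N m)" using exists_comparable_pow by blast
  obtain c where c: "c > 0" "\<And>x. c * tail \<mu> x \<le> tail (conv_pow N m) x"
    using m(2) by (auto simp: comparable_def)
  have p: "pmf (poisson_pmf (t * l)) m > 0" using rate_pos[OF t] by simp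
  have "(pmf (poisson_pmf (t * l)) m * c) * tail \<mu> x \<le> tail (CP t) x" for x
    using order_trans[OF mult_left_mono[OF c(2)[of x] pmf_nonneg] tail_CP_ge[OF t, of m x]]
    by (simp only: mult.assoc)
  then have "comparable (CP t)"
    unfolding comparable_def using p c controlled_CP[OF t] mult_pos_pos by blast
  then show ?thesis
    unfolding P_eq[OF t]
    by (intro comparable_convolution light_tailed_imp_controlled \<zeta> t)
qed

text \<open>Each power of \<open>N\<close> has negligible unit masses, and
  \<open>tail_pow_bound\<close> supplies a Poisson-integrable majorant, so the limit may be taken
  inside the mixture.\<close>

lemma negligible_mass_P:
  assumes "negligible_mass N" and t: "t > 0"
  shows "negligible_mass (P t)"
proof -
  let ?p = "measure_pmf (poisson_pmf (t * l))"
  obtain C where C: "C > 0" "\<And>k x. tail (conv_pow N k) x \<le> C * (fact k / (2 * (t * l)) ^ k) * tail \<mu> x"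
    using tail_pow_bound[OF t] by blast
  have N': "controlled N" using controlled_pow[of 1] by (simp add: convolution_return_0 N)
  have "((\<lambda>x. \<integral>k. unit_mass (conv_pow N k) x / tail \<mu> x \<partial>?p) \<longlongrightarrow> (\<integral>k. 0 \<partial>?p)) at_top"
  proof (rule integral_dominated_convergence_at_top)
    show "integrable ?p (\<lambda>k. C * (fact k / (2 * (t * l)) ^ k))"
      by (rule integrable_poisson_fact_power[OF rate_pos[OF t]])
    show "\<forall>\<^sub>F x in at_top. AE k in ?p. norm (unit_mass (conv_pow N k) x / tail \<mu> x) \<le> C * (fact k / (2 * (t * l)) ^ k)"
    proof (intro always_eventually allI AE_I2)
      fix x k
      have "unit_mass (conv_pow N k) x \<le> C * (fact k / (2 * (t * l)) ^ k) * tail \<mu> x"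
        using unit_mass_le_tail[OF real_distribution_pow[of k], of x] C(2)[of k x] by linarith
      then show "norm (unit_mass (conv_pow N k) x / tail \<mu> x) \<le> C * (fact k / (2 * (t * l)) ^ k)"
        using tail_pos[of x] by (simp add: pos_divide_le_eq)
    qed
    show "AE k in ?p. ((\<lambda>x. unit_mass (conv_pow N k) x / tail \<mu> x) \<longlongrightarrow> 0) at_top"
    proof (rule AE_I2)
      fix k
      show "((\<lambda>x. unit_mass (conv_pow N k) x / tail \<mu> x) \<longlongrightarrow> 0) at_top"
      \<comment> \<open>Zero jumps give the point mass at 0, which does not charge the intervals to
        the right of 0.\<close>
      proof (cases "k = 0")
        case True
        have "\<forall>\<^sub>F x in at_top. unit_mass (conv_pow N k) x / tail \<mu> x = 0"
          using eventually_ge_at_top[of 0] by eventually_elim (simp add: True unit_mass_def measure_return)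
        then show ?thesis by (rule tendsto_eventually)
      next
        case False
        then show ?thesis
          using negligible_mass_conv_pow[OF N' assms(1), of k] by (simp add: negligible_mass_def)
      qed
    qed
  qed auto
  then have "negligible_mass (CP t)"
    by (simp add: negligible_mass_def unit_mass_CP[OF t])
  then show ?thesis
    unfolding P_eq[OF t]
    by (rule negligible_mass_convolution[OF controlled_CP[OF t] _
          light_tailed_imp_controlled(1)[OF \<zeta>[OF t]] light_tailed_imp_negligible_mass[OF \<zeta>[OF t]]])
qed

text \<open>Backwards, \<open>CP 1\<close> is a factor of \<mu>, and its one-jump term is a positive
  multiple of \<open>N\<close>.\<close>

lemma negligible_mass_jump_iff: "negligible_mass N \<longleftrightarrow> negligible_mass \<mu>"
proof
  assume "negligible_mass N"
  then show "negligible_mass \<mu>" using negligible_mass_P[of 1] by (simp add: P_1)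
next
  have one: "(0::real) < 1" by simp
  assume "negligible_mass \<mu>"
  then have CP1: "negligible_mass (CP 1)"
    using negligible_mass_factor[OF real_distribution_CP[OF one] \<zeta>(1)[OF one]] P_eq[OF one] P_1 by simp
  define p where "p = pmf (poisson_pmf (1 * l)) 1"
  have p: "p > 0" using l by (simp add: p_def)
  show "negligible_mass N"
    unfolding negligible_mass_def
  proof (rule tendsto_sandwich[OF _ _ tendsto_const])
    show "((\<lambda>x. 1 / p * (unit_mass (CP 1) x / tail \<mu> x)) \<longlongrightarrow> 0) at_top"
      using CP1 unfolding negligible_mass_def by (rule tendsto_mult_right_zero)
    show "\<forall>\<^sub>F x in at_top. unit_mass N x / tail \<mu> x \<le> 1 / p * (unit_mass (CP 1) x / tail \<mu> x)"
    proof (intro always_eventually allI)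
      fix x
      have "p * unit_mass N x \<le> unit_mass (CP 1) x"
        using unit_mass_CP_ge[OF one, of 1 x] by (simp add: p_def convolution_return_0 N)
      then show "unit_mass N x / tail \<mu> x \<le> 1 / p * (unit_mass (CP 1) x / tail \<mu> x)"
        using p tail_pos[of x] by (simp add: field_simps)
    qed
  qed (simp add: divide_nonneg_nonneg)
qed

text \<open>Time 1 alone already determines the jump condition, which then serves all times.\<close>

theorem semigroup_L0_iff: "(\<forall>t>0. P t \<in> class_L0) \<longleftrightarrow> negligible_mass N"
proof
  assume "\<forall>t>0. P t \<in> class_L0"
  then have "\<mu> \<in> class_L0" using P_1 by (metis zero_less_one)
  then show "negligible_mass N"
    by (simp add: comparable_L0_iff comparable_self negligible_mass_jump_iff)
qed (auto simp: comparable_L0_iff comparable_P_all negligible_mass_P)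

lemma OS_index_comparable: "OS_index N \<ge> 1" "comparable (conv_pow N (OS_index N))"
proof -
  have "\<exists>n. n \<ge> 1 \<and> conv_pow N n \<in> class_OS"
    using exists_comparable_pow pow_OS_iff by blast
  from LeastI_ex[OF this] show "OS_index N \<ge> 1" "comparable (conv_pow N (OS_index N))"
    using pow_OS_iff by (auto simp: OS_index_def)
qed

lemma comparable_pow_iff: "n \<ge> 1 \<Longrightarrow> comparable (conv_pow N n) \<longleftrightarrow> OS_index N \<le> n"
  using pow_OS_iff[of n] comparable_pow_mono[OF OS_index_comparable(2), of n]
  by (auto simp: OS_index_def intro: Least_le)

lemma negligible_mass_jump_iff_ratio:
  "negligible_mass N \<longleftrightarrow>
     ((\<lambda>x. measure N {x<..x + 1} / tail (conv_pow N (OS_index N)) x) \<longlongrightarrow> 0) at_top"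
  using comparable_ratio_tendsto_0_iff[OF OS_index_comparable(2), of "unit_mass N"]
  by (simp add: negligible_mass_def unit_mass_def)

lemma pow_L0_OS_iff:
  assumes "negligible_mass N" "n \<ge> 1"
  shows "conv_pow N n \<in> class_L0 \<inter> class_OS \<longleftrightarrow> OS_index N \<le> n"
proof -
  have N': "controlled N" using controlled_pow[of 1] by (simp add: convolution_return_0 N)
  have "negligible_mass (conv_pow N n)"
    using N' assms by (rule negligible_mass_conv_pow)
  then show ?thesis
    using comparable_L0_iff[of "conv_pow N n"] pow_OS_iff[OF assms(2)] comparable_pow_iff[OF assms(2)] by auto
qed

end

section \<open>From the Levy measure to the compound Poisson semigroup\<close>

lemma (in OS_distribution) not_light_tailed: "\<not> light_tailed \<mu>"
proof
  assume "light_tailed \<mu>"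
  then have "((\<lambda>x. tail \<mu> x / tail \<mu> x) \<longlongrightarrow> 0) at_top"
    by (rule light_tailed_imp_controlled[OF real_dist])
  then have "((\<lambda>x :: real. 1 :: real) \<longlongrightarrow> 0) at_top"
    by (simp add: less_imp_neq[OF tail_pos, symmetric])
  then show False by (simp add: tendsto_const_iff)
qed

text \<open>Otherwise the jumps above 1 are bounded by \<open>c\<close>, so their compound Poisson
  law and hence \<mu> are light-tailed. At \<open>c = 1\<close> this makes the jump rate positive
  and the normalised jump law a distribution.\<close>

lemma (in OS_distribution) levy_measure_unbounded:
  assumes levy: "is_levy_measure \<mu> \<nu>" and c: "c \<ge> 1"
  shows "emeasure \<nu> {c<..} \<noteq> 0"
proof
  assume 0: "emeasure \<nu> {c<..} = 0"
  have \<nu>: "sets \<nu> = sets borel" using levy by (simp add: is_levy_measure_def)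
  obtain \<Psi> \<zeta> where D: "\<And>z. char \<mu> z = exp (\<Psi> z)"
    "\<And>t. t > 0 \<Longrightarrow> real_distribution (\<zeta> t)" "\<And>t. t > 0 \<Longrightarrow> light_tailed (\<zeta> t)"
    "\<And>t z. t > 0 \<Longrightarrow> exp (of_real t * \<Psi> z) = char (jump_part \<nu> {1<..} t) z * char (\<zeta> t) z"
    and fin: "emeasure \<nu> {1<..} \<noteq> \<infinity>"
    using levy_decomposition[OF levy] by metis
  have J: "real_distribution (jump_part \<nu> {1<..} 1)"
    using \<nu> fin by (intro real_distribution_jump_part) auto
  have "\<mu> = (jump_part \<nu> {1<..} 1 \<star> \<zeta> 1)"
    using D(1) D(2)[of 1] D(4)[of 1] J
    by (intro Levy_uniqueness real_dist real_distribution_convolution) (auto simp: fun_eq_iff char_convolution)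
  moreover have "light_tailed (jump_part \<nu> {1<..} 1)"
    unfolding light_tailed_iff_nn_integral[OF J]
  proof (intro allI impI)
    fix \<theta> :: real assume \<theta>: "\<theta> > 0"
    have "AE x in \<nu>. x \<notin> {c<..}"
      using 0 \<nu> by (intro AE_not_in) (auto simp: null_sets_def)
    then have "AE x in \<nu>. x \<in> {1<..} \<longrightarrow> norm (exp (\<theta> * x)) \<le> exp (\<theta> * c)"
      by eventually_elim (use \<theta> in auto)
    then have "integrable \<nu> (\<lambda>x. indicator {1<..} x *\<^sub>R exp (\<theta> * x))"
      using \<nu> fin
      by (intro integrableI_bounded_set_indicator[where B="exp (\<theta> * c)"])
         (auto simp: less_top cong: measurable_cong_sets)
    then have "integrable \<nu> (\<lambda>x. indicator {1<..} x * exp (\<theta> * x))" by simp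
    then show "(\<integral>\<^sup>+x. exp (\<theta> * x) \<partial>jump_part \<nu> {1<..} 1) < \<infinity>"
      using \<nu> fin by (subst nn_integral_exp_jump_part) auto
  qed
  ultimately have "light_tailed \<mu>"
    using light_tailed_convolution[OF J D(2)[of 1] _ D(3)[of 1]] by simp
  then show False using not_light_tailed by simp
qed

text \<open>The Levy-Khintchine exponent is a continuous logarithm vanishing at 0, so
  \<open>conv_rpow_eqI\<close> identifies each real power with its jump decomposition.\<close>

theorem levy_OS_compound_semigroup:
  assumes \<mu>: "\<mu> \<in> class_OS" and levy: "is_levy_measure \<mu> \<nu>"
  shows "\<exists>\<zeta>. OS_compound_semigroup \<mu> (conv_rpow \<mu>) (measure \<nu> {1<..}) (levy_tail_dist \<nu>) \<zeta>"
proof -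
  interpret OS_distribution \<mu> by unfold_locales (rule \<mu>)
  have \<nu>: "sets \<nu> = sets borel" using levy by (simp add: is_levy_measure_def)
  obtain \<Psi> \<zeta> where \<Psi>: "continuous_on UNIV \<Psi>" "\<Psi> 0 = 0" "\<And>z. char \<mu> z = exp (\<Psi> z)"
    and \<zeta>: "\<And>t. t > 0 \<Longrightarrow> real_distribution (\<zeta> t)" "\<And>t. t > 0 \<Longrightarrow> light_tailed (\<zeta> t)"
    and D: "\<And>t z. t > 0 \<Longrightarrow> exp (of_real t * \<Psi> z) = char (jump_part \<nu> {1<..} t) z * char (\<zeta> t) z"
    and fin: "emeasure \<nu> {1<..} \<noteq> \<infinity>"
    using levy_decomposition[OF levy] by metis
  have pos: "emeasure \<nu> {1<..} \<noteq> 0" by (rule levy_measure_unbounded[OF levy]) simp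
  have l: "measure \<nu> {1<..} > 0"
    using pos fin by (simp add: measure_def enn2real_positive_iff less_top zero_less_iff_neq_zero)
  have J_eq: "jump_part \<nu> {1<..} t = compound_poisson (t * measure \<nu> {1<..}) (levy_tail_dist \<nu>)" for t
    using l by (simp add: jump_part_def levy_tail_dist_def)
  have J: "real_distribution (jump_part \<nu> {1<..} t)" if "t > 0" for t
    using \<nu> fin that by (intro real_distribution_jump_part) auto
  have P_eq: "conv_rpow \<mu> t = (jump_part \<nu> {1<..} t \<star> \<zeta> t)" if "t > 0" for t
    using \<Psi> D[OF that] \<zeta>[OF that] J[OF that]
    by (intro conv_rpow_eqI[of _ \<Psi>] real_distribution_convolution) (auto simp: char_convolution)
  have R: "real_distribution (conv_rpow \<mu> t)" if "t > 0" for t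
    unfolding P_eq[OF that] by (intro real_distribution_convolution J \<zeta> that)
  have charP: "char (conv_rpow \<mu> t) z = exp (of_real t * \<Psi> z)" if "t > 0" for t z
    unfolding P_eq[OF that] D[OF that] by (intro char_convolution J \<zeta> that)
  have N: "real_distribution (levy_tail_dist \<nu>)"
    unfolding levy_tail_dist_def using \<nu> pos fin by (intro real_distribution_uniform_measure) auto
  have "OS_compound_semigroup \<mu> (conv_rpow \<mu>) (measure \<nu> {1<..}) (levy_tail_dist \<nu>) \<zeta>"
  proof (intro OS_compound_semigroup.intro OS_semigroup.intro OS_semigroup_axioms.intro
      OS_compound_semigroup_axioms.intro OS_distribution_axioms R l N \<zeta>)
    show "conv_rpow \<mu> (s + t) = (conv_rpow \<mu> s \<star> conv_rpow \<mu> t)" if "s > 0" "t > 0" for s t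
      using that by (intro Levy_uniqueness real_distribution_convolution R)
        (auto simp: fun_eq_iff char_convolution R charP exp_add[symmetric] algebra_simps)
    show "conv_rpow \<mu> 1 = \<mu>"
      using \<Psi> by (intro Levy_uniqueness R real_dist) (auto simp: charP)
    have "measure \<nu> ({1<..} \<inter> {0<..}) = measure \<nu> {1<..}"
      by (rule arg_cong[where f="measure \<nu>"]) auto
    then show "tail (levy_tail_dist \<nu>) 0 = 1"
      unfolding tail_def levy_tail_dist_def using l pos fin \<nu>
      by (subst measure_uniform_measure) auto
    show "conv_rpow \<mu> t = (compound_poisson (t * measure \<nu> {1<..}) (levy_tail_dist \<nu>) \<star> \<zeta> t)" if "t > 0" for t
      using P_eq[OF that] by (simp only: J_eq)
  qed
  then show ?thesis by blast
qed

theorem mainTheorem3: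
  shows "class_C0 = {} \<and> hypothesis_I0 \<and> hypothesis_II0 \<and>
    (\<forall>\<mu> \<nu> \<nu>1 :: real measure. \<forall>n0 :: nat.
       \<mu> \<in> class_OS \<inter> class_ID \<and> is_levy_measure \<mu> \<nu> \<and>
       \<nu>1 = levy_tail_dist \<nu> \<and> n0 = OS_index \<nu>1 \<longrightarrow>
       (\<mu> \<in> class_A0 \<longleftrightarrow>
          ((\<lambda>x. measure \<nu>1 {x<..x + 1} / tail (conv_pow \<nu>1 n0) x) \<longlongrightarrow> 0) at_top) \<and>
       (\<mu> \<in> class_A0 \<longrightarrow>
          (\<forall>n. 1 \<le> n \<and> n < n0 \<longrightarrow> conv_pow \<nu>1 n \<notin> class_L0 \<inter> class_OS) \<and>
          (\<forall>n\<ge>n0. conv_pow \<nu>1 n \<in> class_L0 \<inter> class_OS)))"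
proof (intro conjI class_C0_empty hypothesis_I0_holds hypothesis_II0_holds allI impI; elim conjE)
  fix \<mu> \<nu> \<nu>1 :: "real measure" and n0 :: nat
  assume \<mu>: "\<mu> \<in> class_OS \<inter> class_ID" and levy: "is_levy_measure \<mu> \<nu>"
    and \<nu>1: "\<nu>1 = levy_tail_dist \<nu>" and n0: "n0 = OS_index \<nu>1"
  obtain \<zeta> where "OS_compound_semigroup \<mu> (conv_rpow \<mu>) (measure \<nu> {1<..}) \<nu>1 \<zeta>"
    using levy_OS_compound_semigroup[of \<mu> \<nu>] \<mu> levy \<nu>1 by auto
  then interpret OS_compound_semigroup \<mu> "conv_rpow \<mu>" "measure \<nu> {1<..}" \<nu>1 \<zeta> .
  \<comment> \<open>\<open>T0 \<mu>\<close> contains only positive times by definition, so being all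
    of \<open>{0<..}\<close> means L(0) at every time.\<close>
  have A0: "\<mu> \<in> class_A0 \<longleftrightarrow> negligible_mass \<nu>1"
    unfolding semigroup_L0_iff[symmetric] using \<mu> by (auto simp: class_A0_def T0_def)
  show "\<mu> \<in> class_A0 \<longleftrightarrow>
      ((\<lambda>x. measure \<nu>1 {x<..x + 1} / tail (conv_pow \<nu>1 n0) x) \<longlongrightarrow> 0) at_top"
    unfolding A0 n0 by (rule negligible_mass_jump_iff_ratio)
  {
    fix n assume "\<mu> \<in> class_A0" "1 \<le> n" "n < n0"
    then show "conv_pow \<nu>1 n \<notin> class_L0 \<inter> class_OS"
      using pow_L0_OS_iff[of n] A0 n0 by auto
  }
  {
    fix n assume "\<mu> \<in> class_A0" "n0 \<le> n"
    then show "conv_pow \<nu>1 n \<in> class_L0 \<inter> class_OS"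
      using pow_L0_OS_iff[of n] OS_index_comparable(1) A0 n0 by auto
  }
qed

end
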